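(* Let $\mathcal{M}$ and $\mathcal{N}$ be braided monoidal categories. Assume that $\mathcal{M}$ is pre-rigid and that there is a monoidal adjunction $L\dashv R$ with $R:\mathcal{M}\to\mathcal{N}$ and $L:\mathcal{N}\to\mathcal{M}$, where $L$ and $R$ are both strict monoidal and $L$ is braided monoidal. Then $\mathcal{N}$ is pre-rigid, with pre-dual $N^*=R((LN)^* )$ for every object $N$ in $\mathcal{N}$. If $\overline{(-)^*}:\mathsf{Alg}(\mathcal{M}^{\mathrm{op}})\to\mathsf{Alg}(\mathcal{M})$ has a left adjoint, then $\big((-)^*:\mathcal{N}\to\mathcal{N}^{\mathrm{op}},\ (-)^*:\mathcal{N}^{\mathrm{op}}\to\mathcal{N}\big)$ is a liftable pair of adjoint functors.
   Context: A monoidal category $(\mathcal{C},\otimes,\mathbb{I})$ is (right) pre-rigid if for every object $X$ there are an object $X^*$ (a pre-dual of $X$) and a morphism $\mathrm{ev}_X:X^*\otimes X\to\mathbb{I}$ such that for every object $T$ the map $\mathrm{Hom}_{\mathcal{C}}(T,X^* )\to\mathrm{Hom}_{\mathcal{C}}(T\otimes X,\mathbb{I})$, $u\mapsto \mathrm{ev}_X\circ(u\otimes X)$, is bijective; write $t\mapsto t^\dagger$ for the inverse bijection. Here $X$ also denotes the identity morphism of $X$. Associativity and unit constraints are suppressed. A monoidal functor is strict if its structure morphisms are identities. An adjunction $(L,R)$ between two lax monoidal functors is a monoidal adjunction if its unit and counit are monoidal natural transformations. For a pre-rigid braided monoidal category $\mathcal{C}$ with braiding $c$: $\mathcal{C}^{\mathrm{op}}$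 is monoidal with $X^{\mathrm{op}}\otimes Y^{\mathrm{op}}=(X\otimes Y)^{\mathrm{op}}$ and unit $\mathbb{I}^{\mathrm{op}}$. The functor $(-)^*:\mathcal{C}^{\mathrm{op}}\to\mathcal{C}$ sends $X^{\mathrm{op}}$ to $X^*$ and, for $f:X\to Y$, $f^{\mathrm{op}}$ to the unique $f^*:Y^*\to X^*$ with $\mathrm{ev}_X\circ(f^*\otimes X)=\mathrm{ev}_Y\circ(Y^*\otimes f)$. It is lax monoidal via $\phi_2(X^{\mathrm{op}},Y^{\mathrm{op}})=\big((\mathrm{ev}_X\otimes\mathrm{ev}_Y)\circ(X^*\otimes (c_{X,Y^*})^{-1}\otimes Y)\big)^\dagger:X^*\otimes Y^*\to(X\otimes Y)^*$ and $\phi_0=(m_{\mathbb{I}})^\dagger:\mathbb{I}\to\mathbb{I}^*$, where $m_{\mathbb{I}}:\mathbb{I}\otimes\mathbb{I}\to\mathbb{I}$ is the canonical isomorphism. It has as left adjoint its opposite functor $(-)^*:\mathcal{C}\to\mathcal{C}^{\mathrm{op}}$, with unit $\eta_X=(\mathrm{ev}_X\circ c_{X,X^*})^\dagger:X\to X^{**}$ and counit $\epsilon_{X^{\mathrm{op}}}=(j_X)^{\mathrm{op}}$, $j_X=(\mathrm{ev}_X\circ(c_{X^*,X})^{-1})^\dagger$. $\mathsf{Alg}(\mathcal{A})$ and $\mathsf{Coalg}(\mathcal{A})$ denote the categories of algebra (monoid) and coalgebra (comonoid) objects of a monoidal category $\mathcal{A}$. A lax monoidal functor $F:\mathcal{A}\to\mathcal{B}$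 induces $\overline{F}=\mathsf{Alg}(F):\mathsf{Alg}(\mathcal{A})\to\mathsf{Alg}(\mathcal{B})$, $(A,m,u)\mapsto(FA,Fm\circ\phi_2(A,A),Fu\circ\phi_0)$. If $F$ has a left adjoint $E$ with unit $\eta$ and counit $\epsilon$, then $E$ is colax monoidal via $\psi_2(X,Y)=\epsilon_{EX\otimes EY}\circ E\phi_2(EX,EY)\circ E(\eta_X\otimes\eta_Y)$, $\psi_0=\epsilon_{\mathbb{I}_{\mathcal{A}}}\circ E\phi_0$, and induces $\underline{E}=\mathsf{Coalg}(E):\mathsf{Coalg}(\mathcal{B})\to\mathsf{Coalg}(\mathcal{A})$, $(C,\Delta,\varepsilon)\mapsto(EC,\psi_2(C,C)\circ E\Delta,\psi_0\circ E\varepsilon)$. The pair $(E,F)$ is called liftable if $\overline{F}$ has a left adjoint and $\underline{E}$ has a right adjoint. *)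

theory Defs
  imports Main
begin

section \<open>Categories, functors, adjunctions\<close>

text \<open>Categories are given by carrier sets of objects and of arrows; every arrow has one source
  and one target. Operations are unspecified outside the carriers.\<close>

record ('o, 'a) category =
  ob :: "'o set"
  arr :: "'a set"
  src :: "'a \<Rightarrow> 'o"
  tgt :: "'a \<Rightarrow> 'o"
  idt :: "'o \<Rightarrow> 'a"
  cmp :: "'a \<Rightarrow> 'a \<Rightarrow> 'a" (infixr "\<cdot>\<index>" 55)

definition hom :: "('o, 'a, 'z) category_scheme \<Rightarrow> 'o \<Rightarrow> 'o \<Rightarrow> 'a set" where
  "hom C X Y = {f \<in> arr C. src C f = X \<and> tgt C f = Y}"

locale category =
  fixes C :: "('o, 'a, 'z) category_scheme" (structure)
  assumes src_ob: "f \<in> arr C \<Longrightarrow> src C f \<in> ob C"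
    and tgt_ob: "f \<in> arr C \<Longrightarrow> tgt C f \<in> ob C"
    and idt_hom: "X \<in> ob C \<Longrightarrow> idt C X \<in> hom C X X"
    and cmp_hom: "\<lbrakk>f \<in> hom C X Y; g \<in> hom C Y Z\<rbrakk> \<Longrightarrow> g \<cdot> f \<in> hom C X Z"
    and cmp_idt_left: "f \<in> hom C X Y \<Longrightarrow> idt C Y \<cdot> f = f"
    and cmp_idt_right: "f \<in> hom C X Y \<Longrightarrow> f \<cdot> idt C X = f"
    and cmp_assoc: "\<lbrakk>f \<in> hom C W X; g \<in> hom C X Y; h \<in> hom C Y Z\<rbrakk>
      \<Longrightarrow> (h \<cdot> g) \<cdot> f = h \<cdot> (g \<cdot> f)"

definition inverse_arrows :: "('o, 'a, 'z) category_scheme \<Rightarrow> 'a \<Rightarrow> 'a \<Rightarrow> bool" where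
  "inverse_arrows C f g \<longleftrightarrow> f \<in> arr C \<and> g \<in> hom C (tgt C f) (src C f)
    \<and> g \<cdot>\<^bsub>C\<^esub> f = idt C (src C f) \<and> f \<cdot>\<^bsub>C\<^esub> g = idt C (tgt C f)"

definition iso_arr :: "('o, 'a, 'z) category_scheme \<Rightarrow> 'a \<Rightarrow> bool" where
  "iso_arr C f \<longleftrightarrow> (\<exists>g. inverse_arrows C f g)"

definition inv_arr :: "('o, 'a, 'z) category_scheme \<Rightarrow> 'a \<Rightarrow> 'a" where
  "inv_arr C f = (THE g. inverse_arrows C f g)"

record ('o1, 'a1, 'o2, 'a2) cat_functor =
  fob :: "'o1 \<Rightarrow> 'o2"
  far :: "'a1 \<Rightarrow> 'a2"

locale cat_functor = A: category A + B: category B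
  for A :: "('o1, 'a1, 'x) category_scheme" and B :: "('o2, 'a2, 'y) category_scheme" +
  fixes F :: "('o1, 'a1, 'o2, 'a2, 'z) cat_functor_scheme"
  assumes fob_ob: "X \<in> ob A \<Longrightarrow> fob F X \<in> ob B"
    and far_hom: "f \<in> hom A X Y \<Longrightarrow> far F f \<in> hom B (fob F X) (fob F Y)"
    and far_idt: "X \<in> ob A \<Longrightarrow> far F (idt A X) = idt B (fob F X)"
    and far_cmp: "\<lbrakk>f \<in> hom A X Y; g \<in> hom A Y Z\<rbrakk>
      \<Longrightarrow> far F (g \<cdot>\<^bsub>A\<^esub> f) = far F g \<cdot>\<^bsub>B\<^esub> far F f"

definition id_functor :: "('o, 'a, 'o, 'a) cat_functor" where
  "id_functor = \<lparr>fob = (\<lambda>X. X), far = (\<lambda>f. f)\<rparr>"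

definition comp_functor ::
  "('o2, 'a2, 'o3, 'a3, 'y) cat_functor_scheme \<Rightarrow> ('o1, 'a1, 'o2, 'a2, 'z) cat_functor_scheme
    \<Rightarrow> ('o1, 'a1, 'o3, 'a3) cat_functor" where
  "comp_functor G F = \<lparr>fob = (\<lambda>X. fob G (fob F X)), far = (\<lambda>f. far G (far F f))\<rparr>"

locale nat_transformation = F: cat_functor A B F + G: cat_functor A B G
  for A :: "('o1, 'a1, 'x) category_scheme" and B :: "('o2, 'a2, 'y) category_scheme"
    and F :: "('o1, 'a1, 'o2, 'a2, 'u) cat_functor_scheme"
    and G :: "('o1, 'a1, 'o2, 'a2, 'v) cat_functor_scheme" +
  fixes \<tau> :: "'o1 \<Rightarrow> 'a2"
  assumes component_hom: "X \<in> ob A \<Longrightarrow> \<tau> X \<in> hom B (fob F X) (fob G X)"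
    and naturality: "f \<in> hom A X Y \<Longrightarrow> \<tau> Y \<cdot>\<^bsub>B\<^esub> far F f = far G f \<cdot>\<^bsub>B\<^esub> \<tau> X"

text \<open>\<open>adjunction A B E F \<eta> \<epsilon>\<close>: the functor \<open>E : B \<rightarrow> A\<close> is left adjoint to \<open>F : A \<rightarrow> B\<close>.\<close>

locale adjunction =
    E: cat_functor B A E + F: cat_functor A B F
  + unit: nat_transformation B B id_functor "comp_functor F E" \<eta>
  + counit: nat_transformation A A "comp_functor E F" id_functor \<epsilon>
  for A :: "('o1, 'a1, 'x) category_scheme" and B :: "('o2, 'a2, 'y) category_scheme"
    and E :: "('o2, 'a2, 'o1, 'a1, 'u) cat_functor_scheme"
    and F :: "('o1, 'a1, 'o2, 'a2, 'v) cat_functor_scheme"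
    and \<eta> :: "'o2 \<Rightarrow> 'a2" and \<epsilon> :: "'o1 \<Rightarrow> 'a1" +
  assumes triangle_left: "X \<in> ob B \<Longrightarrow> \<epsilon> (fob E X) \<cdot>\<^bsub>A\<^esub> far E (\<eta> X) = idt A (fob E X)"
    and triangle_right: "Y \<in> ob A \<Longrightarrow> far F (\<epsilon> Y) \<cdot>\<^bsub>B\<^esub> \<eta> (fob F Y) = idt B (fob F Y)"

definition has_left_adjoint ::
  "('o1, 'a1, 'x) category_scheme \<Rightarrow> ('o2, 'a2, 'y) category_scheme
    \<Rightarrow> ('o1, 'a1, 'o2, 'a2, 'z) cat_functor_scheme \<Rightarrow> bool" where
  "has_left_adjoint A B F \<longleftrightarrow>
    (\<exists>(E :: ('o2, 'a2, 'o1, 'a1) cat_functor) \<eta> \<epsilon>. adjunction A B E F \<eta> \<epsilon>)"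

definition has_right_adjoint ::
  "('o2, 'a2, 'y) category_scheme \<Rightarrow> ('o1, 'a1, 'x) category_scheme
    \<Rightarrow> ('o2, 'a2, 'o1, 'a1, 'z) cat_functor_scheme \<Rightarrow> bool" where
  "has_right_adjoint B A E \<longleftrightarrow>
    (\<exists>(F :: ('o1, 'a1, 'o2, 'a2) cat_functor) \<eta> \<epsilon>. adjunction A B E F \<eta> \<epsilon>)"


section \<open>Monoidal and braided monoidal categories\<close>

text \<open>\<open>\<otimes>\<close> is the tensor product of objects, \<open>\<boxtimes>\<close> that of arrows. Constraints are not assumed to be
  identities: \<open>assc X Y Z : (X \<otimes> Y) \<otimes> Z \<rightarrow> X \<otimes> (Y \<otimes> Z)\<close>, \<open>lun X : I \<otimes> X \<rightarrow> X\<close>, \<open>run X : X \<otimes> I \<rightarrow> X\<close>.\<close>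

record ('o, 'a) monoidal_category = "('o, 'a) category" +
  tob :: "'o \<Rightarrow> 'o \<Rightarrow> 'o" (infixr "\<otimes>\<index>" 70)
  tar :: "'a \<Rightarrow> 'a \<Rightarrow> 'a" (infixr "\<boxtimes>\<index>" 70)
  unt :: 'o
  assc :: "'o \<Rightarrow> 'o \<Rightarrow> 'o \<Rightarrow> 'a"
  lun :: "'o \<Rightarrow> 'a"
  run :: "'o \<Rightarrow> 'a"

locale monoidal_category = category C
  for C :: "('o, 'a, 'z) monoidal_category_scheme" (structure) +
  assumes tob_ob: "\<lbrakk>X \<in> ob C; Y \<in> ob C\<rbrakk> \<Longrightarrow> X \<otimes> Y \<in> ob C"
    and tar_hom: "\<lbrakk>f \<in> hom C X X'; g \<in> hom C Y Y'\<rbrakk> \<Longrightarrow> f \<boxtimes> g \<in> hom C (X \<otimes> Y) (X' \<otimes> Y')"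
    and tar_idt: "\<lbrakk>X \<in> ob C; Y \<in> ob C\<rbrakk> \<Longrightarrow> idt C X \<boxtimes> idt C Y = idt C (X \<otimes> Y)"
    and interchange: "\<lbrakk>f \<in> hom C X X'; f' \<in> hom C X' X''; g \<in> hom C Y Y'; g' \<in> hom C Y' Y''\<rbrakk>
      \<Longrightarrow> (f' \<cdot> f) \<boxtimes> (g' \<cdot> g) = (f' \<boxtimes> g') \<cdot> (f \<boxtimes> g)"
    and unt_ob: "unt C \<in> ob C"
    and assc_hom: "\<lbrakk>X \<in> ob C; Y \<in> ob C; Z \<in> ob C\<rbrakk>
      \<Longrightarrow> assc C X Y Z \<in> hom C ((X \<otimes> Y) \<otimes> Z) (X \<otimes> (Y \<otimes> Z))"
    and assc_iso: "\<lbrakk>X \<in> ob C; Y \<in> ob C; Z \<in> ob C\<rbrakk> \<Longrightarrow> iso_arr C (assc C X Y Z)"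
    and assc_natural: "\<lbrakk>f \<in> hom C X X'; g \<in> hom C Y Y'; h \<in> hom C Z Z'\<rbrakk>
      \<Longrightarrow> assc C X' Y' Z' \<cdot> ((f \<boxtimes> g) \<boxtimes> h) = (f \<boxtimes> (g \<boxtimes> h)) \<cdot> assc C X Y Z"
    and lun_hom: "X \<in> ob C \<Longrightarrow> lun C X \<in> hom C (unt C \<otimes> X) X"
    and lun_iso: "X \<in> ob C \<Longrightarrow> iso_arr C (lun C X)"
    and lun_natural: "f \<in> hom C X Y \<Longrightarrow> lun C Y \<cdot> (idt C (unt C) \<boxtimes> f) = f \<cdot> lun C X"
    and run_hom: "X \<in> ob C \<Longrightarrow> run C X \<in> hom C (X \<otimes> unt C) X"
    and run_iso: "X \<in> ob C \<Longrightarrow> iso_arr C (run C X)"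
    and run_natural: "f \<in> hom C X Y \<Longrightarrow> run C Y \<cdot> (f \<boxtimes> idt C (unt C)) = f \<cdot> run C X"
    and pentagon: "\<lbrakk>W \<in> ob C; X \<in> ob C; Y \<in> ob C; Z \<in> ob C\<rbrakk>
      \<Longrightarrow> assc C W X (Y \<otimes> Z) \<cdot> assc C (W \<otimes> X) Y Z
        = (idt C W \<boxtimes> assc C X Y Z) \<cdot> assc C W (X \<otimes> Y) Z \<cdot> (assc C W X Y \<boxtimes> idt C Z)"
    and triangle: "\<lbrakk>X \<in> ob C; Y \<in> ob C\<rbrakk>
      \<Longrightarrow> (idt C X \<boxtimes> lun C Y) \<cdot> assc C X (unt C) Y = run C X \<boxtimes> idt C Y"

record ('o, 'a) braided_category = "('o, 'a) monoidal_category" +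
  braid :: "'o \<Rightarrow> 'o \<Rightarrow> 'a"

locale braided_monoidal_category = monoidal_category C
  for C :: "('o, 'a, 'z) braided_category_scheme" (structure) +
  assumes braid_hom: "\<lbrakk>X \<in> ob C; Y \<in> ob C\<rbrakk> \<Longrightarrow> braid C X Y \<in> hom C (X \<otimes> Y) (Y \<otimes> X)"
    and braid_iso: "\<lbrakk>X \<in> ob C; Y \<in> ob C\<rbrakk> \<Longrightarrow> iso_arr C (braid C X Y)"
    and braid_natural: "\<lbrakk>f \<in> hom C X X'; g \<in> hom C Y Y'\<rbrakk>
      \<Longrightarrow> braid C X' Y' \<cdot> (f \<boxtimes> g) = (g \<boxtimes> f) \<cdot> braid C X Y"
    and hexagon1: "\<lbrakk>X \<in> ob C; Y \<in> ob C; Z \<in> ob C\<rbrakk>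
      \<Longrightarrow> assc C Y Z X \<cdot> braid C X (Y \<otimes> Z) \<cdot> assc C X Y Z
        = (idt C Y \<boxtimes> braid C X Z) \<cdot> assc C Y X Z \<cdot> (braid C X Y \<boxtimes> idt C Z)"
    and hexagon2: "\<lbrakk>X \<in> ob C; Y \<in> ob C; Z \<in> ob C\<rbrakk>
      \<Longrightarrow> inv_arr C (assc C Z X Y) \<cdot> braid C (X \<otimes> Y) Z \<cdot> inv_arr C (assc C X Y Z)
        = (braid C X Z \<boxtimes> idt C Y) \<cdot> inv_arr C (assc C X Z Y) \<cdot> (idt C X \<boxtimes> braid C Y Z)"

text \<open>The opposite category has the same objects and arrows, so \<open>f\<^sup>o\<^sup>p\<close> is represented by \<open>f\<close>.
  Its constraints are the inverses of the original ones.\<close>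

definition op_cat :: "('o, 'a, 'z) monoidal_category_scheme \<Rightarrow> ('o, 'a) monoidal_category" where
  "op_cat C = \<lparr>ob = ob C, arr = arr C, src = tgt C, tgt = src C, idt = idt C,
    cmp = (\<lambda>g f. f \<cdot>\<^bsub>C\<^esub> g), tob = tob C, tar = tar C, unt = unt C,
    assc = (\<lambda>X Y Z. inv_arr C (assc C X Y Z)),
    lun = (\<lambda>X. inv_arr C (lun C X)), run = (\<lambda>X. inv_arr C (run C X))\<rparr>"


section \<open>Monoidal functors and monoidal adjunctions\<close>

record ('o1, 'a1, 'o2, 'a2) lax_functor = "('o1, 'a1, 'o2, 'a2) cat_functor" +
  lax2 :: "'o1 \<Rightarrow> 'o1 \<Rightarrow> 'a2"
  lax0 :: 'a2

locale lax_monoidal_functor =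
    cat_functor A B F + A: monoidal_category A + B: monoidal_category B
  for A :: "('o1, 'a1, 'x) monoidal_category_scheme"
    and B :: "('o2, 'a2, 'y) monoidal_category_scheme"
    and F :: "('o1, 'a1, 'o2, 'a2, 'z) lax_functor_scheme" +
  assumes lax2_hom: "\<lbrakk>X \<in> ob A; Y \<in> ob A\<rbrakk>
      \<Longrightarrow> lax2 F X Y \<in> hom B (fob F X \<otimes>\<^bsub>B\<^esub> fob F Y) (fob F (X \<otimes>\<^bsub>A\<^esub> Y))"
    and lax2_natural: "\<lbrakk>f \<in> hom A X X'; g \<in> hom A Y Y'\<rbrakk>
      \<Longrightarrow> lax2 F X' Y' \<cdot>\<^bsub>B\<^esub> (far F f \<boxtimes>\<^bsub>B\<^esub> far F g) = far F (f \<boxtimes>\<^bsub>A\<^esub> g) \<cdot>\<^bsub>B\<^esub> lax2 F X Y"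
    and lax0_hom: "lax0 F \<in> hom B (unt B) (fob F (unt A))"
    and lax_assc: "\<lbrakk>X \<in> ob A; Y \<in> ob A; Z \<in> ob A\<rbrakk>
      \<Longrightarrow> far F (assc A X Y Z) \<cdot>\<^bsub>B\<^esub> lax2 F (X \<otimes>\<^bsub>A\<^esub> Y) Z \<cdot>\<^bsub>B\<^esub> (lax2 F X Y \<boxtimes>\<^bsub>B\<^esub> idt B (fob F Z))
        = lax2 F X (Y \<otimes>\<^bsub>A\<^esub> Z) \<cdot>\<^bsub>B\<^esub> (idt B (fob F X) \<boxtimes>\<^bsub>B\<^esub> lax2 F Y Z)
            \<cdot>\<^bsub>B\<^esub> assc B (fob F X) (fob F Y) (fob F Z)"
    and lax_lun: "X \<in> ob A
      \<Longrightarrow> far F (lun A X) \<cdot>\<^bsub>B\<^esub> lax2 F (unt A) X \<cdot>\<^bsub>B\<^esub> (lax0 F \<boxtimes>\<^bsub>B\<^esub> idt B (fob F X)) = lun B (fob F X)"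
    and lax_run: "X \<in> ob A
      \<Longrightarrow> far F (run A X) \<cdot>\<^bsub>B\<^esub> lax2 F X (unt A) \<cdot>\<^bsub>B\<^esub> (idt B (fob F X) \<boxtimes>\<^bsub>B\<^esub> lax0 F) = run B (fob F X)"

text \<open>Being strict forces \<open>F\<close> to preserve the tensor product and the unit on the nose; together
  with \<open>lax_assc\<close>, \<open>lax_lun\<close>, \<open>lax_run\<close> it also makes \<open>F\<close> preserve the constraints.\<close>

locale strict_monoidal_functor = lax_monoidal_functor A B F
  for A :: "('o1, 'a1, 'x) monoidal_category_scheme"
    and B :: "('o2, 'a2, 'y) monoidal_category_scheme"
    and F :: "('o1, 'a1, 'o2, 'a2, 'z) lax_functor_scheme" +
  assumes strict_tob: "\<lbrakk>X \<in> ob A; Y \<in> ob A\<rbrakk> \<Longrightarrow> fob F (X \<otimes>\<^bsub>A\<^esub> Y) = fob F X \<otimes>\<^bsub>B\<^esub> fob F Y"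
    and strict_unt: "fob F (unt A) = unt B"
    and strict_lax2: "\<lbrakk>X \<in> ob A; Y \<in> ob A\<rbrakk> \<Longrightarrow> lax2 F X Y = idt B (fob F X \<otimes>\<^bsub>B\<^esub> fob F Y)"
    and strict_lax0: "lax0 F = idt B (unt B)"

locale braided_lax_monoidal_functor =
    lax_monoidal_functor A B F + A: braided_monoidal_category A + B: braided_monoidal_category B
  for A :: "('o1, 'a1, 'x) braided_category_scheme"
    and B :: "('o2, 'a2, 'y) braided_category_scheme"
    and F :: "('o1, 'a1, 'o2, 'a2, 'z) lax_functor_scheme" +
  assumes preserves_braid: "\<lbrakk>X \<in> ob A; Y \<in> ob A\<rbrakk>
      \<Longrightarrow> far F (braid A X Y) \<cdot>\<^bsub>B\<^esub> lax2 F X Y = lax2 F Y X \<cdot>\<^bsub>B\<^esub> braid B (fob F X) (fob F Y)"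

definition id_lax_functor ::
  "('o, 'a, 'x) monoidal_category_scheme \<Rightarrow> ('o, 'a, 'o, 'a) lax_functor" where
  "id_lax_functor C = \<lparr>fob = (\<lambda>X. X), far = (\<lambda>f. f),
    lax2 = (\<lambda>X Y. idt C (X \<otimes>\<^bsub>C\<^esub> Y)), lax0 = idt C (unt C)\<rparr>"

definition comp_lax_functor ::
  "('o1, 'a1, 'x) monoidal_category_scheme \<Rightarrow> ('o3, 'a3, 'y) monoidal_category_scheme
    \<Rightarrow> ('o2, 'a2, 'o3, 'a3) lax_functor \<Rightarrow> ('o1, 'a1, 'o2, 'a2) lax_functor
    \<Rightarrow> ('o1, 'a1, 'o3, 'a3) lax_functor" where
  "comp_lax_functor A C G F = \<lparr>fob = (\<lambda>X. fob G (fob F X)), far = (\<lambda>f. far G (far F f)),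
    lax2 = (\<lambda>X Y. far G (lax2 F X Y) \<cdot>\<^bsub>C\<^esub> lax2 G (fob F X) (fob F Y)),
    lax0 = far G (lax0 F) \<cdot>\<^bsub>C\<^esub> lax0 G\<rparr>"

locale monoidal_nat_transformation =
    nat_transformation A B F G \<tau> + F: lax_monoidal_functor A B F + G: lax_monoidal_functor A B G
  for A :: "('o1, 'a1, 'x) monoidal_category_scheme"
    and B :: "('o2, 'a2, 'y) monoidal_category_scheme"
    and F :: "('o1, 'a1, 'o2, 'a2, 'u) lax_functor_scheme"
    and G :: "('o1, 'a1, 'o2, 'a2, 'v) lax_functor_scheme"
    and \<tau> :: "'o1 \<Rightarrow> 'a2" +
  assumes monoidal2: "\<lbrakk>X \<in> ob A; Y \<in> ob A\<rbrakk>
      \<Longrightarrow> \<tau> (X \<otimes>\<^bsub>A\<^esub> Y) \<cdot>\<^bsub>B\<^esub> lax2 F X Y = lax2 G X Y \<cdot>\<^bsub>B\<^esub> (\<tau> X \<boxtimes>\<^bsub>B\<^esub> \<tau> Y)"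
    and monoidal0: "\<tau> (unt A) \<cdot>\<^bsub>B\<^esub> lax0 F = lax0 G"

locale monoidal_adjunction =
    adjunction A B E F \<eta> \<epsilon>
  + E: lax_monoidal_functor B A E + F: lax_monoidal_functor A B F
  + unit: monoidal_nat_transformation B B "id_lax_functor B" "comp_lax_functor B B F E" \<eta>
  + counit: monoidal_nat_transformation A A "comp_lax_functor A A E F" "id_lax_functor A" \<epsilon>
  for A :: "('o1, 'a1, 'x) monoidal_category_scheme"
    and B :: "('o2, 'a2, 'y) monoidal_category_scheme"
    and E :: "('o2, 'a2, 'o1, 'a1) lax_functor"
    and F :: "('o1, 'a1, 'o2, 'a2) lax_functor"
    and \<eta> :: "'o2 \<Rightarrow> 'a2" and \<epsilon> :: "'o1 \<Rightarrow> 'a1"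


section \<open>Algebras and coalgebras\<close>

text \<open>Objects are triples \<open>(A, m, u)\<close> resp. \<open>(C, \<Delta>, \<epsilon>)\<close>. Arrows are triples \<open>(X, f, Y)\<close> recording
  source and target object, since one arrow \<open>f\<close> may be a morphism for several structures.\<close>

type_synonym ('o, 'a) structured = "'o \<times> 'a \<times> 'a"

definition algebras :: "('o, 'a, 'z) monoidal_category_scheme \<Rightarrow> ('o, 'a) structured set" where
  "algebras C = {(A, m, u). A \<in> ob C \<and> m \<in> hom C (A \<otimes>\<^bsub>C\<^esub> A) A \<and> u \<in> hom C (unt C) A
    \<and> m \<cdot>\<^bsub>C\<^esub> (m \<boxtimes>\<^bsub>C\<^esub> idt C A) = m \<cdot>\<^bsub>C\<^esub> (idt C A \<boxtimes>\<^bsub>C\<^esub> m) \<cdot>\<^bsub>C\<^esub> assc C A A A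
    \<and> m \<cdot>\<^bsub>C\<^esub> (u \<boxtimes>\<^bsub>C\<^esub> idt C A) = lun C A
    \<and> m \<cdot>\<^bsub>C\<^esub> (idt C A \<boxtimes>\<^bsub>C\<^esub> u) = run C A}"

definition algebra_morphism ::
  "('o, 'a, 'z) monoidal_category_scheme \<Rightarrow> ('o, 'a) structured \<Rightarrow> 'a \<Rightarrow> ('o, 'a) structured \<Rightarrow> bool"
  where
  "algebra_morphism C = (\<lambda>(A, m, u) f (B, m', u').
    f \<in> hom C A B \<and> f \<cdot>\<^bsub>C\<^esub> m = m' \<cdot>\<^bsub>C\<^esub> (f \<boxtimes>\<^bsub>C\<^esub> f) \<and> f \<cdot>\<^bsub>C\<^esub> u = u')"

definition coalgebras :: "('o, 'a, 'z) monoidal_category_scheme \<Rightarrow> ('o, 'a) structured set" where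
  "coalgebras C = {(A, d, e). A \<in> ob C \<and> d \<in> hom C A (A \<otimes>\<^bsub>C\<^esub> A) \<and> e \<in> hom C A (unt C)
    \<and> assc C A A A \<cdot>\<^bsub>C\<^esub> (d \<boxtimes>\<^bsub>C\<^esub> idt C A) \<cdot>\<^bsub>C\<^esub> d = (idt C A \<boxtimes>\<^bsub>C\<^esub> d) \<cdot>\<^bsub>C\<^esub> d
    \<and> lun C A \<cdot>\<^bsub>C\<^esub> (e \<boxtimes>\<^bsub>C\<^esub> idt C A) \<cdot>\<^bsub>C\<^esub> d = idt C A
    \<and> run C A \<cdot>\<^bsub>C\<^esub> (idt C A \<boxtimes>\<^bsub>C\<^esub> e) \<cdot>\<^bsub>C\<^esub> d = idt C A}"

definition coalgebra_morphism ::
  "('o, 'a, 'z) monoidal_category_scheme \<Rightarrow> ('o, 'a) structured \<Rightarrow> 'a \<Rightarrow> ('o, 'a) structured \<Rightarrow> bool"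
  where
  "coalgebra_morphism C = (\<lambda>(A, d, e) f (B, d', e').
    f \<in> hom C A B \<and> (f \<boxtimes>\<^bsub>C\<^esub> f) \<cdot>\<^bsub>C\<^esub> d = d' \<cdot>\<^bsub>C\<^esub> f \<and> e' \<cdot>\<^bsub>C\<^esub> f = e)"

definition structured_category ::
  "('o, 'a, 'z) monoidal_category_scheme \<Rightarrow> ('o, 'a) structured set
    \<Rightarrow> (('o, 'a) structured \<Rightarrow> 'a \<Rightarrow> ('o, 'a) structured \<Rightarrow> bool)
    \<Rightarrow> (('o, 'a) structured, ('o, 'a) structured \<times> 'a \<times> ('o, 'a) structured) category" where
  "structured_category C S P = \<lparr>ob = S,
    arr = {(X, f, Y). X \<in> S \<and> Y \<in> S \<and> P X f Y},
    src = (\<lambda>(X, f, Y). X), tgt = (\<lambda>(X, f, Y). Y),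
    idt = (\<lambda>X. (X, idt C (fst X), X)),
    cmp = (\<lambda>(Y, g, Z) (X, f, Y'). (X, g \<cdot>\<^bsub>C\<^esub> f, Z))\<rparr>"

definition Alg ::
  "('o, 'a, 'z) monoidal_category_scheme
    \<Rightarrow> (('o, 'a) structured, ('o, 'a) structured \<times> 'a \<times> ('o, 'a) structured) category" where
  "Alg C = structured_category C (algebras C) (algebra_morphism C)"

definition Coalg ::
  "('o, 'a, 'z) monoidal_category_scheme
    \<Rightarrow> (('o, 'a) structured, ('o, 'a) structured \<times> 'a \<times> ('o, 'a) structured) category" where
  "Coalg C = structured_category C (coalgebras C) (coalgebra_morphism C)"

text \<open>For a lax monoidal functor \<open>F : A \<rightarrow> B\<close>, the induced functor \<open>Alg A \<rightarrow> Alg B\<close>.\<close>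

definition Alg_ob ::
  "('o2, 'a2, 'y) monoidal_category_scheme \<Rightarrow> ('o1, 'a1, 'o2, 'a2, 'z) lax_functor_scheme
    \<Rightarrow> ('o1, 'a1) structured \<Rightarrow> ('o2, 'a2) structured" where
  "Alg_ob B F = (\<lambda>(A, m, u). (fob F A, far F m \<cdot>\<^bsub>B\<^esub> lax2 F A A, far F u \<cdot>\<^bsub>B\<^esub> lax0 F))"

definition Alg_functor ::
  "('o2, 'a2, 'y) monoidal_category_scheme \<Rightarrow> ('o1, 'a1, 'o2, 'a2, 'z) lax_functor_scheme
    \<Rightarrow> (('o1, 'a1) structured, ('o1, 'a1) structured \<times> 'a1 \<times> ('o1, 'a1) structured,
        ('o2, 'a2) structured, ('o2, 'a2) structured \<times> 'a2 \<times> ('o2, 'a2) structured) cat_functor"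
  where
  "Alg_functor B F = \<lparr>fob = Alg_ob B F,
    far = (\<lambda>(X, f, Y). (Alg_ob B F X, far F f, Alg_ob B F Y))\<rparr>"

record ('o1, 'a1, 'o2, 'a2) colax_functor = "('o1, 'a1, 'o2, 'a2) cat_functor" +
  colax2 :: "'o1 \<Rightarrow> 'o1 \<Rightarrow> 'a2"
  colax0 :: 'a2

text \<open>For a colax monoidal functor \<open>E : B \<rightarrow> A\<close>, the induced functor \<open>Coalg B \<rightarrow> Coalg A\<close>.\<close>

definition Coalg_ob ::
  "('o1, 'a1, 'x) monoidal_category_scheme \<Rightarrow> ('o2, 'a2, 'o1, 'a1, 'z) colax_functor_scheme
    \<Rightarrow> ('o2, 'a2) structured \<Rightarrow> ('o1, 'a1) structured" where
  "Coalg_ob A E = (\<lambda>(C, d, e). (fob E C, colax2 E C C \<cdot>\<^bsub>A\<^esub> far E d, colax0 E \<cdot>\<^bsub>A\<^esub> far E e))"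

definition Coalg_functor ::
  "('o1, 'a1, 'x) monoidal_category_scheme \<Rightarrow> ('o2, 'a2, 'o1, 'a1, 'z) colax_functor_scheme
    \<Rightarrow> (('o2, 'a2) structured, ('o2, 'a2) structured \<times> 'a2 \<times> ('o2, 'a2) structured,
        ('o1, 'a1) structured, ('o1, 'a1) structured \<times> 'a1 \<times> ('o1, 'a1) structured) cat_functor"
  where
  "Coalg_functor A E = \<lparr>fob = Coalg_ob A E,
    far = (\<lambda>(X, f, Y). (Coalg_ob A E X, far E f, Coalg_ob A E Y))\<rparr>"

text \<open>The colax monoidal structure on a left adjoint \<open>E : B \<rightarrow> A\<close> of a lax monoidal functor
  \<open>F : A \<rightarrow> B\<close>.\<close>

definition left_adjoint_colax ::
  "('o1, 'a1, 'x) monoidal_category_scheme \<Rightarrow> ('o2, 'a2, 'y) monoidal_category_scheme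
    \<Rightarrow> ('o2, 'a2, 'o1, 'a1) cat_functor \<Rightarrow> ('o1, 'a1, 'o2, 'a2) lax_functor
    \<Rightarrow> ('o2 \<Rightarrow> 'a2) \<Rightarrow> ('o1 \<Rightarrow> 'a1) \<Rightarrow> ('o2, 'a2, 'o1, 'a1) colax_functor" where
  "left_adjoint_colax A B E F \<eta> \<epsilon> = \<lparr>fob = fob E, far = far E,
    colax2 = (\<lambda>X Y. \<epsilon> (fob E X \<otimes>\<^bsub>A\<^esub> fob E Y) \<cdot>\<^bsub>A\<^esub> far E (lax2 F (fob E X) (fob E Y))
      \<cdot>\<^bsub>A\<^esub> far E (\<eta> X \<boxtimes>\<^bsub>B\<^esub> \<eta> Y)),
    colax0 = \<epsilon> (unt A) \<cdot>\<^bsub>A\<^esub> far E (lax0 F)\<rparr>"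

definition liftable_pair ::
  "('o1, 'a1, 'x) monoidal_category_scheme \<Rightarrow> ('o2, 'a2, 'y) monoidal_category_scheme
    \<Rightarrow> ('o2, 'a2, 'o1, 'a1) cat_functor \<Rightarrow> ('o1, 'a1, 'o2, 'a2) lax_functor
    \<Rightarrow> ('o2 \<Rightarrow> 'a2) \<Rightarrow> ('o1 \<Rightarrow> 'a1) \<Rightarrow> bool" where
  "liftable_pair A B E F \<eta> \<epsilon> \<longleftrightarrow>
    lax_monoidal_functor A B F \<and> adjunction A B E F \<eta> \<epsilon>
    \<and> has_left_adjoint (Alg A) (Alg B) (Alg_functor B F)
    \<and> has_right_adjoint (Coalg B) (Coalg A) (Coalg_functor A (left_adjoint_colax A B E F \<eta> \<epsilon>))"


section \<open>Pre-rigid categories and the dual functor\<close>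

definition pre_dual ::
  "('o, 'a, 'z) monoidal_category_scheme \<Rightarrow> 'o \<Rightarrow> 'o \<Rightarrow> 'a \<Rightarrow> bool" where
  "pre_dual C X X' e \<longleftrightarrow> X' \<in> ob C \<and> e \<in> hom C (X' \<otimes>\<^bsub>C\<^esub> X) (unt C)
    \<and> (\<forall>T \<in> ob C. bij_betw (\<lambda>u. e \<cdot>\<^bsub>C\<^esub> (u \<boxtimes>\<^bsub>C\<^esub> idt C X)) (hom C T X') (hom C (T \<otimes>\<^bsub>C\<^esub> X) (unt C)))"

text \<open>\<open>pre_rigid C D ev\<close>: \<open>C\<close> is pre-rigid, with pre-duals \<open>X\<^sup>* = D X\<close> and evaluations \<open>ev X\<close>.\<close>

definition pre_rigid ::
  "('o, 'a, 'z) monoidal_category_scheme \<Rightarrow> ('o \<Rightarrow> 'o) \<Rightarrow> ('o \<Rightarrow> 'a) \<Rightarrow> bool" where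
  "pre_rigid C D ev \<longleftrightarrow> (\<forall>X \<in> ob C. pre_dual C X (D X) (ev X))"

text \<open>\<open>dagger C D ev T X t\<close> is \<open>t\<^sup>\<dagger> : T \<rightarrow> X\<^sup>*\<close> for \<open>t : T \<otimes> X \<rightarrow> I\<close>; \<open>T\<close> and \<open>X\<close> are arguments because
  \<open>T \<otimes> X\<close> does not determine them.\<close>

definition dagger ::
  "('o, 'a, 'z) monoidal_category_scheme \<Rightarrow> ('o \<Rightarrow> 'o) \<Rightarrow> ('o \<Rightarrow> 'a) \<Rightarrow> 'o \<Rightarrow> 'o \<Rightarrow> 'a \<Rightarrow> 'a" where
  "dagger C D ev T X t = (THE u. u \<in> hom C T (D X) \<and> ev X \<cdot>\<^bsub>C\<^esub> (u \<boxtimes>\<^bsub>C\<^esub> idt C X) = t)"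

definition dual_arr ::
  "('o, 'a, 'z) monoidal_category_scheme \<Rightarrow> ('o \<Rightarrow> 'o) \<Rightarrow> ('o \<Rightarrow> 'a) \<Rightarrow> 'a \<Rightarrow> 'a" where
  "dual_arr C D ev f = (let X = src C f; Y = tgt C f in
    THE g. g \<in> hom C (D Y) (D X)
      \<and> ev X \<cdot>\<^bsub>C\<^esub> (g \<boxtimes>\<^bsub>C\<^esub> idt C X) = ev Y \<cdot>\<^bsub>C\<^esub> (idt C (D Y) \<boxtimes>\<^bsub>C\<^esub> f))"

text \<open>The arrow \<open>(P \<otimes> Q) \<otimes> (X \<otimes> Y) \<rightarrow> (P \<otimes> X) \<otimes> (Q \<otimes> Y)\<close> that is \<open>P \<otimes> (c\<^bsub>X,Q\<^esub>)\<^sup>-\<^sup>1 \<otimes> Y\<close> up to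
  rebracketing.\<close>

definition middle_swap ::
  "('o, 'a, 'z) braided_category_scheme \<Rightarrow> 'o \<Rightarrow> 'o \<Rightarrow> 'o \<Rightarrow> 'o \<Rightarrow> 'a" where
  "middle_swap C P Q X Y =
    inv_arr C (assc C P X (Q \<otimes>\<^bsub>C\<^esub> Y))
    \<cdot>\<^bsub>C\<^esub> (idt C P \<boxtimes>\<^bsub>C\<^esub> assc C X Q Y)
    \<cdot>\<^bsub>C\<^esub> (idt C P \<boxtimes>\<^bsub>C\<^esub> (inv_arr C (braid C X Q) \<boxtimes>\<^bsub>C\<^esub> idt C Y))
    \<cdot>\<^bsub>C\<^esub> (idt C P \<boxtimes>\<^bsub>C\<^esub> inv_arr C (assc C Q X Y))
    \<cdot>\<^bsub>C\<^esub> assc C P Q (X \<otimes>\<^bsub>C\<^esub> Y)"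

text \<open>\<open>(-)\<^sup>* : C\<^sup>o\<^sup>p \<rightarrow> C\<close> with its lax monoidal structure. The canonical isomorphism
  \<open>I \<otimes> I \<rightarrow> I\<close> is \<open>lun C I\<close> (which equals \<open>run C I\<close>).\<close>

definition dual_functor ::
  "('o, 'a, 'z) braided_category_scheme \<Rightarrow> ('o \<Rightarrow> 'o) \<Rightarrow> ('o \<Rightarrow> 'a)
    \<Rightarrow> ('o, 'a, 'o, 'a) lax_functor" where
  "dual_functor C D ev = \<lparr>fob = D, far = dual_arr C D ev,
    lax2 = (\<lambda>X Y. dagger C D ev (D X \<otimes>\<^bsub>C\<^esub> D Y) (X \<otimes>\<^bsub>C\<^esub> Y)
      (lun C (unt C) \<cdot>\<^bsub>C\<^esub> (ev X \<boxtimes>\<^bsub>C\<^esub> ev Y) \<cdot>\<^bsub>C\<^esub> middle_swap C (D X) (D Y) X Y)),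
    lax0 = dagger C D ev (unt C) (unt C) (lun C (unt C))\<rparr>"

text \<open>The opposite functor \<open>(-)\<^sup>* : C \<rightarrow> C\<^sup>o\<^sup>p\<close>, given by the same maps on objects and arrows.\<close>

definition dual_functor_op ::
  "('o, 'a, 'z) monoidal_category_scheme \<Rightarrow> ('o \<Rightarrow> 'o) \<Rightarrow> ('o \<Rightarrow> 'a)
    \<Rightarrow> ('o, 'a, 'o, 'a) cat_functor" where
  "dual_functor_op C D ev = \<lparr>fob = D, far = dual_arr C D ev\<rparr>"

definition dual_unit ::
  "('o, 'a, 'z) braided_category_scheme \<Rightarrow> ('o \<Rightarrow> 'o) \<Rightarrow> ('o \<Rightarrow> 'a) \<Rightarrow> 'o \<Rightarrow> 'a" where
  "dual_unit C D ev X = dagger C D ev X (D X) (ev X \<cdot>\<^bsub>C\<^esub> braid C X (D X))"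

text \<open>The counit \<open>X\<^sup>*\<^sup>* \<rightarrow> X\<close> in \<open>C\<^sup>o\<^sup>p\<close>, that is, \<open>j\<^bsub>X\<^esub> : X \<rightarrow> X\<^sup>*\<^sup>*\<close> in \<open>C\<close>.\<close>

definition dual_counit ::
  "('o, 'a, 'z) braided_category_scheme \<Rightarrow> ('o \<Rightarrow> 'o) \<Rightarrow> ('o \<Rightarrow> 'a) \<Rightarrow> 'o \<Rightarrow> 'a" where
  "dual_counit C D ev X = dagger C D ev X (D X) (ev X \<cdot>\<^bsub>C\<^esub> inv_arr C (braid C (D X) X))"

end

(*
  Transposing along the adjunction shows that R((LN)^* ) is a pre-dual of N, and, since R inherits
  compatibility with the braiding from L, the lax monoidal functor (-)^* of N is isomorphic to
  R o (-)^* o L^op. Monoidal adjunctions induce adjunctions between categories of algebras; applied to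
  L -| R and to R^op -| L^op, this gives the left adjoint on Alg as a composite of left adjoints.

  For coalgebras, the colax structure psi on (-)^* obtained as the mate of phi is in general not phi
  itself, unless the braiding is a symmetry: psi(X,Y) = (c_{Y,X} o c_{X,Y})^* o phi(X,Y). Twisting the
  comultiplication by the double braiding is an automorphism of the category of coalgebras, so the
  functor induced by psi is the opposite of the one induced by phi precomposed with an automorphism.

  To avoid strictness, all pairings are written with the nested pairing
  (B (x) A) (x) (X (x) Y) -> I built from A (x) X -> I and B (x) Y -> I; it needs no braiding, and phi
  is obtained from it with a single braiding.
*)
theory Submission
  imports Defs
begin

section \<open>Categories and monoidal categories\<close>

text \<open>The theorem fixes only the objects \<open>fob R (D (fob L X))\<close> and quantifies
  over all evaluations on them. The dual functor of \<open>N\<close> can therefore not be computed,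
  only compared: \<open>transported_ev\<close> is one admissible evaluation, and any other differs
  from it by an isomorphism \<open>\<kappa>\<close>, which has to be natural and monoidal. Existence
  of adjoints is treated pointwise, by universal arrows. Composition, transport along a natural
  isomorphism and passage to opposites then need no bookkeeping of units, counits and triangle
  identities. One hypothesis on algebras serves both halves of liftability because coalgebras of C
  are literally algebras of \<open>op_cat C\<close> and vice versa, with morphisms reversed. A
  universal arrow for the functor on algebras, read backwards, is a couniversal arrow for the
  functor on coalgebras, up to the twist. The locales contain only pentagon, triangle and hexagons,
  so the remaining unit coherences and the Yang-Baxter equation are derived.\<close>

declare hom_def [simp]

context category
begin

declare src_ob [simp] tgt_ob [simp]

lemma idt_simps [simp]:
  assumes "X \<in> ob C"
  shows "idt C X \<in> arr C" "src C (idt C X) = X" "tgt C (idt C X) = X"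
  using idt_hom [OF assms] by auto

lemma cmp_simps [simp]:
  assumes "f \<in> arr C" "g \<in> arr C" "tgt C f = src C g"
  shows "g \<cdot> f \<in> arr C" "src C (g \<cdot> f) = src C f" "tgt C (g \<cdot> f) = tgt C g"
  using cmp_hom [of f "src C f" "src C g" g "tgt C g"] assms by auto

lemma cmp_idt_simps [simp]:
  assumes "f \<in> arr C"
  shows "tgt C f = Y \<Longrightarrow> idt C Y \<cdot> f = f" "src C f = X \<Longrightarrow> f \<cdot> idt C X = f"
  using cmp_idt_left [of f] cmp_idt_right [of f] assms by auto

lemma cmp_assoc_simp [simp]:
  assumes "f \<in> arr C" "g \<in> arr C" "h \<in> arr C" "tgt C f = src C g" "tgt C g = src C h"
  shows "(h \<cdot> g) \<cdot> f = h \<cdot> g \<cdot> f"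
  using cmp_assoc [of f "src C f" "src C g" g "src C h" h] assms by auto

text \<open>Composites are kept right-nested by \<open>cmp_assoc_simp\<close>, so an equation for
  \<open>b \<cdot> a\<close> does not match inside \<open>b \<cdot> a \<cdot> x\<close>. This form
  restores the match and lets structural equations act in the middle of a composite.\<close>

lemma cmp_extend:
  assumes "b \<cdot> a = k" "a \<in> arr C" "b \<in> arr C" "x \<in> arr C" "tgt C a = src C b" "tgt C x = src C a"
  shows "b \<cdot> a \<cdot> x = k \<cdot> x"
proof -
  have "b \<cdot> a \<cdot> x = (b \<cdot> a) \<cdot> x"
    using assms(2-) by simp
  then show ?thesis
    by (simp only: assms(1))
qed

lemma inverse_arrows_unique:
  assumes "inverse_arrows C f g" "inverse_arrows C f g'"
  shows "g = g'"
proof -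
  have "g = g \<cdot> f \<cdot> g'"
    using assms by (auto simp: inverse_arrows_def)
  also have "\<dots> = (g \<cdot> f) \<cdot> g'"
    using assms by (subst cmp_assoc_simp) (auto simp: inverse_arrows_def)
  also have "\<dots> = g'"
    using assms by (auto simp: inverse_arrows_def)
  finally show ?thesis .
qed

lemma inv_arr_eq: "inverse_arrows C f g \<Longrightarrow> inv_arr C f = g"
  unfolding inv_arr_def by (blast intro: the_equality inverse_arrows_unique)

lemma inverse_arrows_inv_arr: "iso_arr C f \<Longrightarrow> inverse_arrows C f (inv_arr C f)"
  unfolding iso_arr_def by (metis inv_arr_eq)

lemma inv_arr_simps [simp]:
  assumes "iso_arr C f"
  shows "inv_arr C f \<in> arr C" "src C (inv_arr C f) = tgt C f" "tgt C (inv_arr C f) = src C f"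
    "inv_arr C f \<cdot> f = idt C (src C f)" "f \<cdot> inv_arr C f = idt C (tgt C f)"
  using inverse_arrows_inv_arr [OF assms] by (auto simp: inverse_arrows_def)

lemma iso_arr_arr: "iso_arr C f \<Longrightarrow> f \<in> arr C"
  by (auto simp: iso_arr_def inverse_arrows_def)

lemma inv_arr_cancel [simp]:
  assumes "iso_arr C f" "x \<in> arr C"
  shows "tgt C x = src C f \<Longrightarrow> inv_arr C f \<cdot> f \<cdot> x = x"
    "tgt C x = tgt C f \<Longrightarrow> f \<cdot> inv_arr C f \<cdot> x = x"
  using assms iso_arr_arr [OF assms(1)]
  by (simp_all flip: cmp_assoc_simp)

lemma iso_arr_inv_arr: "iso_arr C f \<Longrightarrow> iso_arr C (inv_arr C f)"
  using iso_arr_arr by (auto simp: iso_arr_def [of C "inv_arr C f"] inverse_arrows_def intro!: exI [of _ f])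

lemma inv_arr_cmp:
  assumes "iso_arr C f" "iso_arr C g" "tgt C f = src C g"
  shows "iso_arr C (g \<cdot> f)" "inv_arr C (g \<cdot> f) = inv_arr C f \<cdot> inv_arr C g"
proof -
  have "inverse_arrows C (g \<cdot> f) (inv_arr C f \<cdot> inv_arr C g)"
    using assms iso_arr_arr by (auto simp: inverse_arrows_def)
  then show "iso_arr C (g \<cdot> f)" "inv_arr C (g \<cdot> f) = inv_arr C f \<cdot> inv_arr C g"
    unfolding iso_arr_def by (blast intro: inv_arr_eq)+
qed

lemma iso_cancel_left:
  assumes "iso_arr C f" "f \<cdot> g = f \<cdot> h" "g \<in> arr C" "h \<in> arr C" "tgt C g = src C f" "tgt C h = src C f"
  shows "g = h"
proof -
  have "inv_arr C f \<cdot> f \<cdot> g = inv_arr C f \<cdot> f \<cdot> h"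
    using assms by simp
  then show ?thesis
    using assms inv_arr_cancel(1) by metis
qed

lemma iso_cancel_right:
  assumes "iso_arr C f" "g \<cdot> f = h \<cdot> f" "g \<in> arr C" "h \<in> arr C" "tgt C f = src C g" "tgt C f = src C h"
  shows "g = h"
proof -
  have split: "x = (x \<cdot> f) \<cdot> inv_arr C f" if "x \<in> arr C" "src C x = tgt C f" for x
    using assms(1) iso_arr_arr [OF assms(1)] that by simp
  show ?thesis
    using split [of g] split [of h] assms by metis
qed

end

section \<open>Unit coherences derived from pentagon and triangle\<close>

context monoidal_category
begin

declare unt_ob [simp]
declare tob_ob [simp]

lemma tar_simps [simp]:
  assumes "f \<in> arr C" "g \<in> arr C"
  shows "f \<boxtimes> g \<in> arr C" "src C (f \<boxtimes> g) = src C f \<otimes> src C g" "tgt C (f \<boxtimes> g) = tgt C f \<otimes> tgt C g"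
  using tar_hom [of f "src C f" "tgt C f" g "src C g" "tgt C g"] assms by auto

declare tar_idt [simp]

lemma interchange_simp [simp]:
  assumes "f \<in> arr C" "g \<in> arr C" "f' \<in> arr C" "g' \<in> arr C" "tgt C f = src C f'" "tgt C g = src C g'"
  shows "(f' \<boxtimes> g') \<cdot> (f \<boxtimes> g) = (f' \<cdot> f) \<boxtimes> (g' \<cdot> g)"
  using interchange [of f "src C f" "src C f'" f' "tgt C f'" g "src C g" "src C g'" g' "tgt C g'"] assms
  by auto

text \<open>Right-nested companion of \<open>interchange_simp\<close>: together they fuse adjacent
  tensor arrows wherever these stand in a composite.\<close>

lemma interchange_cmp [simp]:
  assumes "f \<in> arr C" "g \<in> arr C" "f' \<in> arr C" "g' \<in> arr C" "tgt C f = src C f'" "tgt C g = src C g'"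
    "x \<in> arr C" "tgt C x = src C f \<otimes> src C g"
  shows "(f' \<boxtimes> g') \<cdot> (f \<boxtimes> g) \<cdot> x = ((f' \<cdot> f) \<boxtimes> (g' \<cdot> g)) \<cdot> x"
proof -
  have "(f' \<boxtimes> g') \<cdot> (f \<boxtimes> g) \<cdot> x = ((f' \<boxtimes> g') \<cdot> (f \<boxtimes> g)) \<cdot> x"
    using assms by (subst cmp_assoc_simp) simp_all
  then show ?thesis
    using assms by simp
qed

lemma structure_simps [simp]:
  assumes "X \<in> ob C"
  shows "lun C X \<in> arr C" "src C (lun C X) = unt C \<otimes> X" "tgt C (lun C X) = X"
    "run C X \<in> arr C" "src C (run C X) = X \<otimes> unt C" "tgt C (run C X) = X"
  using lun_hom run_hom assms by auto

declare lun_iso [simp] run_iso [simp] assc_iso [simp]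

lemma assc_simps [simp]:
  assumes "X \<in> ob C" "Y \<in> ob C" "Z \<in> ob C"
  shows "assc C X Y Z \<in> arr C" "src C (assc C X Y Z) = (X \<otimes> Y) \<otimes> Z"
    "tgt C (assc C X Y Z) = X \<otimes> Y \<otimes> Z"
  using assc_hom assms by auto

lemma iso_tar [simp]:
  assumes "iso_arr C f" "iso_arr C g"
  shows "iso_arr C (f \<boxtimes> g)"
proof -
  have "inverse_arrows C (f \<boxtimes> g) (inv_arr C f \<boxtimes> inv_arr C g)"
    using assms iso_arr_arr by (auto simp: inverse_arrows_def)
  then show ?thesis
    by (auto simp: iso_arr_def)
qed

lemma iso_idt [simp]: "X \<in> ob C \<Longrightarrow> iso_arr C (idt C X)"
  by (auto simp: iso_arr_def inverse_arrows_def intro!: exI [of _ "idt C X"])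

text \<open>\<open>lun\<close> is a natural isomorphism from I \<otimes> - to the identity functor,
  so tensoring with the unit reflects equality of arrows. The derivations of the unit coherences
  rest on this lemma and \<open>run_faithful\<close>.\<close>

lemma lun_faithful:
  assumes "idt C (unt C) \<boxtimes> f = idt C (unt C) \<boxtimes> g" "f \<in> hom C X Y" "g \<in> hom C X Y"
  shows "f = g"
proof -
  have X: "X \<in> ob C" using assms by auto
  have eq: "f \<cdot> lun C X = g \<cdot> lun C X"
    using lun_natural [of f X Y] lun_natural [of g X Y] assms by simp
  show ?thesis
    by (rule iso_cancel_right [OF _ eq]) (use assms X in simp_all)
qed

lemma run_faithful:
  assumes "f \<boxtimes> idt C (unt C) = g \<boxtimes> idt C (unt C)" "f \<in> hom C X Y" "g \<in> hom C X Y"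
  shows "f = g"
proof -
  have X: "X \<in> ob C" using assms by auto
  have eq: "f \<cdot> run C X = g \<cdot> run C X"
    using run_natural [of f X Y] run_natural [of g X Y] assms by simp
  show ?thesis
    by (rule iso_cancel_right [OF _ eq]) (use assms X in simp_all)
qed

lemma assc_natural_cmp:
  assumes "f \<in> hom C X X'" "g \<in> hom C Y Y'" "h \<in> hom C Z Z'" "x \<in> hom C W ((X \<otimes> Y) \<otimes> Z)"
  shows "assc C X' Y' Z' \<cdot> ((f \<boxtimes> g) \<boxtimes> h) \<cdot> x = (f \<boxtimes> (g \<boxtimes> h)) \<cdot> assc C X Y Z \<cdot> x"
proof -
  have o: "X \<in> ob C" "Y \<in> ob C" "Z \<in> ob C" "X' \<in> ob C" "Y' \<in> ob C" "Z' \<in> ob C"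
    using assms by auto
  have "assc C X' Y' Z' \<cdot> ((f \<boxtimes> g) \<boxtimes> h) \<cdot> x = (assc C X' Y' Z' \<cdot> ((f \<boxtimes> g) \<boxtimes> h)) \<cdot> x"
    using assms o by (subst cmp_assoc_simp) auto
  also have "\<dots> = ((f \<boxtimes> (g \<boxtimes> h)) \<cdot> assc C X Y Z) \<cdot> x"
    using assc_natural [OF assms(1-3)] by simp
  also have "\<dots> = (f \<boxtimes> (g \<boxtimes> h)) \<cdot> assc C X Y Z \<cdot> x"
    using assms o by (subst cmp_assoc_simp) auto
  finally show ?thesis .
qed

text \<open>Kelly's derivation. Tensored with the unit on the left and precomposed with the
  isomorphism \<open>?q\<close>, the left side is accessible to the pentagon for I, I, X, Y. Two
  triangles and naturality of the associator then produce the right side.\<close>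

lemma lun_tob:
  assumes "X \<in> ob C" "Y \<in> ob C"
  shows "lun C (X \<otimes> Y) \<cdot> assc C (unt C) X Y = lun C X \<boxtimes> idt C Y"
proof (rule lun_faithful)
  let ?I = "unt C"
  let ?q = "assc C ?I (?I \<otimes> X) Y \<cdot> (assc C ?I ?I X \<boxtimes> idt C Y)"
  have "(idt C ?I \<boxtimes> (lun C (X \<otimes> Y) \<cdot> assc C ?I X Y)) \<cdot> ?q
    = (idt C ?I \<boxtimes> lun C (X \<otimes> Y)) \<cdot> (idt C ?I \<boxtimes> assc C ?I X Y) \<cdot> ?q"
    using assms by simp
  also have "\<dots> = (idt C ?I \<boxtimes> lun C (X \<otimes> Y)) \<cdot> assc C ?I ?I (X \<otimes> Y) \<cdot> assc C (?I \<otimes> ?I) X Y"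
    using assms pentagon [of ?I ?I X Y] by simp
  also have "\<dots> = ((idt C ?I \<boxtimes> lun C (X \<otimes> Y)) \<cdot> assc C ?I ?I (X \<otimes> Y)) \<cdot> assc C (?I \<otimes> ?I) X Y"
    using assms by (subst cmp_assoc_simp) auto
  also have "\<dots> = (run C ?I \<boxtimes> (idt C X \<boxtimes> idt C Y)) \<cdot> assc C (?I \<otimes> ?I) X Y"
    using assms triangle [of ?I "X \<otimes> Y"] by simp
  also have "\<dots> = assc C ?I X Y \<cdot> ((run C ?I \<boxtimes> idt C X) \<boxtimes> idt C Y)"
    using assms by (subst assc_natural [symmetric]) auto
  also have "\<dots> = assc C ?I X Y \<cdot> (((idt C ?I \<boxtimes> lun C X) \<boxtimes> idt C Y) \<cdot> (assc C ?I ?I X \<boxtimes> idt C Y))"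
    using assms triangle [of ?I X] by simp
  also have "\<dots> = (idt C ?I \<boxtimes> (lun C X \<boxtimes> idt C Y)) \<cdot> ?q"
    using assms by (subst assc_natural_cmp) auto
  finally show "idt C ?I \<boxtimes> (lun C (X \<otimes> Y) \<cdot> assc C ?I X Y) = idt C ?I \<boxtimes> (lun C X \<boxtimes> idt C Y)"
    by (rule iso_cancel_right [rotated]) (use assms in \<open>auto intro!: inv_arr_cmp\<close>)
qed (use assms in auto)

text \<open>Mirror image of \<open>lun_tob\<close>: the pentagon for X, Y, I, I, after tensoring
  with the unit on the right and postcomposing with an associator.\<close>

lemma run_tob:
  assumes "X \<in> ob C" "Y \<in> ob C"
  shows "(idt C X \<boxtimes> run C Y) \<cdot> assc C X Y (unt C) = run C (X \<otimes> Y)"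
proof (rule run_faithful)
  let ?I = "unt C"
  have "assc C X Y ?I \<cdot> (((idt C X \<boxtimes> run C Y) \<cdot> assc C X Y ?I) \<boxtimes> idt C ?I)
    = assc C X Y ?I \<cdot> ((idt C X \<boxtimes> run C Y) \<boxtimes> idt C ?I) \<cdot> (assc C X Y ?I \<boxtimes> idt C ?I)"
    using assms by simp
  also have "\<dots> = (idt C X \<boxtimes> (run C Y \<boxtimes> idt C ?I)) \<cdot> assc C X (Y \<otimes> ?I) ?I \<cdot> (assc C X Y ?I \<boxtimes> idt C ?I)"
    using assms by (subst assc_natural_cmp) auto
  also have "\<dots> = (idt C X \<boxtimes> (idt C Y \<boxtimes> lun C ?I)) \<cdot> (idt C X \<boxtimes> assc C Y ?I ?I) \<cdot> assc C X (Y \<otimes> ?I) ?I \<cdot> (assc C X Y ?I \<boxtimes> idt C ?I)"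
    using assms by (simp add: triangle)
  also have "\<dots> = (idt C X \<boxtimes> (idt C Y \<boxtimes> lun C ?I)) \<cdot> assc C X Y (?I \<otimes> ?I) \<cdot> assc C (X \<otimes> Y) ?I ?I"
    using assms by (simp only: pentagon unt_ob)
  also have "\<dots> = assc C X Y ?I \<cdot> ((idt C X \<boxtimes> idt C Y) \<boxtimes> lun C ?I) \<cdot> assc C (X \<otimes> Y) ?I ?I"
    using assms by (subst assc_natural_cmp) auto
  also have "\<dots> = assc C X Y ?I \<cdot> (run C (X \<otimes> Y) \<boxtimes> idt C ?I)"
    using assms by (simp add: triangle)
  finally show "((idt C X \<boxtimes> run C Y) \<cdot> assc C X Y ?I) \<boxtimes> idt C ?I = run C (X \<otimes> Y) \<boxtimes> idt C ?I"
    by (rule iso_cancel_left [rotated]) (use assms in auto)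
qed (use assms in auto)

text \<open>Naturality of \<open>lun\<close> at itself identifies the left unitor of I \<otimes> I
  with \<open>lun\<close> tensored by I on the left. Then \<open>lun_tob\<close> and the triangle
  evaluate the same arrow, and tensoring with the unit is faithful.\<close>

lemma lun_unt: "lun C (unt C) = run C (unt C)"
proof (rule run_faithful)
  let ?I = "unt C"
  have eq: "lun C ?I \<cdot> lun C (?I \<otimes> ?I) = lun C ?I \<cdot> (idt C ?I \<boxtimes> lun C ?I)"
    using lun_natural [of "lun C ?I" "?I \<otimes> ?I" ?I] by simp
  have "lun C (?I \<otimes> ?I) = idt C ?I \<boxtimes> lun C ?I"
    by (rule iso_cancel_left [OF _ eq]) auto
  then show "lun C ?I \<boxtimes> idt C ?I = run C ?I \<boxtimes> idt C ?I"
    using lun_tob [of ?I ?I] triangle [of ?I ?I] by simp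
qed auto

end

section \<open>Nested pairings\<close>

context monoidal_category
begin

abbreviation ainv :: "'o \<Rightarrow> 'o \<Rightarrow> 'o \<Rightarrow> 'a" where
  "ainv X Y Z \<equiv> inv_arr C (assc C X Y Z)"

lemma ainv_natural:
  assumes "f \<in> hom C X X'" "g \<in> hom C Y Y'" "h \<in> hom C Z Z'"
  shows "ainv X' Y' Z' \<cdot> (f \<boxtimes> (g \<boxtimes> h)) = ((f \<boxtimes> g) \<boxtimes> h) \<cdot> ainv X Y Z"
proof -
  have o: "X \<in> ob C" "Y \<in> ob C" "Z \<in> ob C" "X' \<in> ob C" "Y' \<in> ob C" "Z' \<in> ob C"
    using assms by auto
  have "(assc C X' Y' Z' \<cdot> ((f \<boxtimes> g) \<boxtimes> h)) \<cdot> ainv X Y Z = ((f \<boxtimes> (g \<boxtimes> h)) \<cdot> assc C X Y Z) \<cdot> ainv X Y Z"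
    by (simp only: assc_natural [OF assms])
  then have "assc C X' Y' Z' \<cdot> ((f \<boxtimes> g) \<boxtimes> h) \<cdot> ainv X Y Z = f \<boxtimes> (g \<boxtimes> h)"
    using assms o by simp
  then have "ainv X' Y' Z' \<cdot> assc C X' Y' Z' \<cdot> ((f \<boxtimes> g) \<boxtimes> h) \<cdot> ainv X Y Z
      = ainv X' Y' Z' \<cdot> (f \<boxtimes> (g \<boxtimes> h))"
    by simp
  then show ?thesis
    using assms o by simp
qed

lemma ainv_natural_cmp:
  assumes "f \<in> hom C X X'" "g \<in> hom C Y Y'" "h \<in> hom C Z Z'" "x \<in> hom C W (X \<otimes> (Y \<otimes> Z))"
  shows "ainv X' Y' Z' \<cdot> (f \<boxtimes> (g \<boxtimes> h)) \<cdot> x = ((f \<boxtimes> g) \<boxtimes> h) \<cdot> ainv X Y Z \<cdot> x"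
proof -
  have o: "X \<in> ob C" "Y \<in> ob C" "Z \<in> ob C" "X' \<in> ob C" "Y' \<in> ob C" "Z' \<in> ob C"
    using assms by auto
  show ?thesis
    using assms o cmp_extend [OF ainv_natural [OF assms(1-3)], of x] by simp
qed

lemma pentagon_cmp:
  assumes "W \<in> ob C" "X \<in> ob C" "Y \<in> ob C" "Z \<in> ob C" "x \<in> hom C V (((W \<otimes> X) \<otimes> Y) \<otimes> Z)"
  shows "assc C W X (Y \<otimes> Z) \<cdot> assc C (W \<otimes> X) Y Z \<cdot> x
    = (idt C W \<boxtimes> assc C X Y Z) \<cdot> assc C W (X \<otimes> Y) Z \<cdot> (assc C W X Y \<boxtimes> idt C Z) \<cdot> x"
  using assms cmp_extend [OF pentagon, of W X Y Z x] by simp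

text \<open>This and \<open>pentagon_inv2\<close> are the pentagon solved for the mixed composites
  of associators and inverse associators that arise when a contraction is moved past a further
  factor.\<close>

lemma pentagon_inv1:
  assumes "W \<in> ob C" "X \<in> ob C" "Y \<in> ob C" "Z \<in> ob C"
  shows "ainv W X (Y \<otimes> Z) \<cdot> (idt C W \<boxtimes> assc C X Y Z)
    = assc C (W \<otimes> X) Y Z \<cdot> (ainv W X Y \<boxtimes> idt C Z) \<cdot> ainv W (X \<otimes> Y) Z"
proof -
  have "assc C W X (Y \<otimes> Z) \<cdot> assc C (W \<otimes> X) Y Z \<cdot> (ainv W X Y \<boxtimes> idt C Z) \<cdot> ainv W (X \<otimes> Y) Z
      = idt C W \<boxtimes> assc C X Y Z"
    using assms by (subst pentagon_cmp) simp_all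
  then have "ainv W X (Y \<otimes> Z) \<cdot> (idt C W \<boxtimes> assc C X Y Z) = ainv W X (Y \<otimes> Z) \<cdot> assc C W X (Y \<otimes> Z)
      \<cdot> assc C (W \<otimes> X) Y Z \<cdot> (ainv W X Y \<boxtimes> idt C Z) \<cdot> ainv W (X \<otimes> Y) Z"
    by simp
  then show ?thesis
    using assms by simp
qed

lemma pentagon_inv2:
  assumes "W \<in> ob C" "X \<in> ob C" "Y \<in> ob C" "Z \<in> ob C"
  shows "ainv W (X \<otimes> Y) Z \<cdot> (idt C W \<boxtimes> ainv X Y Z) \<cdot> assc C W X (Y \<otimes> Z)
    = (assc C W X Y \<boxtimes> idt C Z) \<cdot> ainv (W \<otimes> X) Y Z"
proof -
  have "assc C W X (Y \<otimes> Z) = (assc C W X (Y \<otimes> Z) \<cdot> assc C (W \<otimes> X) Y Z) \<cdot> ainv (W \<otimes> X) Y Z"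
    using assms by simp
  also have "\<dots> = (idt C W \<boxtimes> assc C X Y Z) \<cdot> assc C W (X \<otimes> Y) Z \<cdot> (assc C W X Y \<boxtimes> idt C Z) \<cdot> ainv (W \<otimes> X) Y Z"
    using assms by (subst pentagon) simp_all
  finally show ?thesis
    using assms by simp
qed

text \<open>\<open>cancel_right\<close> contracts the first two of three factors A, X, Y, and
  \<open>cancel_left\<close> the last two of B, A, X. The bracketings A \<otimes> (X \<otimes> Y)
  and (B \<otimes> A) \<otimes> X are the ones that occur in a pairing of tensor products, hence the
  associators.\<close>

definition cancel_right :: "'o \<Rightarrow> 'o \<Rightarrow> 'o \<Rightarrow> 'a \<Rightarrow> 'a" where
  "cancel_right A X Y e = lun C Y \<cdot> (e \<boxtimes> idt C Y) \<cdot> ainv A X Y"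

definition cancel_left :: "'o \<Rightarrow> 'o \<Rightarrow> 'o \<Rightarrow> 'a \<Rightarrow> 'a" where
  "cancel_left B A X e = run C B \<cdot> (idt C B \<boxtimes> e) \<cdot> assc C B A X"

text \<open>The inner pair A, X is contracted by \<open>e\<close>, and what is left, B \<otimes> Y,
  by \<open>f\<close>. The reversed order B \<otimes> A of the left factors is what lets the two
  caps nest without crossing.\<close>

definition nest :: "'o \<Rightarrow> 'o \<Rightarrow> 'o \<Rightarrow> 'o \<Rightarrow> 'a \<Rightarrow> 'a \<Rightarrow> 'a" where
  "nest A X B Y e f = f \<cdot> (cancel_left B A X e \<boxtimes> idt C Y) \<cdot> ainv (B \<otimes> A) X Y"

lemma cancel_simps [simp]:
  assumes "e \<in> arr C" "src C e = A \<otimes> X" "tgt C e = unt C" "A \<in> ob C" "X \<in> ob C" "Y \<in> ob C"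
  shows "cancel_right A X Y e \<in> arr C" "src C (cancel_right A X Y e) = A \<otimes> X \<otimes> Y"
    "tgt C (cancel_right A X Y e) = Y"
    "cancel_left Y A X e \<in> arr C" "src C (cancel_left Y A X e) = (Y \<otimes> A) \<otimes> X"
    "tgt C (cancel_left Y A X e) = Y"
  using assms by (simp_all add: cancel_right_def cancel_left_def)

lemma nest_simps [simp]:
  assumes "e \<in> arr C" "src C e = A \<otimes> X" "tgt C e = unt C" "A \<in> ob C" "X \<in> ob C"
    "f \<in> arr C" "src C f = B \<otimes> Y" "tgt C f = unt C" "B \<in> ob C" "Y \<in> ob C"
  shows "nest A X B Y e f \<in> arr C" "src C (nest A X B Y e f) = (B \<otimes> A) \<otimes> X \<otimes> Y"
    "tgt C (nest A X B Y e f) = unt C"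
  using assms by (simp_all add: nest_def)

text \<open>The middle pair of B, A, X, Y can be contracted from either bracketing: the pentagon
  moves \<open>e\<close> into the other bracket, and the triangle trades the right unitor of B for
  the left unitor of Y. Hence the second form of \<open>nest\<close> in
  \<open>nest_alt\<close>.\<close>

lemma cancel_middle:
  assumes "e \<in> hom C (A \<otimes> X) (unt C)" "A \<in> ob C" "X \<in> ob C" "B \<in> ob C" "Y \<in> ob C"
  shows "(cancel_left B A X e \<boxtimes> idt C Y) \<cdot> ainv (B \<otimes> A) X Y
    = (idt C B \<boxtimes> cancel_right A X Y e) \<cdot> assc C B A (X \<otimes> Y)"
proof -
  have "(cancel_left B A X e \<boxtimes> idt C Y) \<cdot> ainv (B \<otimes> A) X Y
    = (run C B \<boxtimes> idt C Y) \<cdot> ((idt C B \<boxtimes> e) \<boxtimes> idt C Y) \<cdot> (assc C B A X \<boxtimes> idt C Y) \<cdot> ainv (B \<otimes> A) X Y"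
    using assms by (simp add: cancel_left_def)
  also have "\<dots> = (run C B \<boxtimes> idt C Y) \<cdot> ((idt C B \<boxtimes> e) \<boxtimes> idt C Y) \<cdot> ainv B (A \<otimes> X) Y
      \<cdot> (idt C B \<boxtimes> ainv A X Y) \<cdot> assc C B A (X \<otimes> Y)"
    using assms by (simp only: pentagon_inv2)
  also have "\<dots> = (run C B \<boxtimes> idt C Y) \<cdot> ainv B (unt C) Y \<cdot> (idt C B \<boxtimes> (e \<boxtimes> idt C Y))
      \<cdot> (idt C B \<boxtimes> ainv A X Y) \<cdot> assc C B A (X \<otimes> Y)"
    using assms by (subst ainv_natural_cmp) auto
  also have "\<dots> = ((idt C B \<boxtimes> lun C Y) \<cdot> assc C B (unt C) Y) \<cdot> ainv B (unt C) Y \<cdot> (idt C B \<boxtimes> (e \<boxtimes> idt C Y))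
      \<cdot> (idt C B \<boxtimes> ainv A X Y) \<cdot> assc C B A (X \<otimes> Y)"
    using assms by (simp only: triangle)
  also have "\<dots> = (idt C B \<boxtimes> cancel_right A X Y e) \<cdot> assc C B A (X \<otimes> Y)"
    using assms by (simp add: cancel_right_def)
  finally show ?thesis .
qed

lemma nest_alt:
  assumes "e \<in> hom C (A \<otimes> X) (unt C)" "A \<in> ob C" "X \<in> ob C" "B \<in> ob C" "Y \<in> ob C"
  shows "nest A X B Y e f = f \<cdot> (idt C B \<boxtimes> cancel_right A X Y e) \<cdot> assc C B A (X \<otimes> Y)"
  unfolding nest_def cancel_middle [OF assms] ..

text \<open>The factor Z is a spectator of the contraction. Its associator is pushed through by the
  pentagon, and the unitor of Y \<otimes> Z splits by \<open>lun_tob\<close>.\<close>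

lemma cancel_right_tob:
  assumes "e \<in> hom C (A \<otimes> X) (unt C)" "A \<in> ob C" "X \<in> ob C" "Y \<in> ob C" "Z \<in> ob C"
  shows "cancel_right A X (Y \<otimes> Z) e \<cdot> (idt C A \<boxtimes> assc C X Y Z)
    = (cancel_right A X Y e \<boxtimes> idt C Z) \<cdot> ainv A (X \<otimes> Y) Z"
proof -
  have "cancel_right A X (Y \<otimes> Z) e \<cdot> (idt C A \<boxtimes> assc C X Y Z)
    = lun C (Y \<otimes> Z) \<cdot> (e \<boxtimes> (idt C Y \<boxtimes> idt C Z)) \<cdot> ainv A X (Y \<otimes> Z) \<cdot> (idt C A \<boxtimes> assc C X Y Z)"
    using assms by (simp add: cancel_right_def)
  also have "\<dots> = lun C (Y \<otimes> Z) \<cdot> (e \<boxtimes> (idt C Y \<boxtimes> idt C Z)) \<cdot> assc C (A \<otimes> X) Y Z \<cdot> (ainv A X Y \<boxtimes> idt C Z) \<cdot> ainv A (X \<otimes> Y) Z"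
    using assms by (simp only: pentagon_inv1)
  also have "\<dots> = lun C (Y \<otimes> Z) \<cdot> assc C (unt C) Y Z \<cdot> ((e \<boxtimes> idt C Y) \<boxtimes> idt C Z) \<cdot> (ainv A X Y \<boxtimes> idt C Z) \<cdot> ainv A (X \<otimes> Y) Z"
    using assms by (subst assc_natural_cmp) auto
  also have "\<dots> = (lun C (Y \<otimes> Z) \<cdot> assc C (unt C) Y Z) \<cdot> ((e \<boxtimes> idt C Y) \<boxtimes> idt C Z) \<cdot> (ainv A X Y \<boxtimes> idt C Z) \<cdot> ainv A (X \<otimes> Y) Z"
    using assms by simp
  also have "\<dots> = (cancel_right A X Y e \<boxtimes> idt C Z) \<cdot> ainv A (X \<otimes> Y) Z"
    unfolding lun_tob [OF assms(4,5)] using assms by (simp add: cancel_right_def)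
  finally show ?thesis .
qed

lemma cancel_right_natural:
  assumes "e \<in> hom C (A \<otimes> X) (unt C)" "u \<in> hom C A' A" "x \<in> hom C X' X" "y \<in> hom C Y' Y"
    and o: "A \<in> ob C" "X \<in> ob C"
  shows "y \<cdot> cancel_right A' X' Y' (e \<cdot> (u \<boxtimes> x)) = cancel_right A X Y e \<cdot> (u \<boxtimes> (x \<boxtimes> y))"
proof -
  have o': "A' \<in> ob C" "X' \<in> ob C" "Y \<in> ob C" "Y' \<in> ob C"
    using assms by auto
  have "y \<cdot> cancel_right A' X' Y' (e \<cdot> (u \<boxtimes> x))
    = (y \<cdot> lun C Y') \<cdot> ((e \<cdot> (u \<boxtimes> x)) \<boxtimes> idt C Y') \<cdot> ainv A' X' Y'"
    using assms o' by (simp add: cancel_right_def)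
  also have "\<dots> = (lun C Y \<cdot> (idt C (unt C) \<boxtimes> y)) \<cdot> ((e \<cdot> (u \<boxtimes> x)) \<boxtimes> idt C Y') \<cdot> ainv A' X' Y'"
    by (simp only: lun_natural [OF assms(4)])
  also have "\<dots> = lun C Y \<cdot> (e \<boxtimes> idt C Y) \<cdot> ((u \<boxtimes> x) \<boxtimes> y) \<cdot> ainv A' X' Y'"
    using assms o' by simp
  also have "\<dots> = lun C Y \<cdot> (e \<boxtimes> idt C Y) \<cdot> ainv A X Y \<cdot> (u \<boxtimes> (x \<boxtimes> y))"
    by (simp only: ainv_natural [OF assms(2-4)])
  also have "\<dots> = cancel_right A X Y e \<cdot> (u \<boxtimes> (x \<boxtimes> y))"
    using assms o' by (simp add: cancel_right_def)
  finally show ?thesis .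
qed

lemma nest_natural:
  assumes "e \<in> hom C (A \<otimes> X) (unt C)" "f \<in> hom C (B \<otimes> Y) (unt C)"
    "u \<in> hom C A' A" "x \<in> hom C X' X" "v \<in> hom C B' B" "y \<in> hom C Y' Y"
    and o: "A \<in> ob C" "X \<in> ob C"
  shows "nest A' X' B' Y' (e \<cdot> (u \<boxtimes> x)) (f \<cdot> (v \<boxtimes> y)) = nest A X B Y e f \<cdot> ((v \<boxtimes> u) \<boxtimes> (x \<boxtimes> y))"
proof -
  have o': "A' \<in> ob C" "X' \<in> ob C" "Y \<in> ob C" "Y' \<in> ob C" "B \<in> ob C" "B' \<in> ob C"
    using assms by auto
  have "nest A' X' B' Y' (e \<cdot> (u \<boxtimes> x)) (f \<cdot> (v \<boxtimes> y))
    = f \<cdot> (v \<boxtimes> (y \<cdot> cancel_right A' X' Y' (e \<cdot> (u \<boxtimes> x)))) \<cdot> assc C B' A' (X' \<otimes> Y')"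
    using assms o' by (subst nest_alt) auto
  also have "\<dots> = f \<cdot> (idt C B \<boxtimes> cancel_right A X Y e) \<cdot> (v \<boxtimes> (u \<boxtimes> (x \<boxtimes> y))) \<cdot> assc C B' A' (X' \<otimes> Y')"
    unfolding cancel_right_natural [OF assms(1,3,4,6) o] using assms o' by simp
  also have "\<dots> = f \<cdot> (idt C B \<boxtimes> cancel_right A X Y e) \<cdot> assc C B A (X \<otimes> Y) \<cdot> ((v \<boxtimes> u) \<boxtimes> (x \<boxtimes> y))"
    using assms o' by (subst assc_natural) auto
  also have "\<dots> = nest A X B Y e f \<cdot> ((v \<boxtimes> u) \<boxtimes> (x \<boxtimes> y))"
    using assms o' by (subst nest_alt) auto
  finally show ?thesis .
qed

text \<open>Prepares \<open>nest_assoc\<close>: once a contraction by a nested pairing is split into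
  the inner and the outer one, only associators remain to be compared.\<close>

lemma cancel_right_nest:
  assumes "e \<in> hom C (A \<otimes> X) (unt C)" "f \<in> hom C (B \<otimes> Y) (unt C)"
    and o: "A \<in> ob C" "X \<in> ob C" "B \<in> ob C" "Y \<in> ob C" "Z \<in> ob C"
  shows "cancel_right (B \<otimes> A) (X \<otimes> Y) Z (nest A X B Y e f)
    = cancel_right B Y Z f \<cdot> (idt C B \<boxtimes> cancel_right A X (Y \<otimes> Z) e) \<cdot> assc C B A (X \<otimes> Y \<otimes> Z)
      \<cdot> (idt C (B \<otimes> A) \<boxtimes> assc C X Y Z)"
proof -
  let ?e = "cancel_right A X Y e"
  have "cancel_right B Y Z f \<cdot> (idt C B \<boxtimes> cancel_right A X (Y \<otimes> Z) e) \<cdot> assc C B A (X \<otimes> Y \<otimes> Z)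
      \<cdot> (idt C (B \<otimes> A) \<boxtimes> assc C X Y Z)
    = cancel_right B Y Z f \<cdot> (idt C B \<boxtimes> cancel_right A X (Y \<otimes> Z) e) \<cdot> assc C B A (X \<otimes> Y \<otimes> Z)
      \<cdot> ((idt C B \<boxtimes> idt C A) \<boxtimes> assc C X Y Z)"
    using o by simp
  also have "\<dots> = cancel_right B Y Z f \<cdot> (idt C B \<boxtimes> cancel_right A X (Y \<otimes> Z) e)
      \<cdot> (idt C B \<boxtimes> (idt C A \<boxtimes> assc C X Y Z)) \<cdot> assc C B A ((X \<otimes> Y) \<otimes> Z)"
    using o by (subst assc_natural) auto
  also have "\<dots> = cancel_right B Y Z f \<cdot> (idt C B \<boxtimes> (cancel_right A X (Y \<otimes> Z) e \<cdot> (idt C A \<boxtimes> assc C X Y Z)))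
      \<cdot> assc C B A ((X \<otimes> Y) \<otimes> Z)"
    using assms by simp
  also have "\<dots> = lun C Z \<cdot> (f \<boxtimes> idt C Z) \<cdot> ainv B Y Z \<cdot> (idt C B \<boxtimes> (?e \<boxtimes> idt C Z))
      \<cdot> (idt C B \<boxtimes> ainv A (X \<otimes> Y) Z) \<cdot> assc C B A ((X \<otimes> Y) \<otimes> Z)"
    unfolding cancel_right_tob [OF assms(1) o(1,2,4,5)] using assms
    by (simp add: cancel_right_def [of B])
  also have "\<dots> = lun C Z \<cdot> (f \<boxtimes> idt C Z) \<cdot> ((idt C B \<boxtimes> ?e) \<boxtimes> idt C Z) \<cdot> ainv B (A \<otimes> X \<otimes> Y) Z
      \<cdot> (idt C B \<boxtimes> ainv A (X \<otimes> Y) Z) \<cdot> assc C B A ((X \<otimes> Y) \<otimes> Z)"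
    using assms by (subst ainv_natural_cmp) auto
  also have "\<dots> = lun C Z \<cdot> (f \<boxtimes> idt C Z) \<cdot> ((idt C B \<boxtimes> ?e) \<boxtimes> idt C Z) \<cdot>
      (assc C B A (X \<otimes> Y) \<boxtimes> idt C Z) \<cdot> ainv (B \<otimes> A) (X \<otimes> Y) Z"
    using assms by (subst pentagon_inv2) auto
  also have "\<dots> = cancel_right (B \<otimes> A) (X \<otimes> Y) Z (nest A X B Y e f)"
    using assms by (simp add: cancel_right_def [of "B \<otimes> A"] nest_alt)
  finally show ?thesis ..
qed

text \<open>Both sides are three caps with \<open>e\<close> innermost and \<open>g\<close>
  outermost, so they differ only in bracketing. After \<open>cancel_right_nest\<close> a single
  pentagon for S, B, A and X \<otimes> Y \<otimes> Z settles the difference.\<close>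

lemma nest_assoc:
  assumes "e \<in> hom C (A \<otimes> X) (unt C)" "f \<in> hom C (B \<otimes> Y) (unt C)" "g \<in> hom C (S \<otimes> Z) (unt C)"
    and o: "A \<in> ob C" "X \<in> ob C" "B \<in> ob C" "Y \<in> ob C" "S \<in> ob C" "Z \<in> ob C"
  shows "nest (B \<otimes> A) (X \<otimes> Y) S Z (nest A X B Y e f) g \<cdot> (assc C S B A \<boxtimes> ainv X Y Z)
    = nest A X (S \<otimes> B) (Y \<otimes> Z) e (nest B Y S Z f g)"
proof -
  let ?e = "cancel_right A X (Y \<otimes> Z) e" and ?f = "cancel_right B Y Z f"
  let ?T = "X \<otimes> Y \<otimes> Z"
  have "nest (B \<otimes> A) (X \<otimes> Y) S Z (nest A X B Y e f) g \<cdot> (assc C S B A \<boxtimes> ainv X Y Z)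
    = g \<cdot> (idt C S \<boxtimes> ?f) \<cdot> (idt C S \<boxtimes> (idt C B \<boxtimes> ?e)) \<cdot> (idt C S \<boxtimes> assc C B A ?T)
      \<cdot> (idt C S \<boxtimes> (idt C (B \<otimes> A) \<boxtimes> assc C X Y Z)) \<cdot> assc C S (B \<otimes> A) ((X \<otimes> Y) \<otimes> Z)
      \<cdot> (assc C S B A \<boxtimes> ainv X Y Z)"
    using assms by (subst nest_alt) (simp_all add: cancel_right_nest)
  also have "\<dots> = g \<cdot> (idt C S \<boxtimes> ?f) \<cdot> (idt C S \<boxtimes> (idt C B \<boxtimes> ?e)) \<cdot> (idt C S \<boxtimes> assc C B A ?T)
      \<cdot> assc C S (B \<otimes> A) ?T \<cdot> ((idt C S \<boxtimes> idt C (B \<otimes> A)) \<boxtimes> assc C X Y Z)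
      \<cdot> (assc C S B A \<boxtimes> ainv X Y Z)"
    using assms by (subst assc_natural_cmp) auto
  also have "\<dots> = g \<cdot> (idt C S \<boxtimes> ?f) \<cdot> (idt C S \<boxtimes> (idt C B \<boxtimes> ?e)) \<cdot> (idt C S \<boxtimes> assc C B A ?T)
      \<cdot> assc C S (B \<otimes> A) ?T \<cdot> (assc C S B A \<boxtimes> idt C ?T)"
    using assms by simp
  also have "\<dots> = g \<cdot> (idt C S \<boxtimes> ?f) \<cdot> (idt C S \<boxtimes> (idt C B \<boxtimes> ?e)) \<cdot> assc C S B (A \<otimes> ?T)
      \<cdot> assc C (S \<otimes> B) A ?T"
    using o by (simp only: pentagon tob_ob)
  also have "\<dots> = g \<cdot> (idt C S \<boxtimes> ?f) \<cdot> assc C S B (Y \<otimes> Z) \<cdot> ((idt C S \<boxtimes> idt C B) \<boxtimes> ?e)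
      \<cdot> assc C (S \<otimes> B) A ?T"
    using assms by (subst assc_natural_cmp) auto
  also have "\<dots> = nest A X (S \<otimes> B) (Y \<otimes> Z) e (nest B Y S Z f g)"
    using assms by (simp add: nest_alt)
  finally show ?thesis .
qed

text \<open>The unit pairing is the inner cap here. One triangle evaluates it, and a second one
  turns the right unitor left over on A into the left unitor of X.\<close>

lemma nest_lun_left:
  assumes "e \<in> hom C (A \<otimes> X) (unt C)" and o: "A \<in> ob C" "X \<in> ob C"
  shows "nest (unt C) (unt C) A X (lun C (unt C)) e = e \<cdot> (run C A \<boxtimes> lun C X)"
proof -
  let ?I = "unt C"
  have "nest ?I ?I A X (lun C ?I) e
    = e \<cdot> (run C A \<boxtimes> idt C X) \<cdot> (((idt C A \<boxtimes> lun C ?I) \<cdot> assc C A ?I ?I) \<boxtimes> idt C X) \<cdot> ainv (A \<otimes> ?I) ?I X"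
    using assms by (simp add: nest_def cancel_left_def)
  also have "\<dots> = e \<cdot> (run C A \<boxtimes> idt C X) \<cdot> ((run C A \<boxtimes> idt C ?I) \<boxtimes> idt C X) \<cdot> ainv (A \<otimes> ?I) ?I X"
    using o by (simp only: triangle unt_ob)
  also have "\<dots> = e \<cdot> (run C A \<boxtimes> idt C X) \<cdot> ainv A ?I X \<cdot> (run C A \<boxtimes> (idt C ?I \<boxtimes> idt C X))"
    using assms by (subst ainv_natural) auto
  also have "\<dots> = e \<cdot> ((idt C A \<boxtimes> lun C X) \<cdot> assc C A ?I X) \<cdot> ainv A ?I X \<cdot> (run C A \<boxtimes> (idt C ?I \<boxtimes> idt C X))"
    using o by (simp only: triangle)
  also have "\<dots> = e \<cdot> (run C A \<boxtimes> lun C X)"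
    using assms by simp
  finally show ?thesis .
qed

text \<open>The unit pairing is the outer cap here. The contraction by \<open>e\<close> ends in the
  unit, so naturality of the unitors carries them to the source of \<open>e\<close>, where
  \<open>run_tob\<close> and \<open>lun_tob\<close> simplify them.\<close>

lemma nest_lun_right:
  assumes "e \<in> hom C (A \<otimes> X) (unt C)" and o: "A \<in> ob C" "X \<in> ob C"
  shows "nest A X (unt C) (unt C) e (lun C (unt C)) = e \<cdot> (lun C A \<boxtimes> run C X)"
proof -
  let ?I = "unt C"
  have "cancel_right A X ?I e = (run C ?I \<cdot> (e \<boxtimes> idt C ?I)) \<cdot> ainv A X ?I"
    using assms by (simp add: cancel_right_def lun_unt)
  also have "\<dots> = e \<cdot> ((idt C A \<boxtimes> run C X) \<cdot> assc C A X ?I) \<cdot> ainv A X ?I"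
    unfolding run_natural [OF assms(1)] using assms by (simp add: run_tob)
  also have "\<dots> = e \<cdot> (idt C A \<boxtimes> run C X)"
    using assms by simp
  finally have e: "cancel_right A X ?I e = e \<cdot> (idt C A \<boxtimes> run C X)" .
  have h: "cancel_right A X ?I e \<in> hom C (A \<otimes> X \<otimes> ?I) ?I"
    using assms by simp
  have "nest A X ?I ?I e (lun C ?I)
    = (lun C ?I \<cdot> (idt C ?I \<boxtimes> cancel_right A X ?I e)) \<cdot> assc C ?I A (X \<otimes> ?I)"
    using assms by (simp add: nest_alt)
  also have "\<dots> = cancel_right A X ?I e \<cdot> lun C (A \<otimes> X \<otimes> ?I) \<cdot> assc C ?I A (X \<otimes> ?I)"
    unfolding lun_natural [OF h] using assms by simp
  also have "\<dots> = e \<cdot> (lun C A \<boxtimes> run C X)"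
    unfolding e using assms by (simp add: lun_tob)
  finally show ?thesis .
qed

end

section \<open>Opposite categories and braidings\<close>

lemma op_cat_simps [simp]:
  "ob (op_cat C) = ob C" "arr (op_cat C) = arr C" "src (op_cat C) = tgt C" "tgt (op_cat C) = src C"
  "idt (op_cat C) = idt C" "g \<cdot>\<^bsub>op_cat C\<^esub> f = f \<cdot>\<^bsub>C\<^esub> g"
  "X \<otimes>\<^bsub>op_cat C\<^esub> Y = X \<otimes>\<^bsub>C\<^esub> Y" "f \<boxtimes>\<^bsub>op_cat C\<^esub> g = f \<boxtimes>\<^bsub>C\<^esub> g" "unt (op_cat C) = unt C"
  "assc (op_cat C) X Y Z = inv_arr C (assc C X Y Z)"
  "lun (op_cat C) X = inv_arr C (lun C X)" "run (op_cat C) X = inv_arr C (run C X)"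
  by (simp_all add: op_cat_def)

context monoidal_category
begin

lemma iso_op:
  assumes "iso_arr C f"
  shows "iso_arr (op_cat C) (inv_arr C f)"
proof -
  have "inverse_arrows (op_cat C) (inv_arr C f) f"
    using assms iso_arr_arr by (auto simp: inverse_arrows_def)
  then show ?thesis
    by (auto simp: iso_arr_def)
qed

text \<open>This and \<open>pentagon_inv\<close> are the coherence axioms of the opposite category,
  whose constraints are the inverse ones.\<close>

lemma triangle_inv:
  assumes "X \<in> ob C" "Y \<in> ob C"
  shows "ainv X (unt C) Y \<cdot> (idt C X \<boxtimes> inv_arr C (lun C Y)) = inv_arr C (run C X) \<boxtimes> idt C Y"
proof -
  have "(run C X \<boxtimes> idt C Y) \<cdot> ainv X (unt C) Y \<cdot> (idt C X \<boxtimes> inv_arr C (lun C Y))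
    = ((idt C X \<boxtimes> lun C Y) \<cdot> assc C X (unt C) Y) \<cdot> ainv X (unt C) Y \<cdot> (idt C X \<boxtimes> inv_arr C (lun C Y))"
    by (simp only: triangle [OF assms])
  also have "\<dots> = (run C X \<boxtimes> idt C Y) \<cdot> (inv_arr C (run C X) \<boxtimes> idt C Y)"
    using assms by simp
  finally show ?thesis
    by (rule iso_cancel_left [rotated]) (use assms in simp_all)
qed

lemma pentagon_inv:
  assumes "W \<in> ob C" "X \<in> ob C" "Y \<in> ob C" "Z \<in> ob C"
  shows "ainv (W \<otimes> X) Y Z \<cdot> ainv W X (Y \<otimes> Z)
    = ((ainv W X Y \<boxtimes> idt C Z) \<cdot> ainv W (X \<otimes> Y) Z) \<cdot> (idt C W \<boxtimes> ainv X Y Z)"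
proof -
  have "(assc C W X (Y \<otimes> Z) \<cdot> assc C (W \<otimes> X) Y Z) \<cdot> ainv (W \<otimes> X) Y Z \<cdot> ainv W X (Y \<otimes> Z)
    = (assc C W X (Y \<otimes> Z) \<cdot> assc C (W \<otimes> X) Y Z) \<cdot> (ainv W X Y \<boxtimes> idt C Z) \<cdot> ainv W (X \<otimes> Y) Z \<cdot> (idt C W \<boxtimes> ainv X Y Z)"
    using assms by (subst (2) pentagon) simp_all
  then show ?thesis
    by (rule iso_cancel_left [rotated, THEN trans]) (use assms in \<open>simp_all add: inv_arr_cmp\<close>)
qed

lemma inv_natural:
  assumes "a' \<cdot> f = g \<cdot> a" "iso_arr C a" "iso_arr C a'" "f \<in> arr C" "g \<in> arr C"
    "tgt C f = src C a'" "src C f = src C a" "src C g = tgt C a" "tgt C g = tgt C a'"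
  shows "f \<cdot> inv_arr C a = inv_arr C a' \<cdot> g"
proof -
  note [simp] = iso_arr_arr [OF assms(2)] iso_arr_arr [OF assms(3)]
  have "inv_arr C a' \<cdot> (a' \<cdot> f) \<cdot> inv_arr C a = inv_arr C a' \<cdot> (g \<cdot> a) \<cdot> inv_arr C a"
    by (simp only: assms(1))
  then show ?thesis
    using assms(2-) by simp
qed

lemma monoidal_category_op: "monoidal_category (op_cat C)"
proof
  fix W X Y Z
  assume "W \<in> ob (op_cat C)" "X \<in> ob (op_cat C)" "Y \<in> ob (op_cat C)" "Z \<in> ob (op_cat C)"
  then show "assc (op_cat C) W X (Y \<otimes>\<^bsub>op_cat C\<^esub> Z) \<cdot>\<^bsub>op_cat C\<^esub> assc (op_cat C) (W \<otimes>\<^bsub>op_cat C\<^esub> X) Y Z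
      = (idt (op_cat C) W \<boxtimes>\<^bsub>op_cat C\<^esub> assc (op_cat C) X Y Z)
        \<cdot>\<^bsub>op_cat C\<^esub> assc (op_cat C) W (X \<otimes>\<^bsub>op_cat C\<^esub> Y) Z
        \<cdot>\<^bsub>op_cat C\<^esub> (assc (op_cat C) W X Y \<boxtimes>\<^bsub>op_cat C\<^esub> idt (op_cat C) Z)"
    using pentagon_inv [of W X Y Z] by simp
next
  fix X X' Y Y' Z Z' f g h
  assume a: "f \<in> hom (op_cat C) X X'" "g \<in> hom (op_cat C) Y Y'" "h \<in> hom (op_cat C) Z Z'"
  then have o: "X \<in> ob C" "Y \<in> ob C" "Z \<in> ob C" "X' \<in> ob C" "Y' \<in> ob C" "Z' \<in> ob C"
    by auto
  show "assc (op_cat C) X' Y' Z' \<cdot>\<^bsub>op_cat C\<^esub> ((f \<boxtimes>\<^bsub>op_cat C\<^esub> g) \<boxtimes>\<^bsub>op_cat C\<^esub> h)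
      = (f \<boxtimes>\<^bsub>op_cat C\<^esub> (g \<boxtimes>\<^bsub>op_cat C\<^esub> h)) \<cdot>\<^bsub>op_cat C\<^esub> assc (op_cat C) X Y Z"
    using a o ainv_natural [of f X' X g Y' Y h Z' Z] by simp
next
  fix f X Y
  assume "f \<in> hom (op_cat C) X Y"
  then have f: "f \<in> hom C Y X" "X \<in> ob C" "Y \<in> ob C"
    by auto
  show "lun (op_cat C) Y \<cdot>\<^bsub>op_cat C\<^esub> (idt (op_cat C) (unt (op_cat C)) \<boxtimes>\<^bsub>op_cat C\<^esub> f) = f \<cdot>\<^bsub>op_cat C\<^esub> lun (op_cat C) X"
    using inv_natural [OF lun_natural [OF f(1)]] f by simp
  show "run (op_cat C) Y \<cdot>\<^bsub>op_cat C\<^esub> (f \<boxtimes>\<^bsub>op_cat C\<^esub> idt (op_cat C) (unt (op_cat C))) = f \<cdot>\<^bsub>op_cat C\<^esub> run (op_cat C) X"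
    using inv_natural [OF run_natural [OF f(1)]] f by simp
qed (auto simp: triangle_inv iso_op)

end

section \<open>Braidings: compatibility with the unit, Yang-Baxter, and crossings at caps\<close>

context braided_monoidal_category
begin

declare braid_iso [simp]

lemma braid_simps [simp]:
  assumes "X \<in> ob C" "Y \<in> ob C"
  shows "braid C X Y \<in> arr C" "src C (braid C X Y) = X \<otimes> Y" "tgt C (braid C X Y) = Y \<otimes> X"
  using braid_hom assms by auto

text \<open>The unit laws of a braiding follow from the hexagons. With two units in
  \<open>hexagon1\<close>, the arrow \<open>?h\<close> satisfies \<open>?h \<cdot> (?h \<boxtimes>
  idt C ?I) = ?h \<cdot> (run C X \<boxtimes> idt C ?I)\<close>. The isomorphism \<open>?h\<close>
  cancels, and tensoring with the unit is faithful.\<close>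

lemma lun_braid:
  assumes X: "X \<in> ob C"
  shows "lun C X \<cdot> braid C X (unt C) = run C X"
proof (rule run_faithful)
  let ?I = "unt C"
  let ?h = "lun C X \<cdot> braid C X ?I"
  have i: "iso_arr C ?h"
    using X by (intro inv_arr_cmp) simp_all
  have "braid C X ?I \<cdot> (run C X \<boxtimes> idt C ?I) = braid C X ?I \<cdot> (idt C X \<boxtimes> lun C ?I) \<cdot> assc C X ?I ?I"
    using X by (simp add: triangle)
  also have "\<dots> = (braid C X ?I \<cdot> (idt C X \<boxtimes> run C ?I)) \<cdot> assc C X ?I ?I"
    using X by (simp add: lun_unt)
  also have "\<dots> = (run C ?I \<boxtimes> idt C X) \<cdot> braid C X (?I \<otimes> ?I) \<cdot> assc C X ?I ?I"
    using X by (subst braid_natural) auto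
  also have "\<dots> = ((idt C ?I \<boxtimes> lun C X) \<cdot> assc C ?I ?I X) \<cdot> braid C X (?I \<otimes> ?I) \<cdot> assc C X ?I ?I"
    using X by (simp only: triangle unt_ob)
  also have "\<dots> = (idt C ?I \<boxtimes> lun C X) \<cdot> (assc C ?I ?I X \<cdot> braid C X (?I \<otimes> ?I) \<cdot> assc C X ?I ?I)"
    using X by simp
  also have "\<dots> = (idt C ?I \<boxtimes> ?h) \<cdot> assc C ?I X ?I \<cdot> (braid C X ?I \<boxtimes> idt C ?I)"
    unfolding hexagon1 [OF X unt_ob unt_ob] using X by simp
  finally have "lun C X \<cdot> braid C X ?I \<cdot> (run C X \<boxtimes> idt C ?I)
    = lun C X \<cdot> (idt C ?I \<boxtimes> ?h) \<cdot> assc C ?I X ?I \<cdot> (braid C X ?I \<boxtimes> idt C ?I)"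
    by (simp only:)
  also have "\<dots> = (lun C X \<cdot> (idt C ?I \<boxtimes> ?h)) \<cdot> assc C ?I X ?I \<cdot> (braid C X ?I \<boxtimes> idt C ?I)"
    using X by simp
  also have "\<dots> = (?h \<cdot> lun C (X \<otimes> ?I)) \<cdot> assc C ?I X ?I \<cdot> (braid C X ?I \<boxtimes> idt C ?I)"
    using X by (subst lun_natural [of ?h "X \<otimes> ?I" X]) simp_all
  also have "\<dots> = ?h \<cdot> (lun C (X \<otimes> ?I) \<cdot> assc C ?I X ?I) \<cdot> (braid C X ?I \<boxtimes> idt C ?I)"
    using X by simp
  also have "\<dots> = ?h \<cdot> (?h \<boxtimes> idt C ?I)"
    unfolding lun_tob [OF X unt_ob] using X by simp
  finally have "?h \<cdot> (?h \<boxtimes> idt C ?I) = ?h \<cdot> (run C X \<boxtimes> idt C ?I)"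
    using X by simp
  then show "?h \<boxtimes> idt C ?I = run C X \<boxtimes> idt C ?I"
    by (rule iso_cancel_left [OF i]) (use X in simp_all)
qed (use X in simp_all)

text \<open>The argument of \<open>lun_braid\<close> with \<open>hexagon2\<close> and the units on
  the left.\<close>

lemma run_braid:
  assumes X: "X \<in> ob C"
  shows "run C X \<cdot> braid C (unt C) X = lun C X"
proof -
  let ?I = "unt C"
  let ?h = "run C X \<cdot> braid C ?I X"
  have i: "iso_arr C ?h"
    using X by (intro inv_arr_cmp) simp_all
  \<comment> \<open>The triangle with its associator on the other side, as \<open>hexagon2\<close>
    is written with inverse associators.\<close>
  have r: "(run C Y \<boxtimes> idt C Z) \<cdot> ainv Y ?I Z = idt C Y \<boxtimes> lun C Z" if "Y \<in> ob C" "Z \<in> ob C" for Y Z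
  proof -
    have "(run C Y \<boxtimes> idt C Z) \<cdot> ainv Y ?I Z = ((idt C Y \<boxtimes> lun C Z) \<cdot> assc C Y ?I Z) \<cdot> ainv Y ?I Z"
      using that by (simp only: triangle)
    then show ?thesis
      using that by simp
  qed
  have "braid C ?I X \<cdot> (idt C ?I \<boxtimes> lun C X) = braid C ?I X \<cdot> (lun C ?I \<boxtimes> idt C X) \<cdot> ainv ?I ?I X"
    using X by (simp add: r lun_unt)
  also have "\<dots> = (braid C ?I X \<cdot> (lun C ?I \<boxtimes> idt C X)) \<cdot> ainv ?I ?I X"
    using X by simp
  also have "\<dots> = (idt C X \<boxtimes> lun C ?I) \<cdot> braid C (?I \<otimes> ?I) X \<cdot> ainv ?I ?I X"
    using X by (subst braid_natural) auto
  also have "\<dots> = (run C X \<boxtimes> idt C ?I) \<cdot> (ainv X ?I ?I \<cdot> braid C (?I \<otimes> ?I) X \<cdot> ainv ?I ?I X)"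
    unfolding r [OF X unt_ob, symmetric] using X by simp
  also have "\<dots> = (?h \<boxtimes> idt C ?I) \<cdot> ainv ?I X ?I \<cdot> (idt C ?I \<boxtimes> braid C ?I X)"
    unfolding hexagon2 [OF unt_ob unt_ob X] using X by simp
  finally have "run C X \<cdot> braid C ?I X \<cdot> (idt C ?I \<boxtimes> lun C X)
    = run C X \<cdot> (?h \<boxtimes> idt C ?I) \<cdot> ainv ?I X ?I \<cdot> (idt C ?I \<boxtimes> braid C ?I X)"
    by (simp only:)
  also have "\<dots> = (run C X \<cdot> (?h \<boxtimes> idt C ?I)) \<cdot> ainv ?I X ?I \<cdot> (idt C ?I \<boxtimes> braid C ?I X)"
    using X by simp
  also have "\<dots> = (?h \<cdot> ((idt C ?I \<boxtimes> run C X) \<cdot> assc C ?I X ?I)) \<cdot> ainv ?I X ?I \<cdot> (idt C ?I \<boxtimes> braid C ?I X)"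
    unfolding run_tob [OF unt_ob X] using X by (subst run_natural [of ?h "?I \<otimes> X" X]) simp_all
  also have "\<dots> = ?h \<cdot> (idt C ?I \<boxtimes> ?h)"
    using X by simp
  finally have "?h \<cdot> (idt C ?I \<boxtimes> ?h) = ?h \<cdot> (idt C ?I \<boxtimes> lun C X)"
    using X by simp
  then have "idt C ?I \<boxtimes> ?h = idt C ?I \<boxtimes> lun C X"
    by (rule iso_cancel_left [OF i]) (use X in simp_all)
  then show ?thesis
    by (rule lun_faithful) (use X in simp_all)
qed

text \<open>The half twist on three strands, read in two ways: \<open>hexagon2\<close> splits the
  crossing of X \<otimes> Y with Z, \<open>hexagon1\<close> regroups the crossings so that X moves
  past Z \<otimes> Y at once, and naturality exchanges this with the crossing of Y and Z.\<close>

lemma yang_baxter: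
  assumes "X \<in> ob C" "Y \<in> ob C" "Z \<in> ob C"
  shows "assc C Z Y X \<cdot> (braid C Y Z \<boxtimes> idt C X) \<cdot> braid C X (Y \<otimes> Z) \<cdot> assc C X Y Z
    = (idt C Z \<boxtimes> braid C X Y) \<cdot> braid C (X \<otimes> Y) Z"
proof -
  have "(idt C Z \<boxtimes> braid C X Y) \<cdot> braid C (X \<otimes> Y) Z
    = (idt C Z \<boxtimes> braid C X Y) \<cdot> assc C Z X Y
      \<cdot> (ainv Z X Y \<cdot> braid C (X \<otimes> Y) Z \<cdot> ainv X Y Z) \<cdot> assc C X Y Z"
    using assms by simp
  also have "\<dots> = ((idt C Z \<boxtimes> braid C X Y) \<cdot> assc C Z X Y \<cdot> (braid C X Z \<boxtimes> idt C Y)) \<cdot> ainv X Z Y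
      \<cdot> (idt C X \<boxtimes> braid C Y Z) \<cdot> assc C X Y Z"
    unfolding hexagon2 [OF assms] using assms by simp
  also have "\<dots> = assc C Z Y X \<cdot> (braid C X (Z \<otimes> Y) \<cdot> (idt C X \<boxtimes> braid C Y Z)) \<cdot> assc C X Y Z"
    unfolding hexagon1 [OF assms(1,3,2), symmetric] using assms by simp
  also have "\<dots> = assc C Z Y X \<cdot> (braid C Y Z \<boxtimes> idt C X) \<cdot> braid C X (Y \<otimes> Z) \<cdot> assc C X Y Z"
    using assms by (subst braid_natural) auto
  finally show ?thesis ..
qed

text \<open>An arrow into the unit moves past B at the price of one braiding:
  \<open>run_braid\<close> inserts the braiding with the unit, and naturality carries it to the
  source of \<open>e\<close>.\<close>

lemma lun_cancel:
  assumes "e \<in> hom C A (unt C)" "A \<in> ob C" "B \<in> ob C"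
  shows "lun C B \<cdot> (e \<boxtimes> idt C B) = run C B \<cdot> (idt C B \<boxtimes> e) \<cdot> braid C A B"
proof -
  have "lun C B \<cdot> (e \<boxtimes> idt C B) = run C B \<cdot> braid C (unt C) B \<cdot> (e \<boxtimes> idt C B)"
    using assms by (simp flip: run_braid)
  also have "\<dots> = run C B \<cdot> (idt C B \<boxtimes> e) \<cdot> braid C A B"
    using assms by (subst braid_natural) auto
  finally show ?thesis .
qed

text \<open>Pulls the strand B through the cap \<open>e\<close>. By \<open>hexagon2\<close> its
  crossings with A and with X make up the crossing with A \<otimes> X, which
  \<open>lun_cancel\<close> absorbs. So a crossing with A is traded for an inverse crossing with
  X.\<close>

lemma cancel_left_braid:
  assumes "e \<in> hom C (A \<otimes> X) (unt C)" and o: "A \<in> ob C" "X \<in> ob C" "B \<in> ob C"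
  shows "cancel_left B A X e \<cdot> (braid C A B \<boxtimes> idt C X)
    = cancel_right A X B e \<cdot> (idt C A \<boxtimes> inv_arr C (braid C X B)) \<cdot> assc C A B X"
proof -
  have "cancel_left B A X e \<cdot> (braid C A B \<boxtimes> idt C X)
    = run C B \<cdot> (idt C B \<boxtimes> e) \<cdot> assc C B A X \<cdot> ((braid C A B \<boxtimes> idt C X) \<cdot> ainv A B X \<cdot> (idt C A \<boxtimes> braid C X B))
      \<cdot> (idt C A \<boxtimes> inv_arr C (braid C X B)) \<cdot> assc C A B X"
    using assms by (simp add: cancel_left_def)
  also have "\<dots> = (run C B \<cdot> (idt C B \<boxtimes> e) \<cdot> braid C (A \<otimes> X) B) \<cdot> ainv A X B
      \<cdot> (idt C A \<boxtimes> inv_arr C (braid C X B)) \<cdot> assc C A B X"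
    unfolding hexagon2 [OF o, symmetric] using assms by simp
  also have "\<dots> = cancel_right A X B e \<cdot> (idt C A \<boxtimes> inv_arr C (braid C X B)) \<cdot> assc C A B X"
    unfolding lun_cancel [OF assms(1) tob_ob [OF o(1,2)] o(3), symmetric]
    using assms by (simp add: cancel_right_def)
  finally show ?thesis .
qed

text \<open>The arrow whose dagger is \<open>lax2\<close> of the dual functor. In terms of \<open>nest\<close> it involves a single
  braiding, and all naturality and associativity properties of \<open>nest\<close> become available.\<close>

lemma middle_swap_nest:
  assumes "e \<in> hom C (A \<otimes> X) (unt C)" "f \<in> hom C (B \<otimes> Y) (unt C)"
    and o: "A \<in> ob C" "X \<in> ob C" "B \<in> ob C" "Y \<in> ob C"
  shows "lun C (unt C) \<cdot> (e \<boxtimes> f) \<cdot> middle_swap C A B X Y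
    = nest A X B Y e f \<cdot> (braid C A B \<boxtimes> idt C (X \<otimes> Y))"
proof -
  let ?c = "inv_arr C (braid C X B)"
  let ?r = "(idt C A \<boxtimes> (?c \<boxtimes> idt C Y)) \<cdot> (idt C A \<boxtimes> ainv B X Y) \<cdot> assc C A B (X \<otimes> Y)"
  have "lun C (unt C) \<cdot> (e \<boxtimes> f) \<cdot> middle_swap C A B X Y
    = (lun C (unt C) \<cdot> (idt C (unt C) \<boxtimes> f)) \<cdot> (e \<boxtimes> idt C (B \<otimes> Y)) \<cdot> ainv A X (B \<otimes> Y)
      \<cdot> (idt C A \<boxtimes> assc C X B Y) \<cdot> ?r"
    using assms by (simp add: middle_swap_def)
  also have "\<dots> = f \<cdot> (cancel_right A X (B \<otimes> Y) e \<cdot> (idt C A \<boxtimes> assc C X B Y)) \<cdot> ?r"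
    unfolding lun_natural [OF assms(2)] using assms by (simp add: cancel_right_def)
  also have "\<dots> = f \<cdot> (cancel_right A X B e \<boxtimes> idt C Y) \<cdot> ainv A (X \<otimes> B) Y \<cdot> ?r"
    unfolding cancel_right_tob [OF assms(1) o(1-4)] using assms by simp
  also have "\<dots> = f \<cdot> (cancel_right A X B e \<boxtimes> idt C Y) \<cdot> ((idt C A \<boxtimes> ?c) \<boxtimes> idt C Y)
      \<cdot> ainv A (B \<otimes> X) Y \<cdot> (idt C A \<boxtimes> ainv B X Y) \<cdot> assc C A B (X \<otimes> Y)"
    using assms by (subst ainv_natural_cmp) auto
  also have "\<dots> = f \<cdot> (cancel_right A X B e \<boxtimes> idt C Y) \<cdot> ((idt C A \<boxtimes> ?c) \<boxtimes> idt C Y)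
      \<cdot> (assc C A B X \<boxtimes> idt C Y) \<cdot> ainv (A \<otimes> B) X Y"
    using o by (simp only: pentagon_inv2)
  also have "\<dots> = f \<cdot> ((cancel_right A X B e \<cdot> (idt C A \<boxtimes> ?c) \<cdot> assc C A B X) \<boxtimes> idt C Y) \<cdot> ainv (A \<otimes> B) X Y"
    using assms by simp
  \<comment> \<open>The inverse braiding of X and B inside \<open>middle_swap\<close> becomes the
    braiding of A and B here, and can then leave the caps by naturality.\<close>
  also have "\<dots> = f \<cdot> (cancel_left B A X e \<boxtimes> idt C Y) \<cdot> ((braid C A B \<boxtimes> idt C X) \<boxtimes> idt C Y) \<cdot> ainv (A \<otimes> B) X Y"
    unfolding cancel_left_braid [OF assms(1) o(1-3), symmetric] using assms by simp
  also have "\<dots> = f \<cdot> (cancel_left B A X e \<boxtimes> idt C Y) \<cdot> ainv (B \<otimes> A) X Y \<cdot> (braid C A B \<boxtimes> (idt C X \<boxtimes> idt C Y))"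
    using assms by (subst ainv_natural) auto
  also have "\<dots> = nest A X B Y e f \<cdot> (braid C A B \<boxtimes> idt C (X \<otimes> Y))"
    using assms by (simp add: nest_def)
  finally show ?thesis .
qed

text \<open>A cap with crossed legs: \<open>lun_cancel\<close> moves it to the other side of B, and
  Yang-Baxter regroups the crossings so that the one of X with A \<otimes> B is applied
  first.\<close>

lemma cancel_right_braid:
  assumes "e \<in> hom C (A \<otimes> X) (unt C)" and o: "A \<in> ob C" "X \<in> ob C" "B \<in> ob C"
  shows "cancel_right X A B (e \<cdot> braid C X A)
    = cancel_left B A X e \<cdot> (braid C A B \<boxtimes> idt C X) \<cdot> braid C X (A \<otimes> B)"
proof -
  have "cancel_right X A B (e \<cdot> braid C X A)
    = (lun C B \<cdot> (e \<boxtimes> idt C B)) \<cdot> (braid C X A \<boxtimes> idt C B) \<cdot> ainv X A B"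
    using assms by (simp add: cancel_right_def)
  also have "\<dots> = run C B \<cdot> (idt C B \<boxtimes> e) \<cdot> (braid C (A \<otimes> X) B \<cdot> (braid C X A \<boxtimes> idt C B)) \<cdot> ainv X A B"
    unfolding lun_cancel [OF assms(1) tob_ob [OF o(1,2)] o(3)] using assms by simp
  also have "\<dots> = run C B \<cdot> (idt C B \<boxtimes> e) \<cdot> ((idt C B \<boxtimes> braid C X A) \<cdot> braid C (X \<otimes> A) B) \<cdot> ainv X A B"
    using assms by (subst braid_natural) auto
  also have "\<dots> = cancel_left B A X e \<cdot> (braid C A B \<boxtimes> idt C X) \<cdot> braid C X (A \<otimes> B)"
    unfolding yang_baxter [OF o(2,1,3), symmetric] using assms by (simp add: cancel_left_def)
  finally show ?thesis .
qed

text \<open>Geometrically, both sides are nested caps precomposed with a half twist on four strands.\<close>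

lemma nest_braid:
  assumes "e \<in> hom C (A \<otimes> X) (unt C)" "f \<in> hom C (B \<otimes> Y) (unt C)"
    and o: "A \<in> ob C" "X \<in> ob C" "B \<in> ob C" "Y \<in> ob C"
  shows "nest X A Y B (e \<cdot> braid C X A) (f \<cdot> braid C Y B)
    = nest A X B Y e f \<cdot> (braid C A B \<boxtimes> braid C Y X) \<cdot> braid C (Y \<otimes> X) (A \<otimes> B)"
proof -
  let ?g = "cancel_right X A B (e \<cdot> braid C X A)"
  have "nest X A Y B (e \<cdot> braid C X A) (f \<cdot> braid C Y B)
    = f \<cdot> (braid C Y B \<cdot> (idt C Y \<boxtimes> ?g)) \<cdot> assc C Y X (A \<otimes> B)"
    using assms by (simp add: nest_alt)
  also have "\<dots> = f \<cdot> ((?g \<boxtimes> idt C Y) \<cdot> braid C Y (X \<otimes> A \<otimes> B)) \<cdot> assc C Y X (A \<otimes> B)"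
    using assms by (subst braid_natural) auto
  also have "\<dots> = f \<cdot> (cancel_left B A X e \<boxtimes> idt C Y) \<cdot> ((braid C A B \<boxtimes> idt C X) \<boxtimes> idt C Y)
      \<cdot> ainv (A \<otimes> B) X Y \<cdot> (assc C (A \<otimes> B) X Y \<cdot> (braid C X (A \<otimes> B) \<boxtimes> idt C Y)
      \<cdot> braid C Y (X \<otimes> A \<otimes> B) \<cdot> assc C Y X (A \<otimes> B))"
    unfolding cancel_right_braid [OF assms(1) o(1-3)] using assms by simp
  \<comment> \<open>Yang-Baxter for Y, X and A \<otimes> B, the last taken as a single
    strand.\<close>
  also have "\<dots> = f \<cdot> (cancel_left B A X e \<boxtimes> idt C Y) \<cdot> (((braid C A B \<boxtimes> idt C X) \<boxtimes> idt C Y)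
      \<cdot> ainv (A \<otimes> B) X Y) \<cdot> (idt C (A \<otimes> B) \<boxtimes> braid C Y X) \<cdot> braid C (Y \<otimes> X) (A \<otimes> B)"
    unfolding yang_baxter [OF o(4,2) tob_ob [OF o(1,3)]] using assms by simp
  also have "\<dots> = f \<cdot> (cancel_left B A X e \<boxtimes> idt C Y) \<cdot> (ainv (B \<otimes> A) X Y
      \<cdot> (braid C A B \<boxtimes> (idt C X \<boxtimes> idt C Y))) \<cdot> (idt C (A \<otimes> B) \<boxtimes> braid C Y X) \<cdot> braid C (Y \<otimes> X) (A \<otimes> B)"
    using o by (subst ainv_natural) auto
  also have "\<dots> = nest A X B Y e f \<cdot> (braid C A B \<boxtimes> braid C Y X) \<cdot> braid C (Y \<otimes> X) (A \<otimes> B)"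
    using assms by (simp add: nest_def)
  finally show ?thesis .
qed

end

section \<open>The dual functor of a pre-rigid category\<close>

context braided_monoidal_category
begin

text \<open>By \<open>middle_swap_nest\<close> this is the pairing of A \<otimes> B with X \<otimes>
  Y that defines \<open>lax2\<close>, in its form with a single braiding.\<close>

definition tensor_pairing :: "'o \<Rightarrow> 'o \<Rightarrow> 'o \<Rightarrow> 'o \<Rightarrow> 'a \<Rightarrow> 'a \<Rightarrow> 'a" where
  "tensor_pairing A X B Y e f = nest A X B Y e f \<cdot> (braid C A B \<boxtimes> idt C (X \<otimes> Y))"

lemma tensor_pairing_simps [simp]:
  assumes "e \<in> arr C" "src C e = A \<otimes> X" "tgt C e = unt C" "A \<in> ob C" "X \<in> ob C"
    "f \<in> arr C" "src C f = B \<otimes> Y" "tgt C f = unt C" "B \<in> ob C" "Y \<in> ob C"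
  shows "tensor_pairing A X B Y e f \<in> arr C" "src C (tensor_pairing A X B Y e f) = (A \<otimes> B) \<otimes> X \<otimes> Y"
    "tgt C (tensor_pairing A X B Y e f) = unt C"
  using assms by (simp_all add: tensor_pairing_def)

lemma tensor_pairing_natural:
  assumes "e \<in> hom C (A \<otimes> X) (unt C)" "f \<in> hom C (B \<otimes> Y) (unt C)"
    "u \<in> hom C A' A" "x \<in> hom C X' X" "v \<in> hom C B' B" "y \<in> hom C Y' Y"
    and o: "A \<in> ob C" "X \<in> ob C"
  shows "tensor_pairing A' X' B' Y' (e \<cdot> (u \<boxtimes> x)) (f \<cdot> (v \<boxtimes> y))
    = tensor_pairing A X B Y e f \<cdot> ((u \<boxtimes> v) \<boxtimes> (x \<boxtimes> y))"
proof -
  have o': "A' \<in> ob C" "X' \<in> ob C" "Y \<in> ob C" "Y' \<in> ob C" "B \<in> ob C" "B' \<in> ob C"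
    using assms by auto
  have "tensor_pairing A' X' B' Y' (e \<cdot> (u \<boxtimes> x)) (f \<cdot> (v \<boxtimes> y))
    = nest A X B Y e f \<cdot> (((v \<boxtimes> u) \<cdot> braid C A' B') \<boxtimes> (x \<boxtimes> y))"
    unfolding tensor_pairing_def nest_natural [OF assms] using assms o' by simp
  also have "\<dots> = nest A X B Y e f \<cdot> ((braid C A B \<cdot> (u \<boxtimes> v)) \<boxtimes> (x \<boxtimes> y))"
    using assms by (subst braid_natural) auto
  also have "\<dots> = tensor_pairing A X B Y e f \<cdot> ((u \<boxtimes> v) \<boxtimes> (x \<boxtimes> y))"
    using assms o' by (simp add: tensor_pairing_def)
  finally show ?thesis .
qed

text \<open>Two independent facts: the crossings among A, B, S on the two sides agree by
  Yang-Baxter, since both reverse the order of the three factors, and the caps agree by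
  \<open>nest_assoc\<close>.\<close>

lemma tensor_pairing_assoc:
  assumes "e \<in> hom C (A \<otimes> X) (unt C)" "f \<in> hom C (B \<otimes> Y) (unt C)" "g \<in> hom C (S \<otimes> Z) (unt C)"
    and o: "A \<in> ob C" "X \<in> ob C" "B \<in> ob C" "Y \<in> ob C" "S \<in> ob C" "Z \<in> ob C"
  shows "tensor_pairing (A \<otimes> B) (X \<otimes> Y) S Z (tensor_pairing A X B Y e f) g \<cdot> (idt C ((A \<otimes> B) \<otimes> S) \<boxtimes> ainv X Y Z)
    = tensor_pairing A X (B \<otimes> S) (Y \<otimes> Z) e (tensor_pairing B Y S Z f g) \<cdot> (assc C A B S \<boxtimes> idt C (X \<otimes> Y \<otimes> Z))"
proof -
  let ?n = "nest (B \<otimes> A) (X \<otimes> Y) S Z (nest A X B Y e f) g"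
  have l: "nest (A \<otimes> B) (X \<otimes> Y) S Z (nest A X B Y e f \<cdot> (braid C A B \<boxtimes> idt C (X \<otimes> Y))) (g \<cdot> (idt C S \<boxtimes> idt C Z))
    = ?n \<cdot> ((idt C S \<boxtimes> braid C A B) \<boxtimes> (idt C (X \<otimes> Y) \<boxtimes> idt C Z))"
    by (rule nest_natural) (use assms in simp_all)
  have r: "nest A X (B \<otimes> S) (Y \<otimes> Z) (e \<cdot> (idt C A \<boxtimes> idt C X)) (nest B Y S Z f g \<cdot> (braid C B S \<boxtimes> idt C (Y \<otimes> Z)))
    = nest A X (S \<otimes> B) (Y \<otimes> Z) e (nest B Y S Z f g) \<cdot> ((braid C B S \<boxtimes> idt C A) \<boxtimes> (idt C X \<boxtimes> idt C (Y \<otimes> Z)))"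
    by (rule nest_natural) (use assms in simp_all)
  have "tensor_pairing (A \<otimes> B) (X \<otimes> Y) S Z (tensor_pairing A X B Y e f) g \<cdot> (idt C ((A \<otimes> B) \<otimes> S) \<boxtimes> ainv X Y Z)
    = ?n \<cdot> (((idt C S \<boxtimes> braid C A B) \<cdot> braid C (A \<otimes> B) S) \<boxtimes> ainv X Y Z)"
    using l assms by (simp add: tensor_pairing_def)
  also have "\<dots> = (?n \<cdot> (assc C S B A \<boxtimes> ainv X Y Z))
      \<cdot> (((braid C B S \<boxtimes> idt C A) \<cdot> braid C A (B \<otimes> S) \<cdot> assc C A B S) \<boxtimes> idt C (X \<otimes> Y \<otimes> Z))"
    unfolding yang_baxter [OF o(1,3,5), symmetric] using assms by simp
  also have "\<dots> = tensor_pairing A X (B \<otimes> S) (Y \<otimes> Z) e (tensor_pairing B Y S Z f g)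
      \<cdot> (assc C A B S \<boxtimes> idt C (X \<otimes> Y \<otimes> Z))"
    unfolding nest_assoc [OF assms] using r assms by (simp add: tensor_pairing_def)
  finally show ?thesis .
qed

lemma tensor_pairing_lun_left:
  assumes "e \<in> hom C (A \<otimes> X) (unt C)" and o: "A \<in> ob C" "X \<in> ob C"
  shows "tensor_pairing (unt C) (unt C) A X (lun C (unt C)) e = e \<cdot> (lun C A \<boxtimes> lun C X)"
  using assms by (simp add: tensor_pairing_def nest_lun_left run_braid)

lemma tensor_pairing_lun_right:
  assumes "e \<in> hom C (A \<otimes> X) (unt C)" and o: "A \<in> ob C" "X \<in> ob C"
  shows "tensor_pairing A X (unt C) (unt C) e (lun C (unt C)) = e \<cdot> (run C A \<boxtimes> run C X)"
  using assms by (simp add: tensor_pairing_def nest_lun_right lun_braid)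

lemma inv_braid_natural:
  assumes "f \<in> hom C X X'" "g \<in> hom C Y Y'"
  shows "inv_arr C (braid C X' Y') \<cdot> (g \<boxtimes> f) = (f \<boxtimes> g) \<cdot> inv_arr C (braid C X Y)"
proof -
  have o: "X \<in> ob C" "Y \<in> ob C" "X' \<in> ob C" "Y' \<in> ob C"
    using assms by auto
  show ?thesis
    using inv_natural [OF braid_natural [OF assms]] assms o by simp
qed

end

section \<open>Duals through their universal property, and the lax structure of the dual
  functor\<close>

locale pre_rigid_category = braided_monoidal_category C
  for C :: "('o, 'a, 'z) braided_category_scheme" (structure) +
  fixes D :: "'o \<Rightarrow> 'o" and ev :: "'o \<Rightarrow> 'a"
  assumes pre_rigid: "pre_rigid C D ev"
begin

abbreviation dual :: "'a \<Rightarrow> 'a" where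
  "dual \<equiv> dual_arr C D ev"

abbreviation \<eta> :: "'o \<Rightarrow> 'a" where
  "\<eta> \<equiv> dual_unit C D ev"

abbreviation \<theta> :: "'o \<Rightarrow> 'a" where
  "\<theta> \<equiv> dual_counit C D ev"

abbreviation dual_colax :: "('o, 'a, 'o, 'a) colax_functor" where
  "dual_colax \<equiv> left_adjoint_colax (op_cat C) C (dual_functor_op C D ev) (dual_functor C D ev) \<eta> \<theta>"

abbreviation \<phi>\<^sub>2 :: "'o \<Rightarrow> 'o \<Rightarrow> 'a" where
  "\<phi>\<^sub>2 \<equiv> lax2 (dual_functor C D ev)"

abbreviation \<phi>\<^sub>0 :: 'a where
  "\<phi>\<^sub>0 \<equiv> lax0 (dual_functor C D ev)"

lemma dual_simps [simp]:
  assumes "X \<in> ob C"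
  shows "D X \<in> ob C" "ev X \<in> arr C" "src C (ev X) = D X \<otimes> X" "tgt C (ev X) = unt C"
  using pre_rigid assms by (auto simp: pre_rigid_def pre_dual_def)

lemma ev_bij:
  assumes "X \<in> ob C" "T \<in> ob C"
  shows "bij_betw (\<lambda>u. ev X \<cdot> (u \<boxtimes> idt C X)) (hom C T (D X)) (hom C (T \<otimes> X) (unt C))"
  using pre_rigid assms by (auto simp: pre_rigid_def pre_dual_def)

text \<open>Extensionality: arrows into a dual are determined by their pairings. Equations between
  such arrows are proved below by evaluating both sides.\<close>

lemma dual_eqI:
  assumes "u \<in> hom C T (D X)" "v \<in> hom C T (D X)" "X \<in> ob C"
    "ev X \<cdot> (u \<boxtimes> idt C X) = ev X \<cdot> (v \<boxtimes> idt C X)"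
  shows "u = v"
proof -
  have "T \<in> ob C"
    using assms(1) by auto
  then show ?thesis
    using ev_bij [OF assms(3), of T] assms unfolding bij_betw_def inj_on_def by blast
qed

lemma ex1_dagger:
  assumes "t \<in> hom C (T \<otimes> X) (unt C)" "T \<in> ob C" "X \<in> ob C"
  shows "\<exists>!u. u \<in> hom C T (D X) \<and> ev X \<cdot> (u \<boxtimes> idt C X) = t"
proof -
  have "t \<in> (\<lambda>u. ev X \<cdot> (u \<boxtimes> idt C X)) ` hom C T (D X)"
    using ev_bij [OF assms(3,2)] assms(1) by (simp add: bij_betw_def)
  then show ?thesis
    using dual_eqI assms(3) by blast
qed

lemma dagger_simps [simp]:
  assumes "t \<in> arr C" "src C t = T \<otimes> X" "tgt C t = unt C" "T \<in> ob C" "X \<in> ob C"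
  shows "dagger C D ev T X t \<in> arr C" "src C (dagger C D ev T X t) = T" "tgt C (dagger C D ev T X t) = D X"
    and ev_dagger_idt: "ev X \<cdot> (dagger C D ev T X t \<boxtimes> idt C X) = t"
  using theI' [OF ex1_dagger [of t T X]] assms by (simp_all add: dagger_def)

text \<open>The extra arrows \<open>u\<close> and \<open>x\<close> make the rule fit composites
  whose tensor arrows have been fused by interchange. \<open>ev_dual_arr\<close>,
  \<open>ev_lax2\<close> and \<open>ev_dual_unit\<close> have this shape for the same
  reason.\<close>

lemma ev_dagger:
  assumes "t \<in> hom C (T \<otimes> X) (unt C)" "T \<in> ob C" "X \<in> ob C" "u \<in> hom C S T" "x \<in> hom C Z X"
  shows "ev X \<cdot> ((dagger C D ev T X t \<cdot> u) \<boxtimes> x) = t \<cdot> (u \<boxtimes> x)"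
proof -
  have "ev X \<cdot> ((dagger C D ev T X t \<cdot> u) \<boxtimes> x) = (ev X \<cdot> (dagger C D ev T X t \<boxtimes> idt C X)) \<cdot> (u \<boxtimes> x)"
    using assms by (simp del: ev_dagger_idt)
  also have "\<dots> = t \<cdot> (u \<boxtimes> x)"
    using assms by simp
  finally show ?thesis .
qed

lemma dual_arr_eq:
  assumes "f \<in> hom C X Y"
  shows "dual f = dagger C D ev (D Y) X (ev Y \<cdot> (idt C (D Y) \<boxtimes> f))"
  using assms by (simp add: dual_arr_def dagger_def Let_def)

lemma dual_arr_simps [simp]:
  assumes "f \<in> arr C"
  shows "dual f \<in> arr C" "src C (dual f) = D (tgt C f)"
    "tgt C (dual f) = D (src C f)"
  using assms by (simp_all add: dual_arr_eq [of f "src C f" "tgt C f"])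

lemma ev_dual_arr:
  assumes "f \<in> hom C X Y" "u \<in> hom C T (D Y)" "x \<in> hom C Z X"
  shows "ev X \<cdot> ((dual f \<cdot> u) \<boxtimes> x) = ev Y \<cdot> (u \<boxtimes> (f \<cdot> x))"
proof -
  have o: "X \<in> ob C" "Y \<in> ob C"
    using assms by auto
  have "ev X \<cdot> ((dual f \<cdot> u) \<boxtimes> x) = (ev Y \<cdot> (idt C (D Y) \<boxtimes> f)) \<cdot> (u \<boxtimes> x)"
    unfolding dual_arr_eq [OF assms(1)] by (rule ev_dagger) (use assms o in simp_all)
  then show ?thesis
    using assms o by simp
qed

lemma ev_dual_arr':
  assumes "f \<in> hom C X Y" "x \<in> hom C Z X"
  shows "ev X \<cdot> (dual f \<boxtimes> x) = ev Y \<cdot> (idt C (D Y) \<boxtimes> (f \<cdot> x))"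
proof -
  have "X \<in> ob C" "Y \<in> ob C"
    using assms by auto
  then show ?thesis
    using ev_dual_arr [of f X Y "idt C (D Y)" "D Y" x Z] assms by simp
qed

lemma dual_arr_idt: "X \<in> ob C \<Longrightarrow> dual (idt C X) = idt C (D X)"
  by (rule dual_eqI [of _ "D X" X]) (simp_all add: ev_dual_arr')

lemma dual_arr_cmp:
  assumes "f \<in> hom C X Y" "g \<in> hom C Y Z"
  shows "dual (g \<cdot> f) = dual f \<cdot> dual g"
proof (rule dual_eqI [of _ "D Z" X])
  show "X \<in> ob C"
    using assms by auto
  then show "ev X \<cdot> (dual (g \<cdot> f) \<boxtimes> idt C X) = ev X \<cdot> ((dual f \<cdot> dual g) \<boxtimes> idt C X)"
    using assms by (simp add: ev_dual_arr [of f X Y] ev_dual_arr' [of g Y Z] ev_dual_arr' [of "g \<cdot> f" X Z])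
qed (use assms in simp_all)

lemma dual_functor_simps [simp]:
  "fob (dual_functor C D ev) = D" "far (dual_functor C D ev) = dual"
  "\<phi>\<^sub>0 = dagger C D ev (unt C) (unt C) (lun C (unt C))"
  by (simp_all add: dual_functor_def)

lemma dual_lax2_eq:
  assumes "X \<in> ob C" "Y \<in> ob C"
  shows "\<phi>\<^sub>2 X Y
    = dagger C D ev (D X \<otimes> D Y) (X \<otimes> Y) (tensor_pairing (D X) X (D Y) Y (ev X) (ev Y))"
  using assms by (simp add: dual_functor_def middle_swap_nest tensor_pairing_def)

lemma dual_lax2_simps [simp]:
  assumes "X \<in> ob C" "Y \<in> ob C"
  shows "\<phi>\<^sub>2 X Y \<in> arr C" "src C (\<phi>\<^sub>2 X Y) = D X \<otimes> D Y"
    "tgt C (\<phi>\<^sub>2 X Y) = D (X \<otimes> Y)"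
  using assms by (simp_all add: dual_lax2_eq)

lemma ev_lax2:
  assumes "X \<in> ob C" "Y \<in> ob C" "u \<in> hom C S (D X)" "v \<in> hom C T (D Y)" "x \<in> hom C Z (X \<otimes> Y)"
  shows "ev (X \<otimes> Y) \<cdot> ((\<phi>\<^sub>2 X Y \<cdot> (u \<boxtimes> v)) \<boxtimes> x)
    = tensor_pairing S X T Y (ev X \<cdot> (u \<boxtimes> idt C X)) (ev Y \<cdot> (v \<boxtimes> idt C Y)) \<cdot> (idt C (S \<otimes> T) \<boxtimes> x)"
proof -
  have o: "S \<in> ob C" "T \<in> ob C"
    using assms by auto
  have "ev (X \<otimes> Y) \<cdot> ((\<phi>\<^sub>2 X Y \<cdot> (u \<boxtimes> v)) \<boxtimes> x)
    = tensor_pairing (D X) X (D Y) Y (ev X) (ev Y) \<cdot> ((u \<boxtimes> v) \<boxtimes> x)"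
    unfolding dual_lax2_eq [OF assms(1,2)] by (rule ev_dagger) (use assms in simp_all)
  also have "\<dots> = (tensor_pairing (D X) X (D Y) Y (ev X) (ev Y) \<cdot> ((u \<boxtimes> v) \<boxtimes> (idt C X \<boxtimes> idt C Y))) \<cdot> (idt C (S \<otimes> T) \<boxtimes> x)"
    using assms o by simp
  also have "\<dots> = tensor_pairing S X T Y (ev X \<cdot> (u \<boxtimes> idt C X)) (ev Y \<cdot> (v \<boxtimes> idt C Y)) \<cdot> (idt C (S \<otimes> T) \<boxtimes> x)"
    by (subst tensor_pairing_natural) (use assms in simp_all)
  finally show ?thesis .
qed

lemma ev_lax2':
  assumes "X \<in> ob C" "Y \<in> ob C" "x \<in> hom C Z (X \<otimes> Y)"
  shows "ev (X \<otimes> Y) \<cdot> (\<phi>\<^sub>2 X Y \<boxtimes> x)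
    = tensor_pairing (D X) X (D Y) Y (ev X) (ev Y) \<cdot> (idt C (D X \<otimes> D Y) \<boxtimes> x)"
  using ev_lax2 [OF assms(1,2), of "idt C (D X)" "D X" "idt C (D Y)" "D Y" x Z] assms by simp

lemma dual_lax2_natural:
  assumes "f \<in> hom C X' X" "g \<in> hom C Y' Y"
  shows "\<phi>\<^sub>2 X' Y' \<cdot> (dual f \<boxtimes> dual g)
    = dual (f \<boxtimes> g) \<cdot> \<phi>\<^sub>2 X Y"
proof (rule dual_eqI [of _ "D X \<otimes> D Y" "X' \<otimes> Y'"])
  have o: "X \<in> ob C" "X' \<in> ob C" "Y \<in> ob C" "Y' \<in> ob C"
    using assms by auto
  have "ev (X' \<otimes> Y') \<cdot> ((\<phi>\<^sub>2 X' Y' \<cdot> (dual f \<boxtimes> dual g)) \<boxtimes> idt C (X' \<otimes> Y'))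
    = tensor_pairing (D X) X' (D Y) Y' (ev X' \<cdot> (dual f \<boxtimes> idt C X')) (ev Y' \<cdot> (dual g \<boxtimes> idt C Y'))
      \<cdot> (idt C (D X \<otimes> D Y) \<boxtimes> idt C (X' \<otimes> Y'))"
    by (rule ev_lax2) (use assms o in simp_all)
  also have "\<dots> = tensor_pairing (D X) X' (D Y) Y' (ev X \<cdot> (idt C (D X) \<boxtimes> f)) (ev Y \<cdot> (idt C (D Y) \<boxtimes> g))"
    using assms o by (simp add: ev_dual_arr' [of f X' X] ev_dual_arr' [of g Y' Y])
  also have "\<dots> = tensor_pairing (D X) X (D Y) Y (ev X) (ev Y) \<cdot> ((idt C (D X) \<boxtimes> idt C (D Y)) \<boxtimes> (f \<boxtimes> g))"
    by (rule tensor_pairing_natural) (use assms o in simp_all)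
  also have "\<dots> = ev (X \<otimes> Y) \<cdot> (\<phi>\<^sub>2 X Y \<boxtimes> ((f \<boxtimes> g) \<cdot> idt C (X' \<otimes> Y')))"
    using assms o by (subst ev_lax2') simp_all
  also have "\<dots> = ev (X' \<otimes> Y') \<cdot> ((dual (f \<boxtimes> g) \<cdot> \<phi>\<^sub>2 X Y) \<boxtimes> idt C (X' \<otimes> Y'))"
    using assms o by (intro ev_dual_arr [symmetric]) simp_all
  finally show "ev (X' \<otimes> Y') \<cdot> ((\<phi>\<^sub>2 X' Y' \<cdot> (dual f \<boxtimes> dual g)) \<boxtimes> idt C (X' \<otimes> Y'))
    = ev (X' \<otimes> Y') \<cdot> ((dual (f \<boxtimes> g) \<cdot> \<phi>\<^sub>2 X Y) \<boxtimes> idt C (X' \<otimes> Y'))" .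
qed (use assms in auto)

text \<open>\<open>ainv\<close> stands here as the associator of the opposite category. Under
  evaluation it slides to the second factor of the pairing, and the two sides become the threefold
  pairings compared in \<open>tensor_pairing_assoc\<close>.\<close>

lemma dual_lax_assc:
  assumes o: "X \<in> ob C" "Y \<in> ob C" "Z \<in> ob C"
  shows "dual (ainv X Y Z) \<cdot> \<phi>\<^sub>2 (X \<otimes> Y) Z
      \<cdot> (\<phi>\<^sub>2 X Y \<boxtimes> idt C (D Z))
    = \<phi>\<^sub>2 X (Y \<otimes> Z) \<cdot> (idt C (D X) \<boxtimes> \<phi>\<^sub>2 Y Z)
      \<cdot> assc C (D X) (D Y) (D Z)" (is "?l = ?r")
proof (rule dual_eqI [of _ "(D X \<otimes> D Y) \<otimes> D Z" "X \<otimes> Y \<otimes> Z"])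
  let ?p = "\<phi>\<^sub>2" and ?T = "X \<otimes> Y \<otimes> Z"
  have "ev ?T \<cdot> (?l \<boxtimes> idt C ?T)
    = ev ((X \<otimes> Y) \<otimes> Z) \<cdot> ((?p (X \<otimes> Y) Z \<cdot> (?p X Y \<boxtimes> idt C (D Z))) \<boxtimes> (ainv X Y Z \<cdot> idt C ?T))"
    by (rule ev_dual_arr) (use o in simp_all)
  also have "\<dots> = tensor_pairing (D X \<otimes> D Y) (X \<otimes> Y) (D Z) Z (ev (X \<otimes> Y) \<cdot> (?p X Y \<boxtimes> idt C (X \<otimes> Y)))
      (ev Z \<cdot> (idt C (D Z) \<boxtimes> idt C Z)) \<cdot> (idt C ((D X \<otimes> D Y) \<otimes> D Z) \<boxtimes> (ainv X Y Z \<cdot> idt C ?T))"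
    by (rule ev_lax2) (use o in simp_all)
  also have "\<dots> = tensor_pairing (D X \<otimes> D Y) (X \<otimes> Y) (D Z) Z (tensor_pairing (D X) X (D Y) Y (ev X) (ev Y)) (ev Z)
      \<cdot> (idt C ((D X \<otimes> D Y) \<otimes> D Z) \<boxtimes> ainv X Y Z)"
    using o by (simp add: ev_lax2')
  also have "\<dots> = tensor_pairing (D X) X (D Y \<otimes> D Z) (Y \<otimes> Z) (ev X) (tensor_pairing (D Y) Y (D Z) Z (ev Y) (ev Z))
      \<cdot> (assc C (D X) (D Y) (D Z) \<boxtimes> idt C ?T)"
    by (rule tensor_pairing_assoc) (use o in simp_all)
  also have "\<dots> = (tensor_pairing (D X) X (D Y \<otimes> D Z) (Y \<otimes> Z) (ev X \<cdot> (idt C (D X) \<boxtimes> idt C X))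
      (ev (Y \<otimes> Z) \<cdot> (?p Y Z \<boxtimes> idt C (Y \<otimes> Z))) \<cdot> (idt C (D X \<otimes> D Y \<otimes> D Z) \<boxtimes> idt C ?T))
      \<cdot> (assc C (D X) (D Y) (D Z) \<boxtimes> idt C ?T)"
    using o by (simp add: ev_lax2')
  also have "\<dots> = (ev ?T \<cdot> ((?p X (Y \<otimes> Z) \<cdot> (idt C (D X) \<boxtimes> ?p Y Z)) \<boxtimes> idt C ?T))
      \<cdot> (assc C (D X) (D Y) (D Z) \<boxtimes> idt C ?T)"
    by (subst ev_lax2 [where S = "D X" and T = "D Y \<otimes> D Z" and Z = ?T]) (use o in simp_all)
  also have "\<dots> = ev ?T \<cdot> (?r \<boxtimes> idt C ?T)"
    using o by simp
  finally show "ev ?T \<cdot> (?l \<boxtimes> idt C ?T) = ev ?T \<cdot> (?r \<boxtimes> idt C ?T)" .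
qed (use o in simp_all)

lemma dual_lax_lun:
  assumes o: "X \<in> ob C"
  shows "dual (inv_arr C (lun C X)) \<cdot> \<phi>\<^sub>2 (unt C) X
      \<cdot> (\<phi>\<^sub>0 \<boxtimes> idt C (D X)) = lun C (D X)" (is "?l = ?r")
proof (rule dual_eqI [of _ "unt C \<otimes> D X" X])
  let ?p = "\<lambda>X Y. \<phi>\<^sub>2 X Y"
  let ?z = "\<phi>\<^sub>0" and ?I = "unt C"
  have "ev X \<cdot> (?l \<boxtimes> idt C X)
    = ev (?I \<otimes> X) \<cdot> ((?p ?I X \<cdot> (?z \<boxtimes> idt C (D X))) \<boxtimes> (inv_arr C (lun C X) \<cdot> idt C X))"
    by (rule ev_dual_arr) (use o in simp_all)
  also have "\<dots> = tensor_pairing ?I ?I (D X) X (ev ?I \<cdot> (?z \<boxtimes> idt C ?I)) (ev X \<cdot> (idt C (D X) \<boxtimes> idt C X))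
      \<cdot> (idt C (?I \<otimes> D X) \<boxtimes> (inv_arr C (lun C X) \<cdot> idt C X))"
    by (rule ev_lax2) (use o in simp_all)
  also have "\<dots> = ev X \<cdot> (?r \<boxtimes> idt C X)"
    using o by (simp add: tensor_pairing_lun_left)
  finally show "ev X \<cdot> (?l \<boxtimes> idt C X) = ev X \<cdot> (?r \<boxtimes> idt C X)" .
qed (use o in simp_all)

lemma dual_lax_run:
  assumes o: "X \<in> ob C"
  shows "dual (inv_arr C (run C X)) \<cdot> \<phi>\<^sub>2 X (unt C)
      \<cdot> (idt C (D X) \<boxtimes> \<phi>\<^sub>0) = run C (D X)" (is "?l = ?r")
proof (rule dual_eqI [of _ "D X \<otimes> unt C" X])
  let ?p = "\<lambda>X Y. \<phi>\<^sub>2 X Y"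
  let ?z = "\<phi>\<^sub>0" and ?I = "unt C"
  have "ev X \<cdot> (?l \<boxtimes> idt C X)
    = ev (X \<otimes> ?I) \<cdot> ((?p X ?I \<cdot> (idt C (D X) \<boxtimes> ?z)) \<boxtimes> (inv_arr C (run C X) \<cdot> idt C X))"
    by (rule ev_dual_arr) (use o in simp_all)
  also have "\<dots> = tensor_pairing (D X) X ?I ?I (ev X \<cdot> (idt C (D X) \<boxtimes> idt C X)) (ev ?I \<cdot> (?z \<boxtimes> idt C ?I))
      \<cdot> (idt C (D X \<otimes> ?I) \<boxtimes> (inv_arr C (run C X) \<cdot> idt C X))"
    by (rule ev_lax2) (use o in simp_all)
  also have "\<dots> = ev X \<cdot> (?r \<boxtimes> idt C X)"
    using o by (simp add: tensor_pairing_lun_right)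
  finally show "ev X \<cdot> (?l \<boxtimes> idt C X) = ev X \<cdot> (?r \<boxtimes> idt C X)" .
qed (use o in simp_all)

lemma lax_monoidal_dual_functor: "lax_monoidal_functor (op_cat C) C (dual_functor C D ev)"
proof -
  interpret op: monoidal_category "op_cat C"
    by (rule monoidal_category_op)
  show ?thesis
  proof
    show "far (dual_functor C D ev) (g \<cdot>\<^bsub>op_cat C\<^esub> f) = far (dual_functor C D ev) g \<cdot> far (dual_functor C D ev) f"
      if "f \<in> hom (op_cat C) X Y" "g \<in> hom (op_cat C) Y Z" for f g X Y Z
      using that dual_arr_cmp [of g Z Y f X] by simp
    show "\<phi>\<^sub>2 X' Y' \<cdot> (far (dual_functor C D ev) f \<boxtimes> far (dual_functor C D ev) g)
      = far (dual_functor C D ev) (f \<boxtimes>\<^bsub>op_cat C\<^esub> g) \<cdot> \<phi>\<^sub>2 X Y"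
      if "f \<in> hom (op_cat C) X X'" "g \<in> hom (op_cat C) Y Y'" for f g X X' Y Y'
      using that dual_lax2_natural [of f X' X g Y' Y] by simp
  qed (use dual_lax_assc dual_lax_lun dual_lax_run in \<open>simp_all add: dual_arr_idt\<close>)
qed

section \<open>Unit, counit and the mate of the lax structure\<close>

lemma dual_unit_simps [simp]:
  assumes "X \<in> ob C"
  shows "\<eta> X \<in> arr C" "src C (\<eta> X) = X" "tgt C (\<eta> X) = D (D X)"
    "\<theta> X \<in> arr C" "src C (\<theta> X) = X" "tgt C (\<theta> X) = D (D X)"
  using assms by (simp_all add: dual_unit_def dual_counit_def)

lemma ev_dual_unit:
  assumes "X \<in> ob C" "u \<in> hom C T X" "x \<in> hom C Z (D X)"
  shows "ev (D X) \<cdot> ((\<eta> X \<cdot> u) \<boxtimes> x) = ev X \<cdot> (x \<boxtimes> u) \<cdot> braid C T Z"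
proof -
  have o: "T \<in> ob C" "Z \<in> ob C"
    using assms by auto
  have "ev (D X) \<cdot> ((\<eta> X \<cdot> u) \<boxtimes> x) = (ev X \<cdot> braid C X (D X)) \<cdot> (u \<boxtimes> x)"
    unfolding dual_unit_def by (rule ev_dagger) (use assms in simp_all)
  also have "\<dots> = ev X \<cdot> (braid C X (D X) \<cdot> (u \<boxtimes> x))"
    using assms by simp
  also have "\<dots> = ev X \<cdot> (x \<boxtimes> u) \<cdot> braid C T Z"
    using assms by (subst braid_natural) auto
  finally show ?thesis .
qed

lemma ev_dual_counit:
  assumes "X \<in> ob C" "u \<in> hom C T X" "x \<in> hom C Z (D X)"
  shows "ev (D X) \<cdot> ((\<theta> X \<cdot> u) \<boxtimes> x) = ev X \<cdot> (x \<boxtimes> u) \<cdot> inv_arr C (braid C Z T)"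
proof -
  have o: "T \<in> ob C" "Z \<in> ob C"
    using assms by auto
  have "ev (D X) \<cdot> ((\<theta> X \<cdot> u) \<boxtimes> x) = (ev X \<cdot> inv_arr C (braid C (D X) X)) \<cdot> (u \<boxtimes> x)"
    unfolding dual_counit_def by (rule ev_dagger) (use assms in simp_all)
  also have "\<dots> = ev X \<cdot> (inv_arr C (braid C (D X) X) \<cdot> (u \<boxtimes> x))"
    using assms by simp
  also have "\<dots> = ev X \<cdot> (x \<boxtimes> u) \<cdot> inv_arr C (braid C Z T)"
    using assms by (subst inv_braid_natural) auto
  finally show ?thesis .
qed

lemma ev_dual_unit':
  assumes "X \<in> ob C" "x \<in> hom C Z (D X)"
  shows "ev (D X) \<cdot> (\<eta> X \<boxtimes> x) = ev X \<cdot> (x \<boxtimes> idt C X) \<cdot> braid C X Z"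
  using ev_dual_unit [of X "idt C X" X x Z] assms by simp

lemma ev_dual_counit':
  assumes "X \<in> ob C" "x \<in> hom C Z (D X)"
  shows "ev (D X) \<cdot> (\<theta> X \<boxtimes> x) = ev X \<cdot> (x \<boxtimes> idt C X) \<cdot> inv_arr C (braid C Z X)"
  using ev_dual_counit [of X "idt C X" X x Z] assms by simp

lemma dual_unit_natural:
  assumes f: "f \<in> hom C X Y"
  shows "\<eta> Y \<cdot> f = dual (dual f) \<cdot> \<eta> X"
proof (rule dual_eqI [of _ X "D Y"])
  have o: "X \<in> ob C" "Y \<in> ob C"
    using assms by auto
  have "ev (D Y) \<cdot> ((\<eta> Y \<cdot> f) \<boxtimes> idt C (D Y)) = ev Y \<cdot> (idt C (D Y) \<boxtimes> f) \<cdot> braid C X (D Y)"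
    by (rule ev_dual_unit) (use f o in simp_all)
  also have "\<dots> = (ev X \<cdot> (dual f \<boxtimes> idt C X)) \<cdot> braid C X (D Y)"
    using f o by (subst ev_dual_arr' [OF f]) simp_all
  also have "\<dots> = ev (D X) \<cdot> (\<eta> X \<boxtimes> (dual f \<cdot> idt C (D Y)))"
    using f o by (subst ev_dual_unit') simp_all
  also have "\<dots> = ev (D Y) \<cdot> ((dual (dual f) \<cdot> \<eta> X) \<boxtimes> idt C (D Y))"
    by (rule ev_dual_arr [symmetric]) (use f o in simp_all)
  finally show "ev (D Y) \<cdot> ((\<eta> Y \<cdot> f) \<boxtimes> idt C (D Y))
    = ev (D Y) \<cdot> ((dual (dual f) \<cdot> \<eta> X) \<boxtimes> idt C (D Y))" .
qed (use f in auto)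

lemma dual_counit_natural:
  assumes f: "f \<in> hom C X Y"
  shows "\<theta> Y \<cdot> f = dual (dual f) \<cdot> \<theta> X"
proof (rule dual_eqI [of _ X "D Y"])
  have o: "X \<in> ob C" "Y \<in> ob C"
    using assms by auto
  have "ev (D Y) \<cdot> ((\<theta> Y \<cdot> f) \<boxtimes> idt C (D Y)) = ev Y \<cdot> (idt C (D Y) \<boxtimes> f) \<cdot> inv_arr C (braid C (D Y) X)"
    by (rule ev_dual_counit) (use f o in simp_all)
  also have "\<dots> = (ev X \<cdot> (dual f \<boxtimes> idt C X)) \<cdot> inv_arr C (braid C (D Y) X)"
    using f o by (subst ev_dual_arr' [OF f]) simp_all
  also have "\<dots> = ev (D X) \<cdot> (\<theta> X \<boxtimes> (dual f \<cdot> idt C (D Y)))"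
    using f o by (subst ev_dual_counit') simp_all
  also have "\<dots> = ev (D Y) \<cdot> ((dual (dual f) \<cdot> \<theta> X) \<boxtimes> idt C (D Y))"
    by (rule ev_dual_arr [symmetric]) (use f o in simp_all)
  finally show "ev (D Y) \<cdot> ((\<theta> Y \<cdot> f) \<boxtimes> idt C (D Y))
    = ev (D Y) \<cdot> ((dual (dual f) \<cdot> \<theta> X) \<boxtimes> idt C (D Y))" .
qed (use f in auto)

text \<open>Under evaluation one transformation contributes a braiding and the other an inverse
  braiding of the same two objects, and these cancel. This is why the counit is defined with the
  inverse braiding.\<close>

lemma dual_triangles:
  assumes X: "X \<in> ob C"
  shows "dual (\<eta> X) \<cdot> \<theta> (D X) = idt C (D X)" (is ?unit)
    and "dual (\<theta> X) \<cdot> \<eta> (D X) = idt C (D X)" (is ?counit)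
proof -
  have "ev X \<cdot> ((dual (\<eta> X) \<cdot> \<theta> (D X)) \<boxtimes> idt C X)
    = ev (D (D X)) \<cdot> (\<theta> (D X) \<boxtimes> (\<eta> X \<cdot> idt C X))"
    by (rule ev_dual_arr) (use X in simp_all)
  also have "\<dots> = (ev (D X) \<cdot> (\<eta> X \<boxtimes> idt C (D X))) \<cdot> inv_arr C (braid C X (D X))"
    using X by (subst ev_dual_counit') simp_all
  also have "\<dots> = ev X"
    using X by (subst ev_dual_unit' [where Z = "D X"]) simp_all
  finally show ?unit
    by (subst dual_eqI [of _ "D X" X]) (use X in simp_all)
  have "ev X \<cdot> ((dual (\<theta> X) \<cdot> \<eta> (D X)) \<boxtimes> idt C X)
    = ev (D (D X)) \<cdot> (\<eta> (D X) \<boxtimes> (\<theta> X \<cdot> idt C X))"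
    by (rule ev_dual_arr) (use X in simp_all)
  also have "\<dots> = (ev (D X) \<cdot> (\<theta> X \<boxtimes> idt C (D X))) \<cdot> braid C (D X) X"
    using X by (subst ev_dual_unit') simp_all
  also have "\<dots> = ev X \<cdot> inv_arr C (braid C (D X) X) \<cdot> braid C (D X) X"
    using X by (subst ev_dual_counit' [where Z = "D X"]) simp_all
  finally show ?counit
    by (subst dual_eqI [of _ "D X" X]) (use X in simp_all)
qed

lemma dual_functor_op_simps [simp]:
  "fob (dual_functor_op C D ev) = D" "far (dual_functor_op C D ev) = dual"
  by (simp_all add: dual_functor_op_def)

lemma adjunction_dual: "adjunction (op_cat C) C (dual_functor_op C D ev) (dual_functor C D ev)
    (\<eta>) (\<theta>)"
proof -
  interpret op: monoidal_category "op_cat C"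
    by (rule monoidal_category_op)
  interpret F: lax_monoidal_functor "op_cat C" C "dual_functor C D ev"
    by (rule lax_monoidal_dual_functor)
  interpret E: cat_functor C "op_cat C" "dual_functor_op C D ev"
  proof
    show "far (dual_functor_op C D ev) (g \<cdot> f) = far (dual_functor_op C D ev) g \<cdot>\<^bsub>op_cat C\<^esub> far (dual_functor_op C D ev) f"
      if "f \<in> hom C X Y" "g \<in> hom C Y Z" for f g X Y Z
      using dual_arr_cmp [OF that] by simp
  qed (simp_all add: dual_arr_idt)
  let ?E = "dual_functor_op C D ev" and ?F = "dual_functor C D ev"
  have u: "\<eta> Y \<cdot> far id_functor f = far (comp_functor ?F ?E) f \<cdot> \<eta> X"
    if "f \<in> hom C X Y" for f X Y
    using dual_unit_natural [OF that] by (simp add: id_functor_def comp_functor_def)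
  have c: "\<theta> Y \<cdot>\<^bsub>op_cat C\<^esub> far (comp_functor ?E ?F) f = far id_functor f \<cdot>\<^bsub>op_cat C\<^esub> \<theta> X"
    if "f \<in> hom (op_cat C) X Y" for f X Y
    using dual_counit_natural [of f Y X] that by (simp add: id_functor_def comp_functor_def)
  show ?thesis
  proof
    show "far (comp_functor ?F ?E) (g \<cdot> f) = far (comp_functor ?F ?E) g \<cdot> far (comp_functor ?F ?E) f"
      if "f \<in> hom C X Y" "g \<in> hom C Y Z" for f g X Y Z
      using that dual_arr_cmp [of f X Y g Z] dual_arr_cmp [of "dual g" "D Z" "D Y" "dual f" "D X"]
      by (simp add: comp_functor_def)
    show "far (comp_functor ?E ?F) (g \<cdot>\<^bsub>op_cat C\<^esub> f) = far (comp_functor ?E ?F) g \<cdot>\<^bsub>op_cat C\<^esub> far (comp_functor ?E ?F) f"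
      if "f \<in> hom (op_cat C) X Y" "g \<in> hom (op_cat C) Y Z" for f g X Y Z
      using that dual_arr_cmp [of g Z Y f X] dual_arr_cmp [of "dual f" "D X" "D Y" "dual g" "D Z"]
      by (simp add: comp_functor_def)
  qed (use u c in \<open>simp_all add: id_functor_def comp_functor_def dual_triangles dual_arr_idt\<close>)
qed

text \<open>The mate of the lax structure on the dual functor is in general not its opposite: they differ by a
  double braiding, which is trivial in the symmetric case.\<close>

lemma dual_colax2:
  assumes o: "X \<in> ob C" "Y \<in> ob C"
  shows "colax2 dual_colax X Y
    = dual (braid C Y X \<cdot> braid C X Y) \<cdot> \<phi>\<^sub>2 X Y" (is "?l = ?r")
proof (rule dual_eqI [of _ "D X \<otimes> D Y" "X \<otimes> Y"])
  let ?P = "D X \<otimes> D Y" and ?T = "X \<otimes> Y"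
  let ?h = "\<eta> X \<boxtimes> \<eta> Y"
  let ?p = "\<phi>\<^sub>2 (D X) (D Y)" and ?j = "\<theta> (D X \<otimes> D Y)"
  let ?n = "nest (D X) X (D Y) Y (ev X) (ev Y)"
  have l: "?l = dual ?h \<cdot> dual ?p \<cdot> ?j"
    using o by (simp add: left_adjoint_colax_def)
  show "?l \<in> hom C ?P (D ?T)"
    unfolding l using o by simp
  have "ev ?T \<cdot> (?l \<boxtimes> idt C ?T)
    = ev (D (D X) \<otimes> D (D Y)) \<cdot> ((dual ?p \<cdot> ?j) \<boxtimes> (?h \<cdot> idt C ?T))"
    unfolding l by (rule ev_dual_arr) (use o in simp_all)
  also have "\<dots> = ev (D ?P) \<cdot> (?j \<boxtimes> (?p \<cdot> ?h \<cdot> idt C ?T))"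
    by (rule ev_dual_arr) (use o in simp_all)
  also have "\<dots> = ev ?P \<cdot> ((?p \<cdot> ?h) \<boxtimes> idt C ?P) \<cdot> inv_arr C (braid C ?T ?P)"
    using o by (subst ev_dual_counit' [where Z = ?T]) simp_all
  also have "\<dots> = (ev ?P \<cdot> ((?p \<cdot> ?h) \<boxtimes> idt C ?P)) \<cdot> inv_arr C (braid C ?T ?P)"
    using o by simp
  also have "ev ?P \<cdot> ((?p \<cdot> ?h) \<boxtimes> idt C ?P)
    = tensor_pairing X (D X) Y (D Y) (ev (D X) \<cdot> (\<eta> X \<boxtimes> idt C (D X)))
        (ev (D Y) \<cdot> (\<eta> Y \<boxtimes> idt C (D Y))) \<cdot> (idt C ?T \<boxtimes> idt C ?P)"
    by (rule ev_lax2) (use o in simp_all)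
  also have "\<dots> = nest X (D X) Y (D Y) (ev X \<cdot> braid C X (D X)) (ev Y \<cdot> braid C Y (D Y))
      \<cdot> (braid C X Y \<boxtimes> idt C ?P)"
    using o by (simp add: ev_dual_unit' [of X _ "D X"] ev_dual_unit' [of Y _ "D Y"] tensor_pairing_def)
  \<comment> \<open>\<open>nest_braid\<close> collects the braidings inside the two units. Of the
    resulting crossings, the one of \<open>D X\<close> with \<open>D Y\<close> belongs to the tensor
    pairing of X and Y and will be absorbed into \<open>\<phi>\<^sub>2 X Y\<close>.\<close>
  also have "\<dots> \<cdot> inv_arr C (braid C ?T ?P)
    = ?n \<cdot> (braid C (D X) (D Y) \<boxtimes> braid C Y X) \<cdot> (braid C (Y \<otimes> X) ?P \<cdot> (braid C X Y \<boxtimes> idt C ?P))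
        \<cdot> inv_arr C (braid C ?T ?P)"
    using o by (subst nest_braid) simp_all
  \<comment> \<open>Naturality carries \<open>braid C X Y\<close> to the second factor, next to
    \<open>braid C Y X\<close>. The outer braiding then cancels against the inverse one from the
    counit, and the double braiding on X \<otimes> Y is what remains.\<close>
  also have "\<dots> = ?n \<cdot> (braid C (D X) (D Y) \<boxtimes> braid C Y X) \<cdot> ((idt C ?P \<boxtimes> braid C X Y) \<cdot> braid C ?T ?P)
        \<cdot> inv_arr C (braid C ?T ?P)"
    using o by (subst braid_natural [where X = ?T and Y = ?P]) auto
  also have "\<dots> = ev ?T \<cdot> (\<phi>\<^sub>2 X Y \<boxtimes> ((braid C Y X \<cdot> braid C X Y) \<cdot> idt C ?T))"
    using o by (subst ev_lax2' [where Z = ?T]) (simp_all add: tensor_pairing_def)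
  also have "\<dots> = ev ?T \<cdot> (?r \<boxtimes> idt C ?T)"
    by (rule ev_dual_arr [symmetric]) (use o in simp_all)
  finally show "ev ?T \<cdot> (?l \<boxtimes> idt C ?T) = ev ?T \<cdot> (?r \<boxtimes> idt C ?T)" .
qed (use o in simp_all)

text \<open>No correction arises in degree zero: by \<open>lun_braid\<close> and
  \<open>lun_unt\<close> the braiding of the unit with itself is absorbed by the unitor.\<close>

lemma dual_colax0:
  "colax0 dual_colax = \<phi>\<^sub>0" (is "?l = ?r")
proof (rule dual_eqI [of _ "unt C" "unt C"])
  let ?I = "unt C"
  have l: "?l = dual ?r \<cdot> \<theta> ?I"
    by (simp add: left_adjoint_colax_def)
  show "?l \<in> hom C ?I (D ?I)"
    unfolding l by simp
  have "ev ?I \<cdot> (?l \<boxtimes> idt C ?I) = ev (D ?I) \<cdot> (\<theta> ?I \<boxtimes> (?r \<cdot> idt C ?I))"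
    unfolding l by (rule ev_dual_arr) simp_all
  also have "\<dots> = ev ?I \<cdot> (?r \<boxtimes> idt C ?I) \<cdot> inv_arr C (braid C ?I ?I)"
    by (subst ev_dual_counit' [where Z = ?I]) simp_all
  also have "\<dots> = (ev ?I \<cdot> (?r \<boxtimes> idt C ?I)) \<cdot> inv_arr C (braid C ?I ?I)"
    by (simp del: ev_dagger_idt)
  also have "\<dots> = (lun C ?I \<cdot> braid C ?I ?I) \<cdot> inv_arr C (braid C ?I ?I)"
    by (simp add: lun_braid) (simp add: lun_unt)
  also have "\<dots> = ev ?I \<cdot> (?r \<boxtimes> idt C ?I)"
    by simp
  finally show "ev ?I \<cdot> (?l \<boxtimes> idt C ?I) = ev ?I \<cdot> (?r \<boxtimes> idt C ?I)" .
qed simp_all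

end

section \<open>Adjoints and universal arrows\<close>

lemma structured_category_simps [simp]:
  "ob (structured_category C S P) = S"
  "(X, f, Y) \<in> arr (structured_category C S P) \<longleftrightarrow> X \<in> S \<and> Y \<in> S \<and> P X f Y"
  "src (structured_category C S P) (X, f, Y) = X"
  "tgt (structured_category C S P) (X, f, Y) = Y"
  "idt (structured_category C S P) X = (X, idt C (fst X), X)"
  "(Y, g, Z) \<cdot>\<^bsub>structured_category C S P\<^esub> (X, f, Y') = (X, g \<cdot>\<^bsub>C\<^esub> f, Z)"
  by (simp_all add: structured_category_def)

lemma hom_structured_category_iff:
  "F \<in> hom (structured_category C S P) X Y \<longleftrightarrow> (\<exists>f. F = (X, f, Y) \<and> X \<in> S \<and> Y \<in> S \<and> P X f Y)"
  by (cases F) auto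

text \<open>The part shared by \<open>Alg\<close> and \<open>Coalg\<close>: composition is that of
  the underlying arrows, so the category laws are inherited and only closure of \<open>P\<close> has
  to be checked.\<close>

lemma (in monoidal_category) category_structured:
  assumes "\<And>X f Y. \<lbrakk>X \<in> S; Y \<in> S; P X f Y\<rbrakk> \<Longrightarrow> f \<in> hom C (fst X) (fst Y)"
    and "\<And>X. X \<in> S \<Longrightarrow> P X (idt C (fst X)) X"
    and "\<And>X Y Z f g. \<lbrakk>X \<in> S; Y \<in> S; Z \<in> S; P X f Y; P Y g Z\<rbrakk> \<Longrightarrow> P X (g \<cdot> f) Z"
  shows "category (structured_category C S P)"
proof
  show "(h \<cdot>\<^bsub>structured_category C S P\<^esub> g) \<cdot>\<^bsub>structured_category C S P\<^esub> f
      = h \<cdot>\<^bsub>structured_category C S P\<^esub> (g \<cdot>\<^bsub>structured_category C S P\<^esub> f)"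
    if fgh: "f \<in> hom (structured_category C S P) W X" "g \<in> hom (structured_category C S P) X Y"
      "h \<in> hom (structured_category C S P) Y Z" for f g h W X Y Z
  proof -
    obtain f' g' h' where *: "f = (W, f', X)" "g = (X, g', Y)" "h = (Y, h', Z)"
        "W \<in> S" "X \<in> S" "Y \<in> S" "Z \<in> S" "P W f' X" "P X g' Y" "P Y h' Z"
      using fgh unfolding hom_structured_category_iff by blast
    have "f' \<in> hom C (fst W) (fst X)" "g' \<in> hom C (fst X) (fst Y)" "h' \<in> hom C (fst Y) (fst Z)"
      using * assms(1) by blast+
    then show ?thesis
      using * by simp
  qed
  show "g \<cdot>\<^bsub>structured_category C S P\<^esub> f \<in> hom (structured_category C S P) X Z"
    if "f \<in> hom (structured_category C S P) X Y" "g \<in> hom (structured_category C S P) Y Z" for f g X Y Z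
    using that assms(3) unfolding hom_structured_category_iff by fastforce
  show "idt (structured_category C S P) Y \<cdot>\<^bsub>structured_category C S P\<^esub> f = f"
    "f \<cdot>\<^bsub>structured_category C S P\<^esub> idt (structured_category C S P) X = f"
    if f: "f \<in> hom (structured_category C S P) X Y" for f X Y
  proof -
    obtain f' where *: "f = (X, f', Y)" "X \<in> S" "Y \<in> S" "P X f' Y"
      using f unfolding hom_structured_category_iff by blast
    then have "f' \<in> hom C (fst X) (fst Y)"
      using assms(1) by blast
    then show "idt (structured_category C S P) Y \<cdot>\<^bsub>structured_category C S P\<^esub> f = f"
      "f \<cdot>\<^bsub>structured_category C S P\<^esub> idt (structured_category C S P) X = f"
      using * by simp_all
  qed
  show "idt (structured_category C S P) X \<in> hom (structured_category C S P) X X"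
    if "X \<in> ob (structured_category C S P)" for X
    using that assms(2) by simp
  fix f
  assume "f \<in> arr (structured_category C S P)"
  then show "src (structured_category C S P) f \<in> ob (structured_category C S P)"
    "tgt (structured_category C S P) f \<in> ob (structured_category C S P)"
    by (cases f, simp)+
qed

text \<open>The pointwise form of a left adjoint: \<open>U\<close> with \<open>h\<close> represents
  the functor of arrows from X into values of F. It can be given one object at a time, so no
  functoriality of U is carried around.\<close>

definition universal_arrow ::
  "('o1, 'a1, 'x) category_scheme \<Rightarrow> ('o2, 'a2, 'y) category_scheme
    \<Rightarrow> ('o1, 'a1, 'o2, 'a2, 'z) cat_functor_scheme \<Rightarrow> 'o2 \<Rightarrow> 'o1 \<Rightarrow> 'a2 \<Rightarrow> bool" where
  "universal_arrow A B F X U h \<longleftrightarrow> U \<in> ob A \<and> h \<in> hom B X (fob F U)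
    \<and> (\<forall>Y \<in> ob A. \<forall>f \<in> hom B X (fob F Y). \<exists>!g. g \<in> hom A U Y \<and> far F g \<cdot>\<^bsub>B\<^esub> h = f)"

context cat_functor
begin

declare fob_ob [simp]

lemma far_simps [simp]:
  assumes "f \<in> arr A"
  shows "far F f \<in> arr B" "src B (far F f) = fob F (src A f)" "tgt B (far F f) = fob F (tgt A f)"
  using far_hom [of f "src A f" "tgt A f"] assms by auto

lemma far_cmp_simp:
  assumes "f \<in> arr A" "g \<in> arr A" "tgt A f = src A g"
  shows "far F (g \<cdot>\<^bsub>A\<^esub> f) = far F g \<cdot>\<^bsub>B\<^esub> far F f"
  using far_cmp [of f "src A f" "src A g" g "tgt A g"] assms by auto

lemma universal_arrow_eqI:
  assumes "universal_arrow A B F X U h" "g \<in> hom A U Y" "g' \<in> hom A U Y"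
    "far F g \<cdot>\<^bsub>B\<^esub> h = far F g' \<cdot>\<^bsub>B\<^esub> h"
  shows "g = g'"
proof -
  have "Y \<in> ob A" "far F g \<cdot>\<^bsub>B\<^esub> h \<in> hom B X (fob F Y)"
    using assms by (auto simp: universal_arrow_def)
  then have "\<exists>!k. k \<in> hom A U Y \<and> far F k \<cdot>\<^bsub>B\<^esub> h = far F g \<cdot>\<^bsub>B\<^esub> h"
    using assms(1) unfolding universal_arrow_def by blast
  then show ?thesis
    using assms(2-4) by metis
qed

lemma has_left_adjointI:
  assumes "\<And>X. X \<in> ob B \<Longrightarrow> \<exists>U h. universal_arrow A B F X U h"
  shows "has_left_adjoint A B F"
proof -
  obtain U h where univ: "\<And>X. X \<in> ob B \<Longrightarrow> universal_arrow A B F X (U X) (h X)"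
    using assms by metis
  have Uh [simp]: "U X \<in> ob A" "h X \<in> arr B" "src B (h X) = X" "tgt B (h X) = fob F (U X)" if "X \<in> ob B" for X
    using univ [OF that] by (auto simp: universal_arrow_def)
  define lift where "lift X Y f = (THE g. g \<in> hom A (U X) Y \<and> far F g \<cdot>\<^bsub>B\<^esub> h X = f)" for X Y f
  have lift: "lift X Y f \<in> hom A (U X) Y \<and> far F (lift X Y f) \<cdot>\<^bsub>B\<^esub> h X = f"
    if "X \<in> ob B" "Y \<in> ob A" "f \<in> hom B X (fob F Y)" for X Y f
    unfolding lift_def
    by (rule theI') (use univ [OF that(1)] that in \<open>unfold universal_arrow_def, blast\<close>)
  \<comment> \<open>On arrows E is forced by naturality of \<open>h\<close>: the image of f is the
    only arrow through which \<open>h \<cdot> f\<close> factors.\<close>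
  define E :: "('o2, 'a2, 'o1, 'a1) cat_functor" where
    "E = \<lparr>fob = U, far = (\<lambda>f. lift (src B f) (U (tgt B f)) (h (tgt B f) \<cdot>\<^bsub>B\<^esub> f))\<rparr>"
  \<comment> \<open>The counit lifts the identity, so one triangle identity holds by construction.
    Functoriality of E, naturality of the counit and the other triangle follow from
    uniqueness.\<close>
  define \<epsilon> where "\<epsilon> Y = lift (fob F Y) Y (idt B (fob F Y))" for Y
  have fobE [simp]: "fob E = U"
    by (simp add: E_def)
  have farE_simps [simp]: "far E f \<in> arr A" "src A (far E f) = U (src B f)" "tgt A (far E f) = U (tgt B f)"
    and farE: "far F (far E f) \<cdot>\<^bsub>B\<^esub> h (src B f) = h (tgt B f) \<cdot>\<^bsub>B\<^esub> f" if "f \<in> arr B" for f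
    using lift [of "src B f" "U (tgt B f)" "h (tgt B f) \<cdot>\<^bsub>B\<^esub> f"] that by (simp_all add: E_def)
  have eps_simps [simp]: "\<epsilon> Y \<in> arr A" "src A (\<epsilon> Y) = U (fob F Y)" "tgt A (\<epsilon> Y) = Y"
    and eps: "far F (\<epsilon> Y) \<cdot>\<^bsub>B\<^esub> h (fob F Y) = idt B (fob F Y)" if "Y \<in> ob A" for Y
    using lift [of "fob F Y" Y "idt B (fob F Y)"] that by (simp_all add: \<epsilon>_def)
  interpret E: cat_functor B A E
  proof
    show "far E (idt B X) = idt A (fob E X)" if "X \<in> ob B" for X
      by (rule universal_arrow_eqI [OF univ [OF that]])
        (use that farE [of "idt B X"] in \<open>simp_all add: far_idt\<close>)
    show "far E (g \<cdot>\<^bsub>B\<^esub> f) = far E g \<cdot>\<^bsub>A\<^esub> far E f"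
      if fg: "f \<in> hom B X Y" "g \<in> hom B Y Z" for f g X Y Z
    proof -
      have X: "X \<in> ob B" and o: "Y \<in> ob B" "Z \<in> ob B"
        using fg by auto
      have "far F (far E (g \<cdot>\<^bsub>B\<^esub> f)) \<cdot>\<^bsub>B\<^esub> h X = (h Z \<cdot>\<^bsub>B\<^esub> g) \<cdot>\<^bsub>B\<^esub> f"
        using farE [of "g \<cdot>\<^bsub>B\<^esub> f"] fg o by simp
      also have "\<dots> = far F (far E g) \<cdot>\<^bsub>B\<^esub> (h Y \<cdot>\<^bsub>B\<^esub> f)"
        using farE [of g, symmetric] fg o by simp
      also have "\<dots> = far F (far E g \<cdot>\<^bsub>A\<^esub> far E f) \<cdot>\<^bsub>B\<^esub> h X"
        using farE [of f, symmetric] fg X o by (simp add: far_cmp_simp)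
      finally show ?thesis
        by (rule universal_arrow_eqI [OF univ [OF X], of _ "U Z", rotated 2]) (use fg in simp_all)
    qed
  qed simp_all
  have "adjunction A B E F h \<epsilon>"
  proof
    show "\<epsilon> Y \<cdot>\<^bsub>A\<^esub> far (comp_functor E F) f = far id_functor f \<cdot>\<^bsub>A\<^esub> \<epsilon> X" if f: "f \<in> hom A X Y" for f X Y
    proof -
      have o: "X \<in> ob A" "Y \<in> ob A"
        using f by auto
      have "far F (\<epsilon> Y \<cdot>\<^bsub>A\<^esub> far E (far F f)) \<cdot>\<^bsub>B\<^esub> h (fob F X) = far F (\<epsilon> Y) \<cdot>\<^bsub>B\<^esub> (far F (far E (far F f)) \<cdot>\<^bsub>B\<^esub> h (fob F X))"
        using f o by (simp add: far_cmp_simp)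
      also have "\<dots> = (far F (\<epsilon> Y) \<cdot>\<^bsub>B\<^esub> h (fob F Y)) \<cdot>\<^bsub>B\<^esub> far F f"
        using farE [of "far F f"] f o by simp
      also have "\<dots> = far F f \<cdot>\<^bsub>B\<^esub> (far F (\<epsilon> X) \<cdot>\<^bsub>B\<^esub> h (fob F X))"
        using eps [of X] eps [of Y] f o by simp
      also have "\<dots> = far F (f \<cdot>\<^bsub>A\<^esub> \<epsilon> X) \<cdot>\<^bsub>B\<^esub> h (fob F X)"
        using f o by (simp add: far_cmp_simp)
      finally have "\<epsilon> Y \<cdot>\<^bsub>A\<^esub> far E (far F f) = f \<cdot>\<^bsub>A\<^esub> \<epsilon> X"
        by (rule universal_arrow_eqI [OF univ [OF fob_ob [OF o(1)]], of _ Y, rotated 2]) (use f o in simp_all)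
      then show ?thesis
        by (simp add: id_functor_def comp_functor_def)
    qed
    show "\<epsilon> (fob E X) \<cdot>\<^bsub>A\<^esub> far E (h X) = idt A (fob E X)" if X: "X \<in> ob B" for X
    proof -
      have "far F (\<epsilon> (U X) \<cdot>\<^bsub>A\<^esub> far E (h X)) \<cdot>\<^bsub>B\<^esub> h X = far F (\<epsilon> (U X)) \<cdot>\<^bsub>B\<^esub> (far F (far E (h X)) \<cdot>\<^bsub>B\<^esub> h X)"
        using X by (simp add: far_cmp_simp)
      also have "\<dots> = (far F (\<epsilon> (U X)) \<cdot>\<^bsub>B\<^esub> h (fob F (U X))) \<cdot>\<^bsub>B\<^esub> h X"
        using farE [of "h X"] X by simp
      also have "\<dots> = far F (idt A (U X)) \<cdot>\<^bsub>B\<^esub> h X"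
        using eps [of "U X"] X by (simp add: far_idt)
      finally show ?thesis
        unfolding fobE by (rule universal_arrow_eqI [OF univ [OF X], of _ "U X", rotated 2]) (use X in simp_all)
    qed
    show "h Y \<cdot>\<^bsub>B\<^esub> far id_functor f = far (comp_functor F E) f \<cdot>\<^bsub>B\<^esub> h X" if "f \<in> hom B X Y" for f X Y
      using farE [of f] that by (simp add: id_functor_def comp_functor_def)
  qed (simp_all add: id_functor_def comp_functor_def eps far_idt E.far_idt far_cmp_simp E.far_cmp_simp)
  then show ?thesis
    unfolding has_left_adjoint_def by blast
qed

end

text \<open>Converse of \<open>has_left_adjointI\<close>: adjunctions can be unpacked into universal
  arrows, manipulated there and packed again.\<close>

lemma (in adjunction) universal_arrow_unit:
  assumes X: "X \<in> ob B"
  shows "universal_arrow A B F X (fob E X) (\<eta> X)"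
proof -
  have unit_hom: "\<eta> X \<in> hom B X (fob F (fob E X))" if "X \<in> ob B" for X
    using unit.component_hom [OF that] by (simp add: id_functor_def comp_functor_def)
  have counit_hom: "\<epsilon> Y \<in> hom A (fob E (fob F Y)) Y" if "Y \<in> ob A" for Y
    using counit.component_hom [OF that] by (simp add: id_functor_def comp_functor_def)
  note [simp] = unit_hom [simplified] counit_hom [simplified]
  have "\<exists>!g. g \<in> hom A (fob E X) Y \<and> far F g \<cdot>\<^bsub>B\<^esub> \<eta> X = f" if Y: "Y \<in> ob A" and f: "f \<in> hom B X (fob F Y)" for Y f
  proof (rule ex1I [of _ "\<epsilon> Y \<cdot>\<^bsub>A\<^esub> far E f"])
    have nat: "\<eta> (fob F Y) \<cdot>\<^bsub>B\<^esub> f = far F (far E f) \<cdot>\<^bsub>B\<^esub> \<eta> X"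
      using unit.naturality [OF f] by (simp add: id_functor_def comp_functor_def)
    have "far F (\<epsilon> Y \<cdot>\<^bsub>A\<^esub> far E f) \<cdot>\<^bsub>B\<^esub> \<eta> X = far F (\<epsilon> Y) \<cdot>\<^bsub>B\<^esub> (far F (far E f) \<cdot>\<^bsub>B\<^esub> \<eta> X)"
      using X Y f by (simp add: F.far_cmp_simp)
    also have "\<dots> = (far F (\<epsilon> Y) \<cdot>\<^bsub>B\<^esub> \<eta> (fob F Y)) \<cdot>\<^bsub>B\<^esub> f"
      unfolding nat [symmetric] using X Y f by simp
    also have "\<dots> = f"
      using triangle_right [OF Y] Y f by simp
    finally show "\<epsilon> Y \<cdot>\<^bsub>A\<^esub> far E f \<in> hom A (fob E X) Y \<and> far F (\<epsilon> Y \<cdot>\<^bsub>A\<^esub> far E f) \<cdot>\<^bsub>B\<^esub> \<eta> X = f"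
      using X Y f by simp
  next
    fix g
    assume g: "g \<in> hom A (fob E X) Y \<and> far F g \<cdot>\<^bsub>B\<^esub> \<eta> X = f"
    then have nat: "\<epsilon> Y \<cdot>\<^bsub>A\<^esub> far E (far F g) = g \<cdot>\<^bsub>A\<^esub> \<epsilon> (fob E X)"
      using counit.naturality [of g "fob E X" Y] by (simp add: id_functor_def comp_functor_def)
    have "far E f = far E (far F g) \<cdot>\<^bsub>A\<^esub> far E (\<eta> X)"
      using E.far_cmp_simp [of "\<eta> X" "far F g"] X Y g by simp
    then have "\<epsilon> Y \<cdot>\<^bsub>A\<^esub> far E f = (\<epsilon> Y \<cdot>\<^bsub>A\<^esub> far E (far F g)) \<cdot>\<^bsub>A\<^esub> far E (\<eta> X)"
      using X Y g by simp
    also have "\<dots> = g \<cdot>\<^bsub>A\<^esub> (\<epsilon> (fob E X) \<cdot>\<^bsub>A\<^esub> far E (\<eta> X))"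
      unfolding nat using X Y g by simp
    also have "\<dots> = g"
      using triangle_left [OF X] X Y g by simp
    finally show "g = \<epsilon> Y \<cdot>\<^bsub>A\<^esub> far E f" ..
  qed
  then show ?thesis
    using X unit_hom [OF X] by (simp add: universal_arrow_def del: hom_def)
qed

lemma has_left_adjointD:
  assumes "has_left_adjoint A B F" "X \<in> ob B"
  shows "\<exists>U h. universal_arrow A B F X U h"
  using assms adjunction.universal_arrow_unit unfolding has_left_adjoint_def by metis

lemma has_left_adjoint_cat_functor:
  assumes "has_left_adjoint A B F"
  shows "cat_functor A B F"
  using assms unfolding has_left_adjoint_def adjunction_def by blast

lemma cat_functor_comp:
  assumes "cat_functor A B F" "cat_functor B C G"
  shows "cat_functor A C (comp_functor G F)"
proof -
  interpret F: cat_functor A B F by fact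
  interpret G: cat_functor B C G by fact
  show ?thesis
    by unfold_locales (simp_all add: comp_functor_def F.far_idt G.far_idt F.far_cmp_simp G.far_cmp_simp)
qed

text \<open>Universal arrows compose: an arrow factors first through \<open>k\<close> and G, then
  through \<open>h\<close> and F, so G h after k is universal for the composite.\<close>

lemma has_left_adjoint_comp:
  assumes "has_left_adjoint A B F" "has_left_adjoint B C G"
  shows "has_left_adjoint A C (comp_functor G F)"
proof -
  interpret F: cat_functor A B F
    using assms(1) by (rule has_left_adjoint_cat_functor)
  interpret G: cat_functor B C G
    using assms(2) by (rule has_left_adjoint_cat_functor)
  interpret GF: cat_functor A C "comp_functor G F"
    by (rule cat_functor_comp) unfold_locales
  show ?thesis
  proof (rule GF.has_left_adjointI)
    fix X
    assume X: "X \<in> ob C"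
    obtain V k where k: "universal_arrow B C G X V k"
      using has_left_adjointD [OF assms(2) X] by blast
    then obtain U h where h: "universal_arrow A B F V U h"
      using has_left_adjointD [OF assms(1), of V] by (auto simp: universal_arrow_def)
    have [simp]: "V \<in> ob B" "k \<in> arr C" "src C k = X" "tgt C k = fob G V"
      "U \<in> ob A" "h \<in> arr B" "src B h = V" "tgt B h = fob F U"
      using k h by (auto simp: universal_arrow_def)
    have "\<exists>!g. g \<in> hom A U Y \<and> far G (far F g) \<cdot>\<^bsub>C\<^esub> far G h \<cdot>\<^bsub>C\<^esub> k = f"
      if Y: "Y \<in> ob A" and f: "f \<in> hom C X (fob G (fob F Y))" for Y f
    proof -
      obtain f' where f': "f' \<in> hom B V (fob F Y)" "far G f' \<cdot>\<^bsub>C\<^esub> k = f"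
        using k Y f F.fob_ob [OF Y] unfolding universal_arrow_def by blast
      obtain g where g: "g \<in> hom A U Y" "far F g \<cdot>\<^bsub>B\<^esub> h = f'"
        using h Y f' unfolding universal_arrow_def by blast
      show ?thesis
      proof (rule ex1I [of _ g])
        show "g \<in> hom A U Y \<and> far G (far F g) \<cdot>\<^bsub>C\<^esub> far G h \<cdot>\<^bsub>C\<^esub> k = f"
          using G.B.cmp_extend [OF G.far_cmp_simp [symmetric, of h "far F g"], of k] g f' by simp
        fix g'
        assume g': "g' \<in> hom A U Y \<and> far G (far F g') \<cdot>\<^bsub>C\<^esub> far G h \<cdot>\<^bsub>C\<^esub> k = f"
        have "far F g' \<cdot>\<^bsub>B\<^esub> h = f'"
          by (rule G.universal_arrow_eqI [OF k]) (use g' f' X in \<open>simp_all add: G.far_cmp_simp\<close>)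
        then show "g' = g"
          using g g' by (intro F.universal_arrow_eqI [OF h, of _ Y]) auto
      qed
    qed
    then have "universal_arrow A C (comp_functor G F) X U (far G h \<cdot>\<^bsub>C\<^esub> k)"
      by (simp add: universal_arrow_def comp_functor_def del: hom_def) simp
    then show "\<exists>U h. universal_arrow A C (comp_functor G F) X U h"
      by blast
  qed
qed

text \<open>An arrow into G Y is carried to F Y by the inverse of \<open>\<tau> Y\<close> and
  factored there. Hence \<open>\<tau> U\<close> after a universal arrow for F is universal for
  G.\<close>

lemma has_left_adjoint_iso:
  assumes "has_left_adjoint A B F" "cat_functor A B G"
    and \<tau>: "\<And>Y. Y \<in> ob A \<Longrightarrow> \<tau> Y \<in> hom B (fob F Y) (fob G Y)" "\<And>Y. Y \<in> ob A \<Longrightarrow> iso_arr B (\<tau> Y)"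
    and natural: "\<And>f X Y. f \<in> hom A X Y \<Longrightarrow> \<tau> Y \<cdot>\<^bsub>B\<^esub> far F f = far G f \<cdot>\<^bsub>B\<^esub> \<tau> X"
  shows "has_left_adjoint A B G"
proof -
  interpret F: cat_functor A B F
    using assms(1) by (rule has_left_adjoint_cat_functor)
  interpret G: cat_functor A B G by fact
  note [simp] = \<tau> [simplified]
  show ?thesis
  proof (rule G.has_left_adjointI)
    fix X
    assume X: "X \<in> ob B"
    obtain U h where h: "universal_arrow A B F X U h"
      using has_left_adjointD [OF assms(1) X] by blast
    then have [simp]: "U \<in> ob A" "h \<in> arr B" "src B h = X" "tgt B h = fob F U"
      by (auto simp: universal_arrow_def)
    have shift: "far G g \<cdot>\<^bsub>B\<^esub> \<tau> U \<cdot>\<^bsub>B\<^esub> h = \<tau> Y \<cdot>\<^bsub>B\<^esub> far F g \<cdot>\<^bsub>B\<^esub> h" if "g \<in> hom A U Y" for g Y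
    proof -
      have "Y \<in> ob A"
        using that by auto
      then show ?thesis
        using that F.B.cmp_extend [OF natural [OF that], of h] by simp
    qed
    have "\<exists>!g. g \<in> hom A U Y \<and> far G g \<cdot>\<^bsub>B\<^esub> \<tau> U \<cdot>\<^bsub>B\<^esub> h = f" if Y: "Y \<in> ob A" and f: "f \<in> hom B X (fob G Y)" for Y f
    proof -
      have "inv_arr B (\<tau> Y) \<cdot>\<^bsub>B\<^esub> f \<in> hom B X (fob F Y)"
        using Y f by simp
      then obtain g where g: "g \<in> hom A U Y" "far F g \<cdot>\<^bsub>B\<^esub> h = inv_arr B (\<tau> Y) \<cdot>\<^bsub>B\<^esub> f"
        using h Y unfolding universal_arrow_def by blast
      show ?thesis
      proof (rule ex1I [of _ g])
        show "g \<in> hom A U Y \<and> far G g \<cdot>\<^bsub>B\<^esub> \<tau> U \<cdot>\<^bsub>B\<^esub> h = f"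
          using g shift [OF g(1)] Y f by simp
        fix g'
        assume g': "g' \<in> hom A U Y \<and> far G g' \<cdot>\<^bsub>B\<^esub> \<tau> U \<cdot>\<^bsub>B\<^esub> h = f"
        have "far F g' \<cdot>\<^bsub>B\<^esub> h = inv_arr B (\<tau> Y) \<cdot>\<^bsub>B\<^esub> f"
          using g' shift [of g' Y] Y by auto
        then show "g' = g"
          using g g' by (intro F.universal_arrow_eqI [OF h, of _ Y]) auto
      qed
    qed
    then have "universal_arrow A B G X U (\<tau> U \<cdot>\<^bsub>B\<^esub> h)"
      by (simp add: universal_arrow_def del: hom_def) simp
    then show "\<exists>U h. universal_arrow A B G X U h"
      by blast
  qed
qed

section \<open>Categories of algebras and coalgebras\<close>

lemma hom_Alg_iff: "F \<in> hom (Alg C) X Y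
    \<longleftrightarrow> (\<exists>f. F = (X, f, Y) \<and> X \<in> algebras C \<and> Y \<in> algebras C \<and> algebra_morphism C X f Y)"
  unfolding Alg_def by (rule hom_structured_category_iff)

lemma hom_Coalg_iff: "F \<in> hom (Coalg C) X Y
    \<longleftrightarrow> (\<exists>f. F = (X, f, Y) \<and> X \<in> coalgebras C \<and> Y \<in> coalgebras C \<and> coalgebra_morphism C X f Y)"
  unfolding Coalg_def by (rule hom_structured_category_iff)

lemma Alg_simps [simp]:
  "ob (Alg C) = algebras C" "idt (Alg C) X = (X, idt C (fst X), X)"
  "(Y, g, Z) \<cdot>\<^bsub>Alg C\<^esub> (X, f, Y') = (X, g \<cdot>\<^bsub>C\<^esub> f, Z)"
  by (simp_all add: Alg_def)

lemma Coalg_simps [simp]: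
  "ob (Coalg C) = coalgebras C" "idt (Coalg C) X = (X, idt C (fst X), X)"
  "(Y, g, Z) \<cdot>\<^bsub>Coalg C\<^esub> (X, f, Y') = (X, g \<cdot>\<^bsub>C\<^esub> f, Z)"
  by (simp_all add: Coalg_def)

lemma algebra_morphism_hom: "algebra_morphism C X f Y \<Longrightarrow> f \<in> hom C (fst X) (fst Y)"
  by (auto simp: algebra_morphism_def split: prod.splits)

lemma coalgebra_morphism_hom: "coalgebra_morphism C X f Y \<Longrightarrow> f \<in> hom C (fst X) (fst Y)"
  by (auto simp: coalgebra_morphism_def split: prod.splits)

lemma fst_algebras [simp]: "X \<in> algebras C \<Longrightarrow> fst X \<in> ob C"
  by (auto simp: algebras_def)

text \<open>Together with \<open>algebras_op\<close> this makes algebras in the opposite category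
  the opposite of the category of coalgebras, with the same underlying arrows.\<close>

lemma algebra_morphism_op: "algebra_morphism (op_cat C) X f Y \<longleftrightarrow> coalgebra_morphism C Y f X"
  by (auto simp: algebra_morphism_def coalgebra_morphism_def split: prod.splits)

lemma coalgebra_morphism_op: "coalgebra_morphism (op_cat C) X f Y \<longleftrightarrow> algebra_morphism C Y f X"
  by (auto simp: algebra_morphism_def coalgebra_morphism_def split: prod.splits)

context category
begin

lemma iso_cmp_eq_iff:
  assumes "iso_arr C a" "f \<in> arr C" "g \<in> arr C" "tgt C f = src C a" "tgt C g = tgt C a"
  shows "a \<cdot> f = g \<longleftrightarrow> f = inv_arr C a \<cdot> g"
  using assms by auto

end

context monoidal_category
begin

lemma algebra_morphism_cmp:
  assumes "X \<in> algebras C" "Y \<in> algebras C" "Z \<in> algebras C"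
    "algebra_morphism C X f Y" "algebra_morphism C Y g Z"
  shows "algebra_morphism C X (g \<cdot> f) Z"
proof -
  obtain A m u B m' u' E m'' u'' where e: "X = (A, m, u)" "Y = (B, m', u')" "Z = (E, m'', u'')"
    by (cases X, cases Y, cases Z)
  have [simp]: "m \<in> arr C" "src C m = A \<otimes> A" "tgt C m = A" "u \<in> arr C" "src C u = unt C" "tgt C u = A"
    "m' \<in> arr C" "src C m' = B \<otimes> B" "tgt C m' = B" "u' \<in> arr C" "src C u' = unt C" "tgt C u' = B"
    "m'' \<in> arr C" "src C m'' = E \<otimes> E" "tgt C m'' = E"
    using assms(1-3) by (auto simp: e algebras_def)
  have f: "f \<in> arr C" "src C f = A" "tgt C f = B" "f \<cdot> m = m' \<cdot> (f \<boxtimes> f)" "f \<cdot> u = u'"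
    and g: "g \<in> arr C" "src C g = B" "tgt C g = E" "g \<cdot> m' = m'' \<cdot> (g \<boxtimes> g)" "g \<cdot> u' = u''"
    using assms(4,5) by (auto simp: e algebra_morphism_def)
  have "(g \<cdot> f) \<cdot> m = g \<cdot> m' \<cdot> (f \<boxtimes> f)"
    using f g by simp
  also have "\<dots> = m'' \<cdot> ((g \<cdot> f) \<boxtimes> (g \<cdot> f))"
    using f(1-3) g(1-3) by (simp add: cmp_extend [OF g(4)])
  finally show ?thesis
    using f g by (simp add: e algebra_morphism_def)
qed

lemma coalgebra_morphism_cmp:
  assumes "X \<in> coalgebras C" "Y \<in> coalgebras C" "Z \<in> coalgebras C"
    "coalgebra_morphism C X f Y" "coalgebra_morphism C Y g Z"
  shows "coalgebra_morphism C X (g \<cdot> f) Z"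
proof -
  obtain A m u B m' u' E m'' u'' where e: "X = (A, m, u)" "Y = (B, m', u')" "Z = (E, m'', u'')"
    by (cases X, cases Y, cases Z)
  have [simp]: "m \<in> arr C" "src C m = A" "tgt C m = A \<otimes> A"
    "m' \<in> arr C" "src C m' = B" "tgt C m' = B \<otimes> B"
    "m'' \<in> arr C" "src C m'' = E" "tgt C m'' = E \<otimes> E" "u'' \<in> arr C" "src C u'' = E" "tgt C u'' = unt C"
    using assms(1-3) by (auto simp: e coalgebras_def)
  have f: "f \<in> arr C" "src C f = A" "tgt C f = B" "(f \<boxtimes> f) \<cdot> m = m' \<cdot> f" "u' \<cdot> f = u"
    and g: "g \<in> arr C" "src C g = B" "tgt C g = E" "(g \<boxtimes> g) \<cdot> m' = m'' \<cdot> g" "u'' \<cdot> g = u'"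
    using assms(4,5) by (auto simp: e coalgebra_morphism_def)
  have "((g \<cdot> f) \<boxtimes> (g \<cdot> f)) \<cdot> m = (g \<boxtimes> g) \<cdot> (f \<boxtimes> f) \<cdot> m"
    using f(1-3) g(1-3) by simp
  also have "\<dots> = m'' \<cdot> (g \<cdot> f)"
    unfolding f(4) using f(1-3) g(1-3) by (simp add: cmp_extend [OF g(4)])
  finally show ?thesis
    using f g cmp_extend [OF g(5), of f] by (simp add: e coalgebra_morphism_def)
qed

lemma category_Alg: "category (Alg C)"
  unfolding Alg_def
proof (rule category_structured)
  show "algebra_morphism C X (idt C (fst X)) X" if "X \<in> algebras C" for X
    using that by (cases X) (auto simp: algebra_morphism_def algebras_def)
qed (auto simp: algebra_morphism_cmp dest: algebra_morphism_hom)

lemma category_Coalg: "category (Coalg C)"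
  unfolding Coalg_def
proof (rule category_structured)
  show "coalgebra_morphism C X (idt C (fst X)) X" if "X \<in> coalgebras C" for X
    using that by (cases X) (auto simp: coalgebra_morphism_def coalgebras_def)
qed (auto simp: coalgebra_morphism_cmp dest: coalgebra_morphism_hom)

text \<open>The constraints of the opposite category are inverses, so each algebra axiom turns into
  a coalgebra axiom by moving one isomorphism across the equation. The same triples serve on both
  sides, so passing to the opposite needs no translation of objects.\<close>

lemma algebras_op: "algebras (op_cat C) = coalgebras C"
proof -
  have "(A, d, e) \<in> algebras (op_cat C) \<longleftrightarrow> (A, d, e) \<in> coalgebras C" for A d e
  proof (cases "A \<in> ob C \<and> d \<in> hom C A (A \<otimes> A) \<and> e \<in> hom C A (unt C)")
    case True
    then have "((assc C A A A \<cdot> (d \<boxtimes> idt C A) \<cdot> d = (idt C A \<boxtimes> d) \<cdot> d)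
        \<longleftrightarrow> (d \<boxtimes> idt C A) \<cdot> d = ainv A A A \<cdot> (idt C A \<boxtimes> d) \<cdot> d)"
      "(lun C A \<cdot> (e \<boxtimes> idt C A) \<cdot> d = idt C A) \<longleftrightarrow> ((e \<boxtimes> idt C A) \<cdot> d = inv_arr C (lun C A) \<cdot> idt C A)"
      "(run C A \<cdot> (idt C A \<boxtimes> e) \<cdot> d = idt C A) \<longleftrightarrow> ((idt C A \<boxtimes> e) \<cdot> d = inv_arr C (run C A) \<cdot> idt C A)"
      by (auto simp: iso_cmp_eq_iff simp del: cmp_idt_simps)
    then show ?thesis
      using True by (simp add: algebras_def coalgebras_def)
  qed (auto simp: algebras_def coalgebras_def)
  then show ?thesis
    by auto
qed

lemma coalgebras_op: "coalgebras (op_cat C) = algebras C"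
proof -
  have r: "x \<cdot> inv_arr C a = y \<longleftrightarrow> x = y \<cdot> a"
    if "iso_arr C a" "x \<in> arr C" "y \<in> arr C" "src C x = src C a" "src C y = tgt C a" for a x y
    using that iso_arr_arr by auto
  have "(A, m, u) \<in> coalgebras (op_cat C) \<longleftrightarrow> (A, m, u) \<in> algebras C" for A m u
  proof (cases "A \<in> ob C \<and> m \<in> hom C (A \<otimes> A) A \<and> u \<in> hom C (unt C) A")
    case True
    then have "((m \<cdot> (m \<boxtimes> idt C A)) \<cdot> ainv A A A = m \<cdot> (idt C A \<boxtimes> m))
        \<longleftrightarrow> (m \<cdot> (m \<boxtimes> idt C A) = (m \<cdot> (idt C A \<boxtimes> m)) \<cdot> assc C A A A)"
      "((m \<cdot> (u \<boxtimes> idt C A)) \<cdot> inv_arr C (lun C A) = idt C A) \<longleftrightarrow> (m \<cdot> (u \<boxtimes> idt C A) = idt C A \<cdot> lun C A)"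
      "((m \<cdot> (idt C A \<boxtimes> u)) \<cdot> inv_arr C (run C A) = idt C A) \<longleftrightarrow> (m \<cdot> (idt C A \<boxtimes> u) = idt C A \<cdot> run C A)"
      by - (rule r; simp)+
    then show ?thesis
      using True by (simp add: algebras_def coalgebras_def)
  qed (auto simp: algebras_def coalgebras_def)
  then show ?thesis
    by auto
qed

end

section \<open>Functors and adjunctions induced on categories of algebras\<close>

context lax_monoidal_functor
begin

lemma lax2_simps [simp]:
  assumes "X \<in> ob A" "Y \<in> ob A"
  shows "lax2 F X Y \<in> arr B" "src B (lax2 F X Y) = fob F X \<otimes>\<^bsub>B\<^esub> fob F Y"
    "tgt B (lax2 F X Y) = fob F (X \<otimes>\<^bsub>A\<^esub> Y)"
  using lax2_hom [OF assms] by auto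

lemma lax0_simps [simp]:
  "lax0 F \<in> arr B" "src B (lax0 F) = unt B" "tgt B (lax0 F) = fob F (unt A)"
  using lax0_hom by auto

lemma lax2_natural_cmp:
  assumes "f \<in> hom A X X'" "g \<in> hom A Y Y'" "x \<in> hom B W (fob F X \<otimes>\<^bsub>B\<^esub> fob F Y)"
  shows "lax2 F X' Y' \<cdot>\<^bsub>B\<^esub> (far F f \<boxtimes>\<^bsub>B\<^esub> far F g) \<cdot>\<^bsub>B\<^esub> x = far F (f \<boxtimes>\<^bsub>A\<^esub> g) \<cdot>\<^bsub>B\<^esub> lax2 F X Y \<cdot>\<^bsub>B\<^esub> x"
proof -
  have "X \<in> ob A" "X' \<in> ob A" "Y \<in> ob A" "Y' \<in> ob A"
    using assms by auto
  then show ?thesis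
    using assms B.cmp_extend [OF lax2_natural [OF assms(1,2)], of x] by simp
qed

lemma Alg_ob_algebra:
  assumes "X \<in> algebras A"
  shows "Alg_ob B F X \<in> algebras B"
proof -
  obtain Z m u where X: "X = (Z, m, u)"
    by (cases X)
  have [simp]: "Z \<in> ob A" "m \<in> arr A" "src A m = Z \<otimes>\<^bsub>A\<^esub> Z" "tgt A m = Z"
    "u \<in> arr A" "src A u = unt A" "tgt A u = Z"
    and assoc: "m \<cdot>\<^bsub>A\<^esub> (m \<boxtimes>\<^bsub>A\<^esub> idt A Z) = m \<cdot>\<^bsub>A\<^esub> (idt A Z \<boxtimes>\<^bsub>A\<^esub> m) \<cdot>\<^bsub>A\<^esub> assc A Z Z Z"
    and unit: "m \<cdot>\<^bsub>A\<^esub> (u \<boxtimes>\<^bsub>A\<^esub> idt A Z) = lun A Z" "m \<cdot>\<^bsub>A\<^esub> (idt A Z \<boxtimes>\<^bsub>A\<^esub> u) = run A Z"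
    using assms by (auto simp: X algebras_def)
  let ?Z = "fob F Z" and ?p = "lax2 F Z Z"
  \<comment> \<open>The identity of \<open>?Z\<close> is written as the image of an identity so that
    naturality of \<open>lax2\<close> applies. The two unit laws use the same device.\<close>
  have "(far F m \<cdot>\<^bsub>B\<^esub> ?p) \<cdot>\<^bsub>B\<^esub> ((far F m \<cdot>\<^bsub>B\<^esub> ?p) \<boxtimes>\<^bsub>B\<^esub> idt B ?Z)
    = far F m \<cdot>\<^bsub>B\<^esub> ?p \<cdot>\<^bsub>B\<^esub> (far F m \<boxtimes>\<^bsub>B\<^esub> far F (idt A Z)) \<cdot>\<^bsub>B\<^esub> (?p \<boxtimes>\<^bsub>B\<^esub> idt B ?Z)"
    by (simp add: far_idt)
  also have "\<dots> = far F m \<cdot>\<^bsub>B\<^esub> far F (m \<boxtimes>\<^bsub>A\<^esub> idt A Z) \<cdot>\<^bsub>B\<^esub> lax2 F (Z \<otimes>\<^bsub>A\<^esub> Z) Z \<cdot>\<^bsub>B\<^esub> (?p \<boxtimes>\<^bsub>B\<^esub> idt B ?Z)"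
    by (subst lax2_natural_cmp [of _ "Z \<otimes>\<^bsub>A\<^esub> Z" _ _ Z]) simp_all
  also have "\<dots> = far F (m \<cdot>\<^bsub>A\<^esub> (m \<boxtimes>\<^bsub>A\<^esub> idt A Z)) \<cdot>\<^bsub>B\<^esub> lax2 F (Z \<otimes>\<^bsub>A\<^esub> Z) Z \<cdot>\<^bsub>B\<^esub> (?p \<boxtimes>\<^bsub>B\<^esub> idt B ?Z)"
    by (simp add: far_cmp_simp)
  also have "\<dots> = far F m \<cdot>\<^bsub>B\<^esub> far F (idt A Z \<boxtimes>\<^bsub>A\<^esub> m) \<cdot>\<^bsub>B\<^esub> far F (assc A Z Z Z) \<cdot>\<^bsub>B\<^esub> lax2 F (Z \<otimes>\<^bsub>A\<^esub> Z) Z \<cdot>\<^bsub>B\<^esub> (?p \<boxtimes>\<^bsub>B\<^esub> idt B ?Z)"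
    unfolding assoc by (simp add: far_cmp_simp)
  also have "\<dots> = far F m \<cdot>\<^bsub>B\<^esub> far F (idt A Z \<boxtimes>\<^bsub>A\<^esub> m) \<cdot>\<^bsub>B\<^esub> lax2 F Z (Z \<otimes>\<^bsub>A\<^esub> Z) \<cdot>\<^bsub>B\<^esub> (idt B ?Z \<boxtimes>\<^bsub>B\<^esub> ?p) \<cdot>\<^bsub>B\<^esub> assc B ?Z ?Z ?Z"
    by (simp add: lax_assc)
  also have "\<dots> = far F m \<cdot>\<^bsub>B\<^esub> ?p \<cdot>\<^bsub>B\<^esub> (far F (idt A Z) \<boxtimes>\<^bsub>B\<^esub> far F m) \<cdot>\<^bsub>B\<^esub> (idt B ?Z \<boxtimes>\<^bsub>B\<^esub> ?p) \<cdot>\<^bsub>B\<^esub> assc B ?Z ?Z ?Z"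
    by (subst lax2_natural_cmp [of _ Z _ _ "Z \<otimes>\<^bsub>A\<^esub> Z"]) simp_all
  also have "\<dots> = (far F m \<cdot>\<^bsub>B\<^esub> ?p) \<cdot>\<^bsub>B\<^esub> (idt B ?Z \<boxtimes>\<^bsub>B\<^esub> (far F m \<cdot>\<^bsub>B\<^esub> ?p)) \<cdot>\<^bsub>B\<^esub> assc B ?Z ?Z ?Z"
    by (simp add: far_idt)
  finally have 1: "(far F m \<cdot>\<^bsub>B\<^esub> ?p) \<cdot>\<^bsub>B\<^esub> ((far F m \<cdot>\<^bsub>B\<^esub> ?p) \<boxtimes>\<^bsub>B\<^esub> idt B ?Z)
    = (far F m \<cdot>\<^bsub>B\<^esub> ?p) \<cdot>\<^bsub>B\<^esub> (idt B ?Z \<boxtimes>\<^bsub>B\<^esub> (far F m \<cdot>\<^bsub>B\<^esub> ?p)) \<cdot>\<^bsub>B\<^esub> assc B ?Z ?Z ?Z" .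
  have "(far F m \<cdot>\<^bsub>B\<^esub> ?p) \<cdot>\<^bsub>B\<^esub> ((far F u \<cdot>\<^bsub>B\<^esub> lax0 F) \<boxtimes>\<^bsub>B\<^esub> idt B ?Z)
    = far F m \<cdot>\<^bsub>B\<^esub> ?p \<cdot>\<^bsub>B\<^esub> (far F u \<boxtimes>\<^bsub>B\<^esub> far F (idt A Z)) \<cdot>\<^bsub>B\<^esub> (lax0 F \<boxtimes>\<^bsub>B\<^esub> idt B ?Z)"
    by (simp add: far_idt)
  also have "\<dots> = far F m \<cdot>\<^bsub>B\<^esub> far F (u \<boxtimes>\<^bsub>A\<^esub> idt A Z) \<cdot>\<^bsub>B\<^esub> lax2 F (unt A) Z \<cdot>\<^bsub>B\<^esub> (lax0 F \<boxtimes>\<^bsub>B\<^esub> idt B ?Z)"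
    by (subst lax2_natural_cmp [of _ "unt A" _ _ Z]) simp_all
  also have "\<dots> = far F (m \<cdot>\<^bsub>A\<^esub> (u \<boxtimes>\<^bsub>A\<^esub> idt A Z)) \<cdot>\<^bsub>B\<^esub> lax2 F (unt A) Z \<cdot>\<^bsub>B\<^esub> (lax0 F \<boxtimes>\<^bsub>B\<^esub> idt B ?Z)"
    by (simp add: far_cmp_simp)
  finally have 2: "(far F m \<cdot>\<^bsub>B\<^esub> ?p) \<cdot>\<^bsub>B\<^esub> ((far F u \<cdot>\<^bsub>B\<^esub> lax0 F) \<boxtimes>\<^bsub>B\<^esub> idt B ?Z) = lun B ?Z"
    unfolding unit by (simp add: lax_lun)
  have "(far F m \<cdot>\<^bsub>B\<^esub> ?p) \<cdot>\<^bsub>B\<^esub> (idt B ?Z \<boxtimes>\<^bsub>B\<^esub> (far F u \<cdot>\<^bsub>B\<^esub> lax0 F))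
    = far F m \<cdot>\<^bsub>B\<^esub> ?p \<cdot>\<^bsub>B\<^esub> (far F (idt A Z) \<boxtimes>\<^bsub>B\<^esub> far F u) \<cdot>\<^bsub>B\<^esub> (idt B ?Z \<boxtimes>\<^bsub>B\<^esub> lax0 F)"
    by (simp add: far_idt)
  also have "\<dots> = far F m \<cdot>\<^bsub>B\<^esub> far F (idt A Z \<boxtimes>\<^bsub>A\<^esub> u) \<cdot>\<^bsub>B\<^esub> lax2 F Z (unt A) \<cdot>\<^bsub>B\<^esub> (idt B ?Z \<boxtimes>\<^bsub>B\<^esub> lax0 F)"
    by (subst lax2_natural_cmp [of _ Z _ _ "unt A"]) simp_all
  also have "\<dots> = far F (m \<cdot>\<^bsub>A\<^esub> (idt A Z \<boxtimes>\<^bsub>A\<^esub> u)) \<cdot>\<^bsub>B\<^esub> lax2 F Z (unt A) \<cdot>\<^bsub>B\<^esub> (idt B ?Z \<boxtimes>\<^bsub>B\<^esub> lax0 F)"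
    by (simp add: far_cmp_simp)
  finally have 3: "(far F m \<cdot>\<^bsub>B\<^esub> ?p) \<cdot>\<^bsub>B\<^esub> (idt B ?Z \<boxtimes>\<^bsub>B\<^esub> (far F u \<cdot>\<^bsub>B\<^esub> lax0 F)) = run B ?Z"
    unfolding unit by (simp add: lax_run)
  show ?thesis
    unfolding X Alg_ob_def algebras_def using 1 2 3 by simp
qed

lemma Alg_ob_morphism:
  assumes "X \<in> algebras A" "Y \<in> algebras A" "algebra_morphism A X f Y"
  shows "algebra_morphism B (Alg_ob B F X) (far F f) (Alg_ob B F Y)"
proof -
  obtain Z m u W m' u' where e: "X = (Z, m, u)" "Y = (W, m', u')"
    by (cases X, cases Y)
  have [simp]: "Z \<in> ob A" "m \<in> arr A" "src A m = Z \<otimes>\<^bsub>A\<^esub> Z" "tgt A m = Z"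
    "u \<in> arr A" "src A u = unt A" "tgt A u = Z"
    "W \<in> ob A" "m' \<in> arr A" "src A m' = W \<otimes>\<^bsub>A\<^esub> W" "tgt A m' = W"
    "u' \<in> arr A" "src A u' = unt A" "tgt A u' = W"
    using assms by (auto simp: e algebras_def)
  have f [simp]: "f \<in> arr A" "src A f = Z" "tgt A f = W" and
    fm: "f \<cdot>\<^bsub>A\<^esub> m = m' \<cdot>\<^bsub>A\<^esub> (f \<boxtimes>\<^bsub>A\<^esub> f)" and fu: "f \<cdot>\<^bsub>A\<^esub> u = u'"
    using assms(3) by (auto simp: e algebra_morphism_def)
  have "far F f \<cdot>\<^bsub>B\<^esub> far F m \<cdot>\<^bsub>B\<^esub> lax2 F Z Z = far F (f \<cdot>\<^bsub>A\<^esub> m) \<cdot>\<^bsub>B\<^esub> lax2 F Z Z"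
    by (simp add: far_cmp_simp)
  also have "\<dots> = far F m' \<cdot>\<^bsub>B\<^esub> lax2 F W W \<cdot>\<^bsub>B\<^esub> (far F f \<boxtimes>\<^bsub>B\<^esub> far F f)"
    unfolding fm by (simp add: far_cmp_simp lax2_natural [of f Z W f Z W])
  finally have "far F f \<cdot>\<^bsub>B\<^esub> far F m \<cdot>\<^bsub>B\<^esub> lax2 F Z Z = (far F m' \<cdot>\<^bsub>B\<^esub> lax2 F W W) \<cdot>\<^bsub>B\<^esub> (far F f \<boxtimes>\<^bsub>B\<^esub> far F f)"
    by simp
  moreover have "far F f \<cdot>\<^bsub>B\<^esub> far F u \<cdot>\<^bsub>B\<^esub> lax0 F = far F u' \<cdot>\<^bsub>B\<^esub> lax0 F"
    using B.cmp_extend [OF far_cmp_simp [of u f, symmetric], of "lax0 F"] by (simp add: fu)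
  ultimately show ?thesis
    by (simp add: e Alg_ob_def algebra_morphism_def)
qed

lemma Alg_functor_simps [simp]:
  "fob (Alg_functor B F) = Alg_ob B F"
  "far (Alg_functor B F) (X, f, Y) = (Alg_ob B F X, far F f, Alg_ob B F Y)"
  by (simp_all add: Alg_functor_def)

lemma fst_Alg_ob [simp]: "fst (Alg_ob B F X) = fob F (fst X)"
  by (simp add: Alg_ob_def split: prod.splits)

lemma cat_functor_Alg: "cat_functor (Alg A) (Alg B) (Alg_functor B F)"
proof -
  interpret AA: category "Alg A"
    by (rule A.category_Alg)
  interpret BB: category "Alg B"
    by (rule B.category_Alg)
  show ?thesis
  proof
    show "fob (Alg_functor B F) X \<in> ob (Alg B)" if "X \<in> ob (Alg A)" for X
      using that by (simp add: Alg_ob_algebra)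
    show "far (Alg_functor B F) f \<in> hom (Alg B) (fob (Alg_functor B F) X) (fob (Alg_functor B F) Y)"
      if "f \<in> hom (Alg A) X Y" for f X Y
      using that unfolding hom_Alg_iff by (auto simp: Alg_ob_algebra Alg_ob_morphism)
    show "far (Alg_functor B F) (idt (Alg A) X) = idt (Alg B) (fob (Alg_functor B F) X)"
      if "X \<in> ob (Alg A)" for X
      using that by (simp add: far_idt)
    show "far (Alg_functor B F) (g \<cdot>\<^bsub>Alg A\<^esub> f) = far (Alg_functor B F) g \<cdot>\<^bsub>Alg B\<^esub> far (Alg_functor B F) f"
      if fg: "f \<in> hom (Alg A) X Y" "g \<in> hom (Alg A) Y Z" for f g X Y Z
    proof -
      obtain f' g' where *: "f = (X, f', Y)" "g = (Y, g', Z)" "algebra_morphism A X f' Y" "algebra_morphism A Y g' Z"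
        using fg unfolding hom_Alg_iff by blast
      have "f' \<in> hom A (fst X) (fst Y)" "g' \<in> hom A (fst Y) (fst Z)"
        using algebra_morphism_hom [OF *(3)] algebra_morphism_hom [OF *(4)] by simp_all
      then show ?thesis
        using * by (simp add: far_cmp_simp)
    qed
  qed
qed

end

text \<open>Monoidality of \<eta> and \<epsilon>, with naturality at multiplication and unit, makes
  their components at algebras algebra morphisms. The universal arrow of the underlying adjunction
  therefore lifts, and uniqueness is inherited because an algebra morphism is determined by its
  underlying arrow.\<close>

lemma (in monoidal_adjunction) has_left_adjoint_Alg:
  "has_left_adjoint (Alg A) (Alg B) (Alg_functor B F)"
proof -
  interpret AF: cat_functor "Alg A" "Alg B" "Alg_functor B F"
    by (rule F.cat_functor_Alg)
  have unit_hom: "\<eta> X \<in> hom B X (fob F (fob E X))" if "X \<in> ob B" for X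
    using unit.component_hom [OF that] by (simp add: id_lax_functor_def comp_lax_functor_def)
  have counit_hom: "\<epsilon> Y \<in> hom A (fob E (fob F Y)) Y" if "Y \<in> ob A" for Y
    using counit.component_hom [OF that] by (simp add: id_lax_functor_def comp_lax_functor_def)
  note [simp] = unit_hom [simplified] counit_hom [simplified]
  have unit_morphism: "algebra_morphism B X (\<eta> (fst X)) (Alg_ob B F (Alg_ob A E X))" if alg: "X \<in> algebras B" for X
  proof -
    obtain Z m u where X: "X = (Z, m, u)"
      by (cases X)
    have h: "m \<in> hom B (Z \<otimes>\<^bsub>B\<^esub> Z) Z" "u \<in> hom B (unt B) Z"
      and Z [simp]: "Z \<in> ob B" "m \<in> arr B" "src B m = Z \<otimes>\<^bsub>B\<^esub> Z" "tgt B m = Z" "u \<in> arr B" "src B u = unt B" "tgt B u = Z"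
      using alg by (auto simp: X algebras_def)
    have n: "\<eta> Z \<cdot>\<^bsub>B\<^esub> m = far F (far E m) \<cdot>\<^bsub>B\<^esub> \<eta> (Z \<otimes>\<^bsub>B\<^esub> Z)" "\<eta> Z \<cdot>\<^bsub>B\<^esub> u = far F (far E u) \<cdot>\<^bsub>B\<^esub> \<eta> (unt B)"
      using unit.naturality [OF h(1)] unit.naturality [OF h(2)]
      by (simp_all add: id_lax_functor_def comp_lax_functor_def)
    have "\<eta> (Z \<otimes>\<^bsub>B\<^esub> Z) = (far F (lax2 E Z Z) \<cdot>\<^bsub>B\<^esub> lax2 F (fob E Z) (fob E Z)) \<cdot>\<^bsub>B\<^esub> (\<eta> Z \<boxtimes>\<^bsub>B\<^esub> \<eta> Z)"
      using unit.monoidal2 [of Z Z] by (simp add: id_lax_functor_def comp_lax_functor_def)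
    moreover have "\<eta> (unt B) = far F (lax0 E) \<cdot>\<^bsub>B\<^esub> lax0 F"
      using unit.monoidal0 by (simp add: id_lax_functor_def comp_lax_functor_def)
    ultimately show ?thesis
      by (simp add: X Alg_ob_def algebra_morphism_def F.far_cmp_simp n)
  qed
  have counit_morphism: "algebra_morphism A (Alg_ob A E (Alg_ob B F Y)) (\<epsilon> (fst Y)) Y" if alg: "Y \<in> algebras A" for Y
  proof -
    obtain Z m u where Y: "Y = (Z, m, u)"
      by (cases Y)
    have h: "m \<in> hom A (Z \<otimes>\<^bsub>A\<^esub> Z) Z" "u \<in> hom A (unt A) Z"
      and Z [simp]: "Z \<in> ob A" "m \<in> arr A" "src A m = Z \<otimes>\<^bsub>A\<^esub> Z" "tgt A m = Z" "u \<in> arr A" "src A u = unt A" "tgt A u = Z"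
      using alg by (auto simp: Y algebras_def)
    have n: "\<epsilon> Z \<cdot>\<^bsub>A\<^esub> far E (far F m) = m \<cdot>\<^bsub>A\<^esub> \<epsilon> (Z \<otimes>\<^bsub>A\<^esub> Z)" "\<epsilon> Z \<cdot>\<^bsub>A\<^esub> far E (far F u) = u \<cdot>\<^bsub>A\<^esub> \<epsilon> (unt A)"
      using counit.naturality [OF h(1)] counit.naturality [OF h(2)]
      by (simp_all add: id_lax_functor_def comp_lax_functor_def)
    have c: "\<epsilon> (Z \<otimes>\<^bsub>A\<^esub> Z) \<cdot>\<^bsub>A\<^esub> (far E (lax2 F Z Z) \<cdot>\<^bsub>A\<^esub> lax2 E (fob F Z) (fob F Z)) = \<epsilon> Z \<boxtimes>\<^bsub>A\<^esub> \<epsilon> Z"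
      using counit.monoidal2 [of Z Z] by (simp add: id_lax_functor_def comp_lax_functor_def)
    have c0: "\<epsilon> (unt A) \<cdot>\<^bsub>A\<^esub> (far E (lax0 F) \<cdot>\<^bsub>A\<^esub> lax0 E) = idt A (unt A)"
      using counit.monoidal0 by (simp add: id_lax_functor_def comp_lax_functor_def)
    have "\<epsilon> Z \<cdot>\<^bsub>A\<^esub> far E (far F m \<cdot>\<^bsub>B\<^esub> lax2 F Z Z) \<cdot>\<^bsub>A\<^esub> lax2 E (fob F Z) (fob F Z) = m \<cdot>\<^bsub>A\<^esub> (\<epsilon> Z \<boxtimes>\<^bsub>A\<^esub> \<epsilon> Z)"
      unfolding c [symmetric] using E.B.cmp_extend [OF n(1), of "far E (lax2 F Z Z) \<cdot>\<^bsub>A\<^esub> lax2 E (fob F Z) (fob F Z)"]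
      by (simp add: E.far_cmp_simp)
    moreover have "\<epsilon> Z \<cdot>\<^bsub>A\<^esub> far E (far F u \<cdot>\<^bsub>B\<^esub> lax0 F) \<cdot>\<^bsub>A\<^esub> lax0 E = u"
      using c0 E.B.cmp_extend [OF n(2), of "far E (lax0 F) \<cdot>\<^bsub>A\<^esub> lax0 E"]
      by (simp add: E.far_cmp_simp)
    ultimately show ?thesis
      by (simp add: Y Alg_ob_def algebra_morphism_def)
  qed
  show ?thesis
  proof (rule AF.has_left_adjointI)
    fix X
    assume "X \<in> ob (Alg B)"
    then have X: "X \<in> algebras B"
      by simp
    let ?U = "Alg_ob A E X"
    let ?h = "(X, \<eta> (fst X), Alg_ob B F ?U)"
    have U: "?U \<in> algebras A"
      using X by (rule E.Alg_ob_algebra)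
    have univ: "universal_arrow A B F (fst X) (fob E (fst X)) (\<eta> (fst X))"
      using X by (simp add: universal_arrow_unit)
    have "\<exists>!g. g \<in> hom (Alg A) ?U Y \<and> far (Alg_functor B F) g \<cdot>\<^bsub>Alg B\<^esub> ?h = f"
      if Y: "Y \<in> algebras A" and f: "f \<in> hom (Alg B) X (Alg_ob B F Y)" for Y f
    proof -
      obtain f' where f': "f = (X, f', Alg_ob B F Y)" "algebra_morphism B X f' (Alg_ob B F Y)"
        using f unfolding hom_Alg_iff by blast
      have hf' [simp]: "f' \<in> arr B" "src B f' = fst X" "tgt B f' = fob F (fst Y)"
        using algebra_morphism_hom [OF f'(2)] by simp_all
      \<comment> \<open>The transpose of \<open>f'\<close>. It is an algebra morphism, being the
        image of \<open>f'\<close> under E followed by the counit.\<close>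
      let ?g = "\<epsilon> (fst Y) \<cdot>\<^bsub>A\<^esub> far E f'"
      have g: "algebra_morphism A ?U ?g Y"
        using E.Alg_ob_morphism [OF X F.Alg_ob_algebra [OF Y] f'(2)]
        by (rule E.B.algebra_morphism_cmp [OF U E.Alg_ob_algebra [OF F.Alg_ob_algebra [OF Y]] Y _ counit_morphism [OF Y]])
      have nat: "\<eta> (fob F (fst Y)) \<cdot>\<^bsub>B\<^esub> f' = far F (far E f') \<cdot>\<^bsub>B\<^esub> \<eta> (fst X)"
        using unit.naturality [of f' "fst X" "fob F (fst Y)"] by (simp add: id_lax_functor_def comp_lax_functor_def)
      have "far F ?g \<cdot>\<^bsub>B\<^esub> \<eta> (fst X) = far F (\<epsilon> (fst Y)) \<cdot>\<^bsub>B\<^esub> (far F (far E f') \<cdot>\<^bsub>B\<^esub> \<eta> (fst X))"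
        using X Y by (simp add: F.far_cmp_simp)
      also have "\<dots> = (far F (\<epsilon> (fst Y)) \<cdot>\<^bsub>B\<^esub> \<eta> (fob F (fst Y))) \<cdot>\<^bsub>B\<^esub> f'"
        unfolding nat [symmetric] using X Y by simp
      also have "\<dots> = f'"
        using triangle_right [of "fst Y"] Y by simp
      finally have gf: "far F ?g \<cdot>\<^bsub>B\<^esub> \<eta> (fst X) = f'" .
      show ?thesis
      proof (rule ex1I [of _ "(?U, ?g, Y)"])
        show "(?U, ?g, Y) \<in> hom (Alg A) ?U Y \<and> far (Alg_functor B F) (?U, ?g, Y) \<cdot>\<^bsub>Alg B\<^esub> ?h = f"
          using g U Y gf by (simp add: hom_Alg_iff f'(1) del: hom_def)
        fix k
        assume k: "k \<in> hom (Alg A) ?U Y \<and> far (Alg_functor B F) k \<cdot>\<^bsub>Alg B\<^esub> ?h = f"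
        then obtain k' where k': "k = (?U, k', Y)" "algebra_morphism A ?U k' Y"
          unfolding hom_Alg_iff by blast
        then have "k' \<in> hom A (fob E (fst X)) (fst Y)"
          using algebra_morphism_hom [OF k'(2)] by simp
        moreover have "?g \<in> hom A (fob E (fst X)) (fst Y)"
          using algebra_morphism_hom [OF g] by simp
        moreover have "far F k' \<cdot>\<^bsub>B\<^esub> \<eta> (fst X) = f'"
          using k by (simp add: k'(1) f'(1))
        ultimately have "k' = ?g"
          using gf F.universal_arrow_eqI [OF univ] by metis
        then show "k = (?U, ?g, Y)"
          by (simp add: k'(1))
      qed
    qed
    moreover have "?h \<in> hom (Alg B) X (Alg_ob B F ?U)"
      using X U unit_morphism [OF X] by (simp add: hom_Alg_iff F.Alg_ob_algebra del: hom_def)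
    ultimately have "universal_arrow (Alg A) (Alg B) (Alg_functor B F) X ?U ?h"
      using U by (simp add: universal_arrow_def del: hom_def)
    then show "\<exists>U h. universal_arrow (Alg A) (Alg B) (Alg_functor B F) X U h"
      by blast
  qed
qed

section \<open>Strict monoidal functors\<close>

text \<open>\<open>op_cat\<close> takes a monoidal category, whereas the categories of coalgebras,
  which also have to be reversed, carry no tensor product here.\<close>

definition opposite :: "('o, 'a, 'z) category_scheme \<Rightarrow> ('o, 'a) category" where
  "opposite C = \<lparr>ob = ob C, arr = arr C, src = tgt C, tgt = src C, idt = idt C, cmp = (\<lambda>g f. f \<cdot>\<^bsub>C\<^esub> g)\<rparr>"

lemma opposite_simps [simp]:
  "ob (opposite C) = ob C" "arr (opposite C) = arr C" "src (opposite C) = tgt C" "tgt (opposite C) = src C"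
  "idt (opposite C) = idt C" "g \<cdot>\<^bsub>opposite C\<^esub> f = f \<cdot>\<^bsub>C\<^esub> g"
  by (simp_all add: opposite_def)

lemma (in category) category_opposite: "category (opposite C)"
  by unfold_locales auto

lemma (in cat_functor) cat_functor_opposite: "cat_functor (opposite A) (opposite B) F"
proof -
  interpret A': category "opposite A" by (rule A.category_opposite)
  interpret B': category "opposite B" by (rule B.category_opposite)
  show ?thesis
    by unfold_locales (auto simp: far_idt far_cmp_simp)
qed

text \<open>Reversing both categories exchanges unit with counit and left with right adjoint, while
  every arrow stays the same.\<close>

lemma adjunction_opposite:
  assumes A: "category A" and B: "category B" and adj: "adjunction (opposite B) (opposite A) F E \<epsilon> \<eta>"
  shows "adjunction A B E F \<eta> \<epsilon>"
proof -
  interpret A: category A by fact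
  interpret B: category B by fact
  interpret adj: adjunction "opposite B" "opposite A" F E \<epsilon> \<eta> by fact
  have E: "cat_functor B A E"
  proof
    show "far E (g \<cdot>\<^bsub>B\<^esub> f) = far E g \<cdot>\<^bsub>A\<^esub> far E f" if "f \<in> hom B X Y" "g \<in> hom B Y Z" for f g X Y Z
      using that adj.F.far_cmp [of g Z Y f X] by simp
  qed (use adj.F.fob_ob adj.F.far_simps adj.F.far_idt in simp_all)
  have F: "cat_functor A B F"
  proof
    show "far F (g \<cdot>\<^bsub>A\<^esub> f) = far F g \<cdot>\<^bsub>B\<^esub> far F f" if "f \<in> hom A X Y" "g \<in> hom A Y Z" for f g X Y Z
      using that adj.E.far_cmp [of g Z Y f X] by simp
  qed (use adj.E.fob_ob adj.E.far_simps adj.E.far_idt in simp_all)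
  interpret E: cat_functor B A E by (rule E)
  interpret F: cat_functor A B F by (rule F)
  interpret FE: cat_functor B B "comp_functor F E"
    by (rule cat_functor_comp) unfold_locales
  interpret EF: cat_functor A A "comp_functor E F"
    by (rule cat_functor_comp) unfold_locales
  have u: "\<eta> Y \<cdot>\<^bsub>B\<^esub> far id_functor f = far (comp_functor F E) f \<cdot>\<^bsub>B\<^esub> \<eta> X" if "f \<in> hom B X Y" for f X Y
    using adj.counit.naturality [of f Y X] that by (simp add: id_functor_def comp_functor_def)
  have c: "\<epsilon> Y \<cdot>\<^bsub>A\<^esub> far (comp_functor E F) f = far id_functor f \<cdot>\<^bsub>A\<^esub> \<epsilon> X" if "f \<in> hom A X Y" for f X Y
    using adj.unit.naturality [of f Y X] that by (simp add: id_functor_def comp_functor_def)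
  show ?thesis
  proof
    show "\<eta> X \<in> hom B (fob id_functor X) (fob (comp_functor F E) X)" if "X \<in> ob B" for X
      using adj.counit.component_hom [of X] that by (simp add: id_functor_def comp_functor_def)
    show "\<epsilon> X \<in> hom A (fob (comp_functor E F) X) (fob id_functor X)" if "X \<in> ob A" for X
      using adj.unit.component_hom [of X] that by (simp add: id_functor_def comp_functor_def)
    show "\<epsilon> (fob E X) \<cdot>\<^bsub>A\<^esub> far E (\<eta> X) = idt A (fob E X)" if "X \<in> ob B" for X
      using adj.triangle_right [of X] that by simp
    show "far F (\<epsilon> Y) \<cdot>\<^bsub>B\<^esub> \<eta> (fob F Y) = idt B (fob F Y)" if "Y \<in> ob A" for Y
      using adj.triangle_left [of Y] that by simp
  qed (use u c in \<open>simp_all add: id_functor_def\<close>)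
qed

text \<open>Couniversal arrows are encoded as universal arrows between opposite categories, so the
  construction of adjoints need not be repeated in dual form.\<close>

lemma (in cat_functor) has_right_adjointI:
  assumes "\<And>Y. Y \<in> ob B \<Longrightarrow> \<exists>V k. universal_arrow (opposite A) (opposite B) F Y V k"
  shows "has_right_adjoint A B F"
proof -
  interpret op: cat_functor "opposite A" "opposite B" F
    by (rule cat_functor_opposite)
  have "has_left_adjoint (opposite A) (opposite B) F"
    using assms by (intro op.has_left_adjointI) simp
  then show ?thesis
    using adjunction_opposite [OF B.category_axioms A.category_axioms]
    unfolding has_left_adjoint_def has_right_adjoint_def by blast
qed

lemma (in monoidal_category) iso_Alg:
  assumes X: "X \<in> algebras C" and Y: "Y \<in> algebras C" and f: "algebra_morphism C X f Y" "iso_arr C f"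
  shows "iso_arr (Alg C) (X, f, Y)"
proof -
  obtain A m u B m' u' where e: "X = (A, m, u)" "Y = (B, m', u')"
    by (cases X, cases Y)
  have [simp]: "A \<in> ob C" "m \<in> arr C" "src C m = A \<otimes> A" "tgt C m = A" "u \<in> arr C" "src C u = unt C" "tgt C u = A"
    "B \<in> ob C" "m' \<in> arr C" "src C m' = B \<otimes> B" "tgt C m' = B"
    using X Y by (auto simp: e algebras_def)
  have f' [simp]: "f \<in> arr C" "src C f = A" "tgt C f = B" and fm: "f \<cdot> m = m' \<cdot> (f \<boxtimes> f)" and fu: "f \<cdot> u = u'"
    using f(1) by (auto simp: e algebra_morphism_def)
  have "inv_arr C f \<cdot> m' = inv_arr C f \<cdot> (m' \<cdot> (f \<boxtimes> f)) \<cdot> (inv_arr C f \<boxtimes> inv_arr C f)"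
    using f(2) by simp
  also have "\<dots> = m \<cdot> (inv_arr C f \<boxtimes> inv_arr C f)"
    unfolding fm [symmetric] using f(2) by simp
  finally have "algebra_morphism C Y (inv_arr C f) X"
    using f(2) by (simp add: e algebra_morphism_def flip: fu)
  then have "inverse_arrows (Alg C) (X, f, Y) (Y, inv_arr C f, X)"
    using X Y f by (simp add: inverse_arrows_def Alg_def) (simp add: e)
  then show ?thesis
    unfolding iso_arr_def by blast
qed

lemma (in cat_functor) far_inv:
  assumes "iso_arr A f"
  shows "iso_arr B (far F f)" "far F (inv_arr A f) = inv_arr B (far F f)"
proof -
  have [simp]: "f \<in> arr A"
    using assms by (rule A.iso_arr_arr)
  have "inverse_arrows B (far F f) (far F (inv_arr A f))"
    using assms by (simp add: inverse_arrows_def far_idt flip: far_cmp_simp)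
  then show "iso_arr B (far F f)" "far F (inv_arr A f) = inv_arr B (far F f)"
    by (auto simp: iso_arr_def B.inv_arr_eq)
qed

context strict_monoidal_functor
begin

declare strict_tob [simp] strict_unt [simp] strict_lax2 [simp] strict_lax0 [simp] far_idt [simp]

lemma strict_tar [simp]:
  assumes "f \<in> arr A" "g \<in> arr A"
  shows "far F (f \<boxtimes>\<^bsub>A\<^esub> g) = far F f \<boxtimes>\<^bsub>B\<^esub> far F g"
  using lax2_natural [of f "src A f" "tgt A f" g "src A g" "tgt A g"] assms by simp

lemma strict_assc [simp]:
  assumes "X \<in> ob A" "Y \<in> ob A" "Z \<in> ob A"
  shows "far F (assc A X Y Z) = assc B (fob F X) (fob F Y) (fob F Z)"
  using lax_assc [OF assms] assms far_simps [of "assc A X Y Z"] by simp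

lemma strict_unitors [simp]:
  assumes "X \<in> ob A"
  shows "far F (lun A X) = lun B (fob F X)" "far F (run A X) = run B (fob F X)"
  using lax_lun [OF assms] lax_run [OF assms] assms far_simps [of "lun A X"] far_simps [of "run A X"]
  by simp_all

text \<open>\<open>nest\<close> is built from composition, tensor product and constraints alone, all
  of which a strict functor preserves on the nose.\<close>

lemma strict_nest:
  assumes "e \<in> hom A (P \<otimes>\<^bsub>A\<^esub> X) (unt A)" "f \<in> hom A (Q \<otimes>\<^bsub>A\<^esub> Y) (unt A)"
    and o: "P \<in> ob A" "X \<in> ob A" "Q \<in> ob A" "Y \<in> ob A"
  shows "far F (A.nest P X Q Y e f) = B.nest (fob F P) (fob F X) (fob F Q) (fob F Y) (far F e) (far F f)"
  using assms by (simp add: A.nest_def B.nest_def A.cancel_left_def B.cancel_left_def far_cmp_simp far_inv)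

text \<open>A lax structure cannot in general be reversed, but that of a strict functor consists of
  identities, so the same record is lax monoidal between the opposites.\<close>

lemma lax_monoidal_functor_op: "lax_monoidal_functor (op_cat A) (op_cat B) F"
proof -
  interpret oA: monoidal_category "op_cat A" by (rule A.monoidal_category_op)
  interpret oB: monoidal_category "op_cat B" by (rule B.monoidal_category_op)
  show ?thesis
    by unfold_locales (auto simp: far_cmp_simp far_inv)
qed

end

section \<open>Monoidal adjunctions between strict functors\<close>

locale strict_monoidal_adjunction =
    monoidal_adjunction A B E F \<eta> \<epsilon> + E: strict_monoidal_functor B A E + F: strict_monoidal_functor A B F
  for A :: "('o1, 'a1, 'x) monoidal_category_scheme"
    and B :: "('o2, 'a2, 'y) monoidal_category_scheme"
    and E :: "('o2, 'a2, 'o1, 'a1) lax_functor"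
    and F :: "('o1, 'a1, 'o2, 'a2) lax_functor"
    and \<eta> :: "'o2 \<Rightarrow> 'a2" and \<epsilon> :: "'o1 \<Rightarrow> 'a1"
begin

lemma unit_simps [simp]:
  assumes "X \<in> ob B"
  shows "\<eta> X \<in> arr B" "src B (\<eta> X) = X" "tgt B (\<eta> X) = fob F (fob E X)"
  using unit.component_hom [OF assms] by (simp_all add: id_lax_functor_def comp_lax_functor_def)

lemma counit_simps [simp]:
  assumes "Y \<in> ob A"
  shows "\<epsilon> Y \<in> arr A" "src A (\<epsilon> Y) = fob E (fob F Y)" "tgt A (\<epsilon> Y) = Y"
  using counit.component_hom [OF assms] by (simp_all add: id_lax_functor_def comp_lax_functor_def)

lemma unit_natural: "f \<in> hom B X Y \<Longrightarrow> \<eta> Y \<cdot>\<^bsub>B\<^esub> f = far F (far E f) \<cdot>\<^bsub>B\<^esub> \<eta> X"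
  using unit.naturality [of f X Y] by (simp add: id_lax_functor_def comp_lax_functor_def)

lemma counit_natural: "f \<in> hom A X Y \<Longrightarrow> \<epsilon> Y \<cdot>\<^bsub>A\<^esub> far E (far F f) = f \<cdot>\<^bsub>A\<^esub> \<epsilon> X"
  using counit.naturality [of f X Y] by (simp add: id_lax_functor_def comp_lax_functor_def)

text \<open>For strict functors the structure maps in the monoidality condition are identities, so
  the condition becomes an equation usable as a rewrite rule. The same happens in
  \<open>counit_tob\<close>, \<open>unit_unt\<close> and \<open>counit_unt\<close>.\<close>

lemma unit_tob [simp]:
  assumes "X \<in> ob B" "Y \<in> ob B"
  shows "\<eta> (X \<otimes>\<^bsub>B\<^esub> Y) = \<eta> X \<boxtimes>\<^bsub>B\<^esub> \<eta> Y"
  using unit.monoidal2 [OF assms] assms unit_simps [of "X \<otimes>\<^bsub>B\<^esub> Y"]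
  by (simp add: id_lax_functor_def comp_lax_functor_def)

lemma counit_tob [simp]:
  assumes "X \<in> ob A" "Y \<in> ob A"
  shows "\<epsilon> (X \<otimes>\<^bsub>A\<^esub> Y) = \<epsilon> X \<boxtimes>\<^bsub>A\<^esub> \<epsilon> Y"
  using counit.monoidal2 [OF assms] assms counit_simps [of "X \<otimes>\<^bsub>A\<^esub> Y"]
  by (simp add: id_lax_functor_def comp_lax_functor_def)

lemma unit_unt [simp]: "\<eta> (unt B) = idt B (unt B)"
  using unit.monoidal0 unit_simps [of "unt B"] by (simp add: id_lax_functor_def comp_lax_functor_def)

lemma counit_unt [simp]: "\<epsilon> (unt A) = idt A (unt A)"
  using counit.monoidal0 counit_simps [of "unt A"] by (simp add: id_lax_functor_def comp_lax_functor_def)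

text \<open>Unit and counit change roles; strictness keeps both functors lax monoidal on the
  opposites. This gives the functor that E induces on algebras of the opposite categories, that is
  on coalgebras, a left adjoint in \<open>Alg\<close>.\<close>

lemma monoidal_adjunction_op: "monoidal_adjunction (op_cat B) (op_cat A) F E \<epsilon> \<eta>"
proof -
  interpret oE: lax_monoidal_functor "op_cat B" "op_cat A" E by (rule E.lax_monoidal_functor_op)
  interpret oF: lax_monoidal_functor "op_cat A" "op_cat B" F by (rule F.lax_monoidal_functor_op)
  have u: "\<eta> Y \<cdot>\<^bsub>op_cat B\<^esub> far (comp_functor F E) f = far id_functor f \<cdot>\<^bsub>op_cat B\<^esub> \<eta> X"
    "\<eta> Y \<cdot>\<^bsub>op_cat B\<^esub> far (comp_lax_functor (op_cat B) (op_cat B) F E) f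
      = far (id_lax_functor (op_cat B)) f \<cdot>\<^bsub>op_cat B\<^esub> \<eta> X" if "f \<in> hom (op_cat B) X Y" for f X Y
    using unit_natural [of f Y X] that
    by (simp_all add: id_functor_def comp_functor_def id_lax_functor_def comp_lax_functor_def)
  have c: "\<epsilon> Y \<cdot>\<^bsub>op_cat A\<^esub> far id_functor f = far (comp_functor E F) f \<cdot>\<^bsub>op_cat A\<^esub> \<epsilon> X"
    "\<epsilon> Y \<cdot>\<^bsub>op_cat A\<^esub> far (id_lax_functor (op_cat A)) f
      = far (comp_lax_functor (op_cat A) (op_cat A) E F) f \<cdot>\<^bsub>op_cat A\<^esub> \<epsilon> X" if "f \<in> hom (op_cat A) X Y" for f X Y
    using counit_natural [of f Y X] that
    by (simp_all add: id_functor_def comp_functor_def id_lax_functor_def comp_lax_functor_def)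
  have t: "\<eta> (fob F X) \<cdot>\<^bsub>op_cat B\<^esub> far F (\<epsilon> X) = idt (op_cat B) (fob F X)" if "X \<in> ob (op_cat A)" for X
    using triangle_right [of X] that by simp
  have t': "far E (\<eta> Y) \<cdot>\<^bsub>op_cat A\<^esub> \<epsilon> (fob E Y) = idt (op_cat A) (fob E Y)" if "Y \<in> ob (op_cat B)" for Y
    using triangle_left [of Y] that by simp
  show ?thesis
    by unfold_locales (assumption | rule u c t t' | simp add: id_functor_def comp_functor_def
        id_lax_functor_def comp_lax_functor_def E.far_cmp_simp F.far_cmp_simp E.far_inv F.far_inv)+
qed

end

section \<open>Twisting coalgebras by the double braiding\<close>

context braided_monoidal_category
begin

text \<open>Yang-Baxter for inverse crossings. Instead of inverting factor by factor, both sides are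
  composed with the isomorphism \<open>?u \<cdot> ainv X Y Z\<close>; each then collapses to
  \<open>assc C Z Y X\<close>, and the isomorphism cancels.\<close>

lemma yang_baxter_inv:
  assumes o: "X \<in> ob C" "Y \<in> ob C" "Z \<in> ob C"
  shows "assc C X Y Z \<cdot> (inv_arr C (braid C X Y) \<boxtimes> idt C Z) \<cdot> inv_arr C (braid C (Y \<otimes> X) Z) \<cdot> assc C Z Y X
    = (idt C X \<boxtimes> inv_arr C (braid C Y Z)) \<cdot> inv_arr C (braid C X (Z \<otimes> Y))"
proof -
  let ?f = "(idt C X \<boxtimes> inv_arr C (braid C Y Z)) \<cdot> inv_arr C (braid C X (Z \<otimes> Y))"
  let ?g = "assc C X Y Z \<cdot> (inv_arr C (braid C X Y) \<boxtimes> idt C Z) \<cdot> inv_arr C (braid C (Y \<otimes> X) Z) \<cdot> assc C Z Y X"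
  let ?u = "(idt C Z \<boxtimes> braid C X Y) \<cdot> braid C (X \<otimes> Y) Z"
  have u: "iso_arr C (?u \<cdot> ainv X Y Z)"
    using o by (intro inv_arr_cmp) (simp_all add: iso_arr_inv_arr)
  have "(?u \<cdot> ainv X Y Z) \<cdot> ?g = (idt C Z \<boxtimes> braid C X Y) \<cdot> (braid C (X \<otimes> Y) Z
      \<cdot> (inv_arr C (braid C X Y) \<boxtimes> idt C Z)) \<cdot> inv_arr C (braid C (Y \<otimes> X) Z) \<cdot> assc C Z Y X"
    using o by simp
  also have "\<dots> = assc C Z Y X"
    using o by (subst braid_natural [where X = "Y \<otimes> X" and Y = Z]) auto
  finally have g: "(?u \<cdot> ainv X Y Z) \<cdot> ?g = assc C Z Y X" .
  have "(?u \<cdot> ainv X Y Z) \<cdot> ?f = assc C Z Y X \<cdot> (braid C Y Z \<boxtimes> idt C X)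
      \<cdot> (braid C X (Y \<otimes> Z) \<cdot> (idt C X \<boxtimes> inv_arr C (braid C Y Z))) \<cdot> inv_arr C (braid C X (Z \<otimes> Y))"
    unfolding yang_baxter [OF o, symmetric] using o by simp
  also have "\<dots> = assc C Z Y X"
    using o by (subst braid_natural [where X = X and Y = "Z \<otimes> Y"]) auto
  finally have "(?u \<cdot> ainv X Y Z) \<cdot> ?g = (?u \<cdot> ainv X Y Z) \<cdot> ?f"
    using g by simp
  then show ?thesis
    by (rule iso_cancel_left [OF u]) (use o in simp_all)
qed

text \<open>The two co-opposite coalgebras, with the braiding and with its inverse. Coassociativity
  combines the original one with Yang-Baxter, and the counit laws are interchanged. Iterating gives
  \<open>twist\<close> and \<open>untwist\<close>.\<close>

lemma co_opposite_coalgebra: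
  assumes "(A, d, e) \<in> coalgebras C"
  shows "(A, braid C A A \<cdot> d, e) \<in> coalgebras C"
    and "(A, inv_arr C (braid C A A) \<cdot> d, e) \<in> coalgebras C"
proof -
  have [simp]: "A \<in> ob C" "d \<in> arr C" "src C d = A" "tgt C d = A \<otimes> A" "e \<in> arr C" "src C e = A" "tgt C e = unt C"
    and coassoc: "assc C A A A \<cdot> (d \<boxtimes> idt C A) \<cdot> d = (idt C A \<boxtimes> d) \<cdot> d"
    and counit: "lun C A \<cdot> (e \<boxtimes> idt C A) \<cdot> d = idt C A" "run C A \<cdot> (idt C A \<boxtimes> e) \<cdot> d = idt C A"
    using assms by (auto simp: coalgebras_def)
  let ?c = "braid C A A" and ?i = "inv_arr C (braid C A A)"
  have nat: "braid C X' Y' \<cdot> (f \<boxtimes> g) \<cdot> d = (g \<boxtimes> f) \<cdot> ?c \<cdot> d" if "f \<in> hom C A X'" "g \<in> hom C A Y'" for f g X' Y'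
  proof -
    have "X' \<in> ob C" "Y' \<in> ob C"
      using that by auto
    then show ?thesis
      using that cmp_extend [OF braid_natural [OF that], of d] by simp
  qed
  have nati: "inv_arr C (braid C X' Y') \<cdot> (g \<boxtimes> f) \<cdot> d = (f \<boxtimes> g) \<cdot> ?i \<cdot> d" if "f \<in> hom C A X'" "g \<in> hom C A Y'" for f g X' Y'
  proof -
    have "X' \<in> ob C" "Y' \<in> ob C"
      using that by auto
    then show ?thesis
      using that cmp_extend [OF inv_braid_natural [OF that], of d] by simp
  qed
  \<comment> \<open>Unit laws for the inverse braiding, obtained by composing
    \<open>lun_braid\<close> and \<open>run_braid\<close> with it.\<close>
  have "(lun C A \<cdot> braid C A (unt C)) \<cdot> inv_arr C (braid C A (unt C)) = lun C A"
    "(run C A \<cdot> braid C (unt C) A) \<cdot> inv_arr C (braid C (unt C) A) = run C A"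
    by simp_all
  then have li: "run C A \<cdot> inv_arr C (braid C A (unt C)) = lun C A" "lun C A \<cdot> inv_arr C (braid C (unt C) A) = run C A"
    unfolding lun_braid [OF \<open>A \<in> ob C\<close>] run_braid [OF \<open>A \<in> ob C\<close>] by blast+
  have "assc C A A A \<cdot> ((?c \<cdot> d) \<boxtimes> idt C A) \<cdot> ?c \<cdot> d = assc C A A A \<cdot> (?c \<boxtimes> idt C A) \<cdot> (d \<boxtimes> idt C A) \<cdot> ?c \<cdot> d"
    by simp
  also have "\<dots> = assc C A A A \<cdot> (?c \<boxtimes> idt C A) \<cdot> braid C A (A \<otimes> A) \<cdot> (idt C A \<boxtimes> d) \<cdot> d"
    by (subst nat [where X' = A and Y' = "A \<otimes> A"]) simp_all
  \<comment> \<open>Coassociativity of \<open>d\<close> is inserted to bring up the left side of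
    \<open>yang_baxter\<close>.\<close>
  also have "\<dots> = (assc C A A A \<cdot> (?c \<boxtimes> idt C A) \<cdot> braid C A (A \<otimes> A) \<cdot> assc C A A A) \<cdot> (d \<boxtimes> idt C A) \<cdot> d"
    unfolding coassoc [symmetric] by simp
  also have "\<dots> = (idt C A \<boxtimes> ?c) \<cdot> braid C (A \<otimes> A) A \<cdot> (d \<boxtimes> idt C A) \<cdot> d"
    by (subst yang_baxter) simp_all
  also have "\<dots> = (idt C A \<boxtimes> (?c \<cdot> d)) \<cdot> ?c \<cdot> d"
    by (subst nat [where X' = "A \<otimes> A" and Y' = A]) simp_all
  finally have 1: "assc C A A A \<cdot> ((?c \<cdot> d) \<boxtimes> idt C A) \<cdot> ?c \<cdot> d = (idt C A \<boxtimes> (?c \<cdot> d)) \<cdot> ?c \<cdot> d" .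
  have 2: "lun C A \<cdot> (e \<boxtimes> idt C A) \<cdot> ?c \<cdot> d = idt C A"
    using counit(2) nat [of "idt C A" A e "unt C"] cmp_extend [OF lun_braid, of A "(idt C A \<boxtimes> e) \<cdot> d"]
    by simp
  have 3: "run C A \<cdot> (idt C A \<boxtimes> e) \<cdot> ?c \<cdot> d = idt C A"
    using counit(1) nat [of e "unt C" "idt C A" A] cmp_extend [OF run_braid, of A "(e \<boxtimes> idt C A) \<cdot> d"]
    by simp
  show "(A, ?c \<cdot> d, e) \<in> coalgebras C"
    using 1 2 3 by (simp add: coalgebras_def)
  have "assc C A A A \<cdot> ((?i \<cdot> d) \<boxtimes> idt C A) \<cdot> ?i \<cdot> d = assc C A A A \<cdot> (?i \<boxtimes> idt C A) \<cdot> (d \<boxtimes> idt C A) \<cdot> ?i \<cdot> d"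
    by simp
  also have "\<dots> = assc C A A A \<cdot> (?i \<boxtimes> idt C A) \<cdot> inv_arr C (braid C (A \<otimes> A) A) \<cdot> (idt C A \<boxtimes> d) \<cdot> d"
    by (subst nati [where X' = "A \<otimes> A" and Y' = A]) simp_all
  also have "\<dots> = (assc C A A A \<cdot> (?i \<boxtimes> idt C A) \<cdot> inv_arr C (braid C (A \<otimes> A) A) \<cdot> assc C A A A) \<cdot> (d \<boxtimes> idt C A) \<cdot> d"
    unfolding coassoc [symmetric] by simp
  also have "\<dots> = (idt C A \<boxtimes> ?i) \<cdot> inv_arr C (braid C A (A \<otimes> A)) \<cdot> (d \<boxtimes> idt C A) \<cdot> d"
    by (subst yang_baxter_inv) simp_all
  also have "\<dots> = (idt C A \<boxtimes> (?i \<cdot> d)) \<cdot> ?i \<cdot> d"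
    by (subst nati [where X' = A and Y' = "A \<otimes> A"]) simp_all
  finally have 4: "assc C A A A \<cdot> ((?i \<cdot> d) \<boxtimes> idt C A) \<cdot> ?i \<cdot> d = (idt C A \<boxtimes> (?i \<cdot> d)) \<cdot> ?i \<cdot> d" .
  have 5: "lun C A \<cdot> (e \<boxtimes> idt C A) \<cdot> ?i \<cdot> d = idt C A"
    using counit(2) nati [of e "unt C" "idt C A" A] cmp_extend [OF li(2), of "(idt C A \<boxtimes> e) \<cdot> d"]
    by simp
  have 6: "run C A \<cdot> (idt C A \<boxtimes> e) \<cdot> ?i \<cdot> d = idt C A"
    using counit(1) nati [of "idt C A" A e "unt C"] cmp_extend [OF li(1), of "(e \<boxtimes> idt C A) \<cdot> d"]
    by simp
  show "(A, ?i \<cdot> d, e) \<in> coalgebras C"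
    using 4 5 6 by (simp add: coalgebras_def)
qed

text \<open>The co-opposite taken twice: precisely the double braiding by which
  \<open>dual_colax2\<close> corrects the lax structure. It leaves coalgebras unchanged when the
  braiding is a symmetry.\<close>

definition twist :: "('o, 'a) structured \<Rightarrow> ('o, 'a) structured" where
  "twist = (\<lambda>(A, d, e). (A, braid C A A \<cdot> braid C A A \<cdot> d, e))"

definition untwist :: "('o, 'a) structured \<Rightarrow> ('o, 'a) structured" where
  "untwist = (\<lambda>(A, d, e). (A, inv_arr C (braid C A A) \<cdot> inv_arr C (braid C A A) \<cdot> d, e))"

lemma fst_twist [simp]: "fst (twist X) = fst X"
  by (simp add: twist_def split: prod.splits)

lemma twist_coalgebra: "X \<in> coalgebras C \<Longrightarrow> twist X \<in> coalgebras C"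
  by (cases X) (auto simp: twist_def intro!: co_opposite_coalgebra)

lemma untwist_coalgebra: "X \<in> coalgebras C \<Longrightarrow> untwist X \<in> coalgebras C"
  by (cases X) (auto simp: untwist_def intro!: co_opposite_coalgebra)

lemma twist_untwist: "X \<in> coalgebras C \<Longrightarrow> twist (untwist X) = X"
  by (cases X) (auto simp: twist_def untwist_def coalgebras_def)

text \<open>By naturality the double braiding comes out in front on both sides of the
  comultiplication law, and being invertible it cancels. So \<open>twist\<close> is fully faithful
  with unchanged underlying arrows; \<open>twist_untwist\<close> adds surjectivity on
  objects.\<close>

lemma coalgebra_morphism_twist:
  assumes "X \<in> coalgebras C" "Y \<in> coalgebras C"
  shows "coalgebra_morphism C (twist X) f (twist Y) \<longleftrightarrow> coalgebra_morphism C X f Y"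
proof -
  obtain A d e B d' e' where e: "X = (A, d, e)" "Y = (B, d', e')"
    by (cases X, cases Y)
  have [simp]: "A \<in> ob C" "d \<in> arr C" "src C d = A" "tgt C d = A \<otimes> A"
    "B \<in> ob C" "d' \<in> arr C" "src C d' = B" "tgt C d' = B \<otimes> B"
    using assms by (auto simp: e coalgebras_def)
  have "(f \<boxtimes> f) \<cdot> braid C A A \<cdot> braid C A A \<cdot> d = (braid C B B \<cdot> braid C B B \<cdot> d') \<cdot> f
      \<longleftrightarrow> (f \<boxtimes> f) \<cdot> d = d' \<cdot> f" if f: "f \<in> hom C A B"
  proof -
    have n: "(f \<boxtimes> f) \<cdot> braid C A A \<cdot> x = braid C B B \<cdot> (f \<boxtimes> f) \<cdot> x" if "x \<in> hom C A (A \<otimes> A)" for x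
      using cmp_extend [OF braid_natural [OF f f], of x] that f by simp
    have i: "iso_arr C (braid C B B \<cdot> braid C B B)"
      by (intro inv_arr_cmp) simp_all
    have "(f \<boxtimes> f) \<cdot> braid C A A \<cdot> braid C A A \<cdot> d = (braid C B B \<cdot> braid C B B) \<cdot> (f \<boxtimes> f) \<cdot> d"
      using f n [of d] n [of "braid C A A \<cdot> d"] by simp
    moreover have "(braid C B B \<cdot> braid C B B \<cdot> d') \<cdot> f = (braid C B B \<cdot> braid C B B) \<cdot> d' \<cdot> f"
      using f by simp
    moreover have "(f \<boxtimes> f) \<cdot> d = d' \<cdot> f"
      if eq: "(braid C B B \<cdot> braid C B B) \<cdot> (f \<boxtimes> f) \<cdot> d = (braid C B B \<cdot> braid C B B) \<cdot> d' \<cdot> f"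
      by (rule iso_cancel_left [OF i eq]) (use f in simp_all)
    ultimately show ?thesis
      by auto
  qed
  then show ?thesis
    by (auto simp: e twist_def coalgebra_morphism_def)
qed

end

section \<open>Uniqueness of duals, and the right adjoint on coalgebras\<close>

context pre_rigid_category
begin

text \<open>Uniqueness of representing objects: the dagger of each evaluation with respect to the
  other gives two arrows, whose composites are identities because they pair like identities.\<close>

lemma comparison_iso:
  assumes "pre_rigid_category C D' ev'" and X: "X \<in> ob C"
  shows "iso_arr C (dagger C D ev (D' X) X (ev' X))"
proof -
  interpret D': pre_rigid_category C D' ev' by fact
  let ?k = "dagger C D ev (D' X) X (ev' X)" and ?l = "dagger C D' ev' (D X) X (ev X)"
  have "ev X \<cdot> ((?k \<cdot> ?l) \<boxtimes> idt C X) = ev' X \<cdot> (?l \<boxtimes> idt C X)"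
    by (rule ev_dagger) (use X in simp_all)
  then have "?k \<cdot> ?l = idt C (D X)"
    using X by (subst dual_eqI [of _ "D X" X]) simp_all
  moreover have "ev' X \<cdot> ((?l \<cdot> ?k) \<boxtimes> idt C X) = ev X \<cdot> (?k \<boxtimes> idt C X)"
    by (rule D'.ev_dagger) (use X in simp_all)
  then have "?l \<cdot> ?k = idt C (D' X)"
    using X by (subst D'.dual_eqI [of _ "D' X" X]) simp_all
  ultimately have "inverse_arrows C ?k ?l"
    using X by (simp add: inverse_arrows_def)
  then show ?thesis
    unfolding iso_arr_def by blast
qed

text \<open>Contravariance of the dual moves the double braiding of \<open>dual_colax2\<close> from
  the structure map into the comultiplication, where it is \<open>twist\<close>. The equality of
  objects is literal.\<close>

lemma Coalg_ob_dual:
  assumes "X \<in> coalgebras C"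
  shows "Coalg_ob (op_cat C) dual_colax X = Alg_ob C (dual_functor C D ev) (twist X)"
proof -
  obtain A d e where X: "X = (A, d, e)"
    by (cases X)
  have A: "A \<in> ob C" and d: "d \<in> hom C A (A \<otimes> A)"
    using assms by (auto simp: X coalgebras_def)
  then have "dual (braid C A A \<cdot> braid C A A \<cdot> d)
    = dual d \<cdot> dual (braid C A A \<cdot> braid C A A)"
    using dual_arr_cmp [OF d, of "braid C A A \<cdot> braid C A A" "A \<otimes> A"] by simp
  moreover have "fob dual_colax = D"
    "far dual_colax = dual"
    by (simp_all add: left_adjoint_colax_def)
  ultimately show ?thesis
    using A d dual_colax2 [OF A A] dual_colax0
    by (simp add: X Coalg_ob_def Alg_ob_def twist_def)
qed

text \<open>By \<open>Coalg_ob_dual\<close> the functor in question is the dual functor on algebras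
  applied after \<open>twist\<close>, read in the opposite direction. A universal arrow for the
  functor on algebras becomes couniversal once its object is untwisted.\<close>

lemma has_right_adjoint_Coalg:
  assumes "has_left_adjoint (Alg (op_cat C)) (Alg C) (Alg_functor C (dual_functor C D ev))"
  shows "has_right_adjoint (Coalg C) (Coalg (op_cat C)) (Coalg_functor (op_cat C)
    dual_colax)"
proof -
  interpret op: monoidal_category "op_cat C"
    by (rule monoidal_category_op)
  interpret dual: lax_monoidal_functor "op_cat C" C "dual_functor C D ev"
    by (rule lax_monoidal_dual_functor)
  let ?E = "dual_colax"
  let ?G = "Coalg_functor (op_cat C) ?E"
  let ?T = "\<lambda>X. Alg_ob C (dual_functor C D ev) (twist X)"
  interpret Coalg: category "Coalg C"
    by (rule category_Coalg)
  interpret opCoalg: category "Coalg (op_cat C)"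
    by (rule op.category_Coalg)
  have G_ob: "fob ?G X = ?T X" if "X \<in> coalgebras C" for X
    using Coalg_ob_dual [OF that] by (simp add: Coalg_functor_def)
  have far_E: "far ?E = dual"
    by (simp add: left_adjoint_colax_def)
  have G_far: "far ?G (X, f, Y) = (?T X, dual f, ?T Y)" if "X \<in> coalgebras C" "Y \<in> coalgebras C" for X f Y
    using Coalg_ob_dual [OF that(1)] Coalg_ob_dual [OF that(2)] far_E by (simp add: Coalg_functor_def)
  have T: "?T X \<in> algebras C" if "X \<in> coalgebras C" for X
    using twist_coalgebra [OF that] by (intro dual.Alg_ob_algebra) (simp add: algebras_op)
  have T_morphism: "algebra_morphism C (?T Y) (dual f) (?T X)"
    if "X \<in> coalgebras C" "Y \<in> coalgebras C" "coalgebra_morphism C X f Y" for X Y f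
    using dual.Alg_ob_morphism [of "twist Y" "twist X" f] that
    by (simp add: algebras_op algebra_morphism_op twist_coalgebra coalgebra_morphism_twist)
  have fst_T [simp]: "fst (?T X) = D (fst X)" for X
    by simp
  have fst_coalgebra: "fst X \<in> ob C" if "X \<in> coalgebras C" for X
    using that by (auto simp: coalgebras_def)
  interpret G: cat_functor "Coalg C" "Coalg (op_cat C)" ?G
  proof
    show "fob ?G X \<in> ob (Coalg (op_cat C))" if "X \<in> ob (Coalg C)" for X
      using that T by (simp add: G_ob coalgebras_op)
    show "far ?G f \<in> hom (Coalg (op_cat C)) (fob ?G X) (fob ?G Y)" if "f \<in> hom (Coalg C) X Y" for f X Y
      using that unfolding hom_Coalg_iff
      by (auto simp: G_ob G_far coalgebras_op T coalgebra_morphism_op T_morphism)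
    show "far ?G (idt (Coalg C) X) = idt (Coalg (op_cat C)) (fob ?G X)" if "X \<in> ob (Coalg C)" for X
      using that by (simp add: G_ob G_far dual_arr_idt fst_coalgebra)
    show "far ?G (g \<cdot>\<^bsub>Coalg C\<^esub> f) = far ?G g \<cdot>\<^bsub>Coalg (op_cat C)\<^esub> far ?G f"
      if fg: "f \<in> hom (Coalg C) X Y" "g \<in> hom (Coalg C) Y Z" for f g X Y Z
    proof -
      obtain f' g' where *: "f = (X, f', Y)" "g = (Y, g', Z)" "coalgebra_morphism C X f' Y" "coalgebra_morphism C Y g' Z"
          "X \<in> coalgebras C" "Y \<in> coalgebras C" "Z \<in> coalgebras C"
        using fg unfolding hom_Coalg_iff by blast
      then show ?thesis
        using dual_arr_cmp [OF coalgebra_morphism_hom [OF *(3)] coalgebra_morphism_hom [OF *(4)]]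
        by (simp add: G_far)
    qed
  qed
  show ?thesis
  proof (rule G.has_right_adjointI)
    fix Y
    assume "Y \<in> ob (Coalg (op_cat C))"
    then have Y: "Y \<in> algebras C"
      by (simp add: coalgebras_op)
    obtain U h where Uh: "universal_arrow (Alg (op_cat C)) (Alg C) (Alg_functor C (dual_functor C D ev)) Y U h"
      using has_left_adjointD [OF assms, of Y] Y by auto
    then have U: "U \<in> coalgebras C" and "h \<in> hom (Alg C) Y (Alg_ob C (dual_functor C D ev) U)"
      and univ: "\<And>W f. \<lbrakk>W \<in> coalgebras C; f \<in> hom (Alg C) Y (Alg_ob C (dual_functor C D ev) W)\<rbrakk>
        \<Longrightarrow> \<exists>!g. g \<in> hom (Alg (op_cat C)) U W \<and> far (Alg_functor C (dual_functor C D ev)) g \<cdot>\<^bsub>Alg C\<^esub> h = f"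
      by (auto simp: universal_arrow_def algebras_op simp del: hom_def)
    then obtain h' where h': "h = (Y, h', Alg_ob C (dual_functor C D ev) U)"
        "algebra_morphism C Y h' (Alg_ob C (dual_functor C D ev) U)"
      unfolding hom_Alg_iff by blast
    \<comment> \<open>Chosen so that the twist inside \<open>?T\<close> returns U, and the arrow
      \<open>h'\<close> can be reused unchanged.\<close>
    let ?V = "untwist U"
    let ?k = "(?T ?V, h', Y)"
    have V: "?V \<in> coalgebras C" and TV: "?T ?V = Alg_ob C (dual_functor C D ev) U"
      using U by (simp_all add: untwist_coalgebra twist_untwist)
    have "\<exists>!g. g \<in> hom (Coalg C) W ?V \<and> ?k \<cdot>\<^bsub>Coalg (op_cat C)\<^esub> far ?G g = f"
      if W: "W \<in> coalgebras C" and f: "f \<in> hom (Coalg (op_cat C)) (?T W) Y" for W f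
    proof -
      obtain f' where f': "f = (?T W, f', Y)" "algebra_morphism C Y f' (?T W)"
        using f unfolding hom_Coalg_iff coalgebra_morphism_op by blast
      have "(Y, f', ?T W) \<in> hom (Alg C) Y (?T W)"
        using Y T [OF W] f'(2) by (simp add: hom_Alg_iff del: hom_def)
      from univ [OF twist_coalgebra [OF W] this]
      obtain g where g: "g \<in> hom (Alg (op_cat C)) U (twist W)"
          "far (Alg_functor C (dual_functor C D ev)) g \<cdot>\<^bsub>Alg C\<^esub> h = (Y, f', ?T W)"
        and g_unique: "\<And>g'. g' \<in> hom (Alg (op_cat C)) U (twist W) \<Longrightarrow>
          far (Alg_functor C (dual_functor C D ev)) g' \<cdot>\<^bsub>Alg C\<^esub> h = (Y, f', ?T W) \<Longrightarrow> g' = g"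
        by metis
      obtain g' where g': "g = (U, g', twist W)" "coalgebra_morphism C (twist W) g' U"
        using g(1) unfolding hom_Alg_iff algebra_morphism_op by blast
      have eq: "dual g' \<cdot> h' = f'"
        using g(2) by (simp add: g' h')
      \<comment> \<open>Morphisms from \<open>twist W\<close> to U and from W to \<open>?V\<close>
        have the same underlying arrows. This carries both existence and uniqueness of the
        factorisation across.\<close>
      have m: "coalgebra_morphism C (twist W) k U \<longleftrightarrow> coalgebra_morphism C W k ?V" for k
        using coalgebra_morphism_twist [OF W V] twist_untwist [OF U] by simp
      show ?thesis
      proof (rule ex1I [of _ "(W, g', ?V)"])
        show "(W, g', ?V) \<in> hom (Coalg C) W ?V \<and> ?k \<cdot>\<^bsub>Coalg (op_cat C)\<^esub> far ?G (W, g', ?V) = f"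
          using W V m g'(2) eq by (simp add: hom_Coalg_iff G_far f' del: hom_def)
        fix l
        assume l: "l \<in> hom (Coalg C) W ?V \<and> ?k \<cdot>\<^bsub>Coalg (op_cat C)\<^esub> far ?G l = f"
        then obtain l' where l': "l = (W, l', ?V)" "coalgebra_morphism C W l' ?V"
          unfolding hom_Coalg_iff by blast
        have "(U, l', twist W) \<in> hom (Alg (op_cat C)) U (twist W)"
          using U twist_coalgebra [OF W] l'(2) m
          by (simp add: hom_Alg_iff algebras_op algebra_morphism_op del: hom_def)
        moreover have "dual l' \<cdot> h' = f'"
          using l W V by (simp add: l'(1) f'(1) G_far)
        ultimately have "(U, l', twist W) = g"
          by (intro g_unique) (simp_all add: h')
        then show "l = (W, g', ?V)"
          by (simp add: l' g')
      qed
    qed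
    moreover have "?k \<in> hom (Coalg (op_cat C)) (?T ?V) Y"
      using Y V T [OF V] h'(2) TV by (simp add: hom_Coalg_iff coalgebras_op coalgebra_morphism_op del: hom_def)
    moreover have op_hom: "hom (opposite K) X Z = hom K Z X" for K :: "('x, 'y, 'w) category_scheme" and X Z
      by auto
    ultimately have "universal_arrow (opposite (Coalg C)) (opposite (Coalg (op_cat C))) ?G Y ?V ?k"
      using V unfolding universal_arrow_def op_hom by (simp add: G_ob del: hom_def)
    then show "\<exists>V k. universal_arrow (opposite (Coalg C)) (opposite (Coalg (op_cat C))) ?G Y V k"
      by blast
  qed
qed

end

section \<open>Transfer of pre-rigidity\<close>

lemma pre_rigid_categoryI:
  "\<lbrakk>braided_monoidal_category C; pre_rigid C D ev\<rbrakk> \<Longrightarrow> pre_rigid_category C D ev"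
  by (simp add: pre_rigid_category_def pre_rigid_category_axioms_def)

lemma (in pre_rigid_category) liftable_dual:
  assumes "has_left_adjoint (Alg (op_cat C)) (Alg C) (Alg_functor C (dual_functor C D ev))"
  shows "liftable_pair (op_cat C) C (dual_functor_op C D ev) (dual_functor C D ev)
    (dual_unit C D ev) (dual_counit C D ev)"
  using assms lax_monoidal_dual_functor adjunction_dual has_right_adjoint_Coalg
  by (simp add: liftable_pair_def)

locale pre_rigid_transfer =
    M: pre_rigid_category M D ev + N: braided_monoidal_category N
  + strict_monoidal_adjunction M N L R \<eta> \<epsilon> + braided: braided_lax_monoidal_functor N M L
  for M :: "('o, 'a) braided_category" and N :: "('p, 'b) braided_category"
    and L :: "('p, 'b, 'o, 'a) lax_functor" and R :: "('o, 'a, 'p, 'b) lax_functor"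
    and \<eta> :: "'p \<Rightarrow> 'b" and \<epsilon> :: "'o \<Rightarrow> 'a"
    and D :: "'o \<Rightarrow> 'o" and ev :: "'o \<Rightarrow> 'a"
begin

abbreviation N_cmp (infixr "\<cdot>\<^sub>N" 55) where
  "g \<cdot>\<^sub>N f \<equiv> g \<cdot>\<^bsub>N\<^esub> f"

abbreviation N_tar (infixr "\<boxtimes>\<^sub>N" 70) where
  "f \<boxtimes>\<^sub>N g \<equiv> f \<boxtimes>\<^bsub>N\<^esub> g"

lemma L_braid:
  assumes "X \<in> ob N" "Y \<in> ob N"
  shows "far L (braid N X Y) = braid M (fob L X) (fob L Y)"
  using braided.preserves_braid [OF assms] assms E.far_simps [of "braid N X Y"] by simp

text \<open>Transposition along the adjunction is injective, because naturality of the unit and a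
  triangle identity recover an arrow from its transpose.\<close>

lemma transpose_eqI:
  assumes f: "f \<in> hom N X (fob R Y)" and g: "g \<in> hom N X (fob R Y)" and Y: "Y \<in> ob M"
    and eq: "\<epsilon> Y \<cdot>\<^bsub>M\<^esub> far L f = \<epsilon> Y \<cdot>\<^bsub>M\<^esub> far L g"
  shows "f = g"
proof -
  have "h = far R (\<epsilon> Y \<cdot>\<^bsub>M\<^esub> far L h) \<cdot>\<^sub>N \<eta> X" if h: "h \<in> hom N X (fob R Y)" for h
  proof -
    have "X \<in> ob N"
      using h by auto
    then have "far R (\<epsilon> Y \<cdot>\<^bsub>M\<^esub> far L h) \<cdot>\<^sub>N \<eta> X = far R (\<epsilon> Y) \<cdot>\<^sub>N (far R (far L h) \<cdot>\<^sub>N \<eta> X)"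
      using h Y by (simp add: F.far_cmp_simp)
    also have "\<dots> = (far R (\<epsilon> Y) \<cdot>\<^sub>N \<eta> (fob R Y)) \<cdot>\<^sub>N h"
      unfolding unit_natural [OF h, symmetric] using h Y by simp
    also have "\<dots> = h"
      using h Y by (simp add: triangle_right)
    finally show ?thesis ..
  qed
  then show ?thesis
    using f g eq by metis
qed

text \<open>The two transposes are compared. The left one is computed by naturality of the counit;
  since the counit is monoidal and L preserves braidings, naturality of the braiding of
  \<open>M\<close> gives the right one.\<close>

lemma R_braid:
  assumes "X \<in> ob M" "Y \<in> ob M"
  shows "far R (braid M X Y) = braid N (fob R X) (fob R Y)"
proof (rule transpose_eqI [where Y = "Y \<otimes>\<^bsub>M\<^esub> X"])
  have "\<epsilon> (Y \<otimes>\<^bsub>M\<^esub> X) \<cdot>\<^bsub>M\<^esub> far L (far R (braid M X Y)) = braid M X Y \<cdot>\<^bsub>M\<^esub> (\<epsilon> X \<boxtimes>\<^bsub>M\<^esub> \<epsilon> Y)"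
    using counit_natural [of "braid M X Y" "X \<otimes>\<^bsub>M\<^esub> Y" "Y \<otimes>\<^bsub>M\<^esub> X"] assms by simp
  also have "\<dots> = (\<epsilon> Y \<boxtimes>\<^bsub>M\<^esub> \<epsilon> X) \<cdot>\<^bsub>M\<^esub> braid M (fob L (fob R X)) (fob L (fob R Y))"
    using assms by (intro M.braid_natural) simp_all
  finally show "\<epsilon> (Y \<otimes>\<^bsub>M\<^esub> X) \<cdot>\<^bsub>M\<^esub> far L (far R (braid M X Y))
    = \<epsilon> (Y \<otimes>\<^bsub>M\<^esub> X) \<cdot>\<^bsub>M\<^esub> far L (braid N (fob R X) (fob R Y))"
    using assms by (simp add: L_braid)
qed (use assms in simp_all)

text \<open>This pairing determines the lax structure of the dual functor, so compatibility of R
  with braidings enters the comparison of duals only through this lemma.\<close>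

lemma R_tensor_pairing:
  assumes "e \<in> hom M (P \<otimes>\<^bsub>M\<^esub> X) (unt M)" "f \<in> hom M (Q \<otimes>\<^bsub>M\<^esub> Y) (unt M)"
    and o: "P \<in> ob M" "X \<in> ob M" "Q \<in> ob M" "Y \<in> ob M"
  shows "far R (M.tensor_pairing P X Q Y e f)
    = N.tensor_pairing (fob R P) (fob R X) (fob R Q) (fob R Y) (far R e) (far R f)"
  using assms F.strict_nest [OF assms]
  by (simp add: M.tensor_pairing_def N.tensor_pairing_def F.far_cmp_simp R_braid)

text \<open>The unit carries X to R(L X), where the image under R of the evaluation of L X can act.
  Strictness of R identifies the tensor product of images with the image of the tensor product, and
  R I with I.\<close>

definition transported_ev :: "'p \<Rightarrow> 'b" where
  "transported_ev X = far R (ev (fob L X)) \<cdot>\<^sub>N (idt N (fob R (D (fob L X))) \<boxtimes>\<^sub>N \<eta> X)"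

lemma transported_ev_simps [simp]:
  assumes "X \<in> ob N"
  shows "transported_ev X \<in> arr N" "src N (transported_ev X) = fob R (D (fob L X)) \<otimes>\<^bsub>N\<^esub> X"
    "tgt N (transported_ev X) = unt N"
  using assms by (simp_all add: transported_ev_def)

lemma transported_ev_far:
  assumes "X \<in> ob N" "w \<in> hom M S (D (fob L X))" "x \<in> hom N Z X"
  shows "transported_ev X \<cdot>\<^sub>N (far R w \<boxtimes>\<^sub>N x)
    = far R (ev (fob L X) \<cdot>\<^bsub>M\<^esub> (w \<boxtimes>\<^bsub>M\<^esub> far L x)) \<cdot>\<^sub>N (idt N (fob R S) \<boxtimes>\<^sub>N \<eta> Z)"
proof -
  have "S \<in> ob M" "Z \<in> ob N"
    using assms by auto
  then show ?thesis
    using assms unit_natural [OF assms(3)] by (simp add: transported_ev_def F.far_cmp_simp)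
qed

text \<open>Each arrow T \<rightarrow> R(D(L X)) has the form R v after the unit. The lemma says
  that pairing it in \<open>N\<close> corresponds, by transposition, to pairing \<open>v\<close> in
  \<open>M\<close>.\<close>

lemma transported_ev_sharp:
  assumes "X \<in> ob N" "T \<in> ob N" "v \<in> hom M (fob L T) (D (fob L X))"
  shows "transported_ev X \<cdot>\<^sub>N ((far R v \<cdot>\<^sub>N \<eta> T) \<boxtimes>\<^sub>N idt N X)
    = far R (ev (fob L X) \<cdot>\<^bsub>M\<^esub> (v \<boxtimes>\<^bsub>M\<^esub> idt M (fob L X))) \<cdot>\<^sub>N \<eta> (T \<otimes>\<^bsub>N\<^esub> X)"
  using assms by (simp add: transported_ev_def F.far_cmp_simp)

text \<open>A composite of three bijections: transposition of arrows T \<rightarrow> R(D(L X)) to L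
  T \<rightarrow> D(L X), pairing with the evaluation of L X, and transposition of arrows L T
  \<otimes> L X \<rightarrow> I back to T \<otimes> X \<rightarrow> I. Strictness of L and R makes
  the last one available, and \<open>transported_ev_sharp\<close> identifies the composite.\<close>

lemma pre_rigid_transported: "pre_rigid N (\<lambda>X. fob R (D (fob L X))) transported_ev"
proof -
  have "bij_betw (\<lambda>u. transported_ev X \<cdot>\<^sub>N (u \<boxtimes>\<^sub>N idt N X)) (hom N T (fob R (D (fob L X)))) (hom N (T \<otimes>\<^bsub>N\<^esub> X) (unt N))"
    if o: "X \<in> ob N" "T \<in> ob N" for X T
  proof (rule bij_betw_imageI)
    let ?DX = "D (fob L X)" and ?LX = "fob L X" and ?LT = "fob L T"
    have univ: "universal_arrow M N R Z (fob L Z) (\<eta> Z)" if "Z \<in> ob N" for Z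
      using that by (rule universal_arrow_unit)
    have lift: "\<exists>v. v \<in> hom M (fob L Z) Y \<and> far R v \<cdot>\<^sub>N \<eta> Z = u"
      if "Z \<in> ob N" "Y \<in> ob M" "u \<in> hom N Z (fob R Y)" for Z Y u
      using univ [OF that(1)] that unfolding universal_arrow_def by blast
    show "inj_on (\<lambda>u. transported_ev X \<cdot>\<^sub>N (u \<boxtimes>\<^sub>N idt N X)) (hom N T (fob R ?DX))"
    proof (rule inj_onI)
      fix u u'
      assume u: "u \<in> hom N T (fob R ?DX)" "u' \<in> hom N T (fob R ?DX)"
        and eq: "transported_ev X \<cdot>\<^sub>N (u \<boxtimes>\<^sub>N idt N X) = transported_ev X \<cdot>\<^sub>N (u' \<boxtimes>\<^sub>N idt N X)"
      have DX: "?DX \<in> ob M"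
        using o by simp
      obtain v v' where v: "v \<in> hom M ?LT ?DX" "far R v \<cdot>\<^sub>N \<eta> T = u"
        and v': "v' \<in> hom M ?LT ?DX" "far R v' \<cdot>\<^sub>N \<eta> T = u'"
        using lift [OF o(2) DX u(1)] lift [OF o(2) DX u(2)] by blast
      have "far R (ev ?LX \<cdot>\<^bsub>M\<^esub> (v \<boxtimes>\<^bsub>M\<^esub> idt M ?LX)) \<cdot>\<^sub>N \<eta> (T \<otimes>\<^bsub>N\<^esub> X)
          = far R (ev ?LX \<cdot>\<^bsub>M\<^esub> (v' \<boxtimes>\<^bsub>M\<^esub> idt M ?LX)) \<cdot>\<^sub>N \<eta> (T \<otimes>\<^bsub>N\<^esub> X)"
        using eq unfolding v(2) [symmetric] v'(2) [symmetric]
          transported_ev_sharp [OF o v(1)] transported_ev_sharp [OF o v'(1)] .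
      then have "ev ?LX \<cdot>\<^bsub>M\<^esub> (v \<boxtimes>\<^bsub>M\<^esub> idt M ?LX) = ev ?LX \<cdot>\<^bsub>M\<^esub> (v' \<boxtimes>\<^bsub>M\<^esub> idt M ?LX)"
        by (rule F.universal_arrow_eqI [OF univ, of "T \<otimes>\<^bsub>N\<^esub> X" _ "unt M", rotated 3]) (use o v v' in simp_all)
      then have "v = v'"
        by (rule M.dual_eqI [OF v(1) v'(1), rotated]) (use o in simp)
      then show "u = u'"
        using v v' by simp
    qed
    show "(\<lambda>u. transported_ev X \<cdot>\<^sub>N (u \<boxtimes>\<^sub>N idt N X)) ` hom N T (fob R ?DX) = hom N (T \<otimes>\<^bsub>N\<^esub> X) (unt N)"
    proof (intro equalityI subsetI)
      fix t
      assume "t \<in> hom N (T \<otimes>\<^bsub>N\<^esub> X) (unt N)"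
      then obtain w where w: "w \<in> hom M (fob L (T \<otimes>\<^bsub>N\<^esub> X)) (unt M)" "far R w \<cdot>\<^sub>N \<eta> (T \<otimes>\<^bsub>N\<^esub> X) = t"
        using lift [of "T \<otimes>\<^bsub>N\<^esub> X" "unt M" t] o by auto
      let ?v = "dagger M D ev ?LT ?LX w"
      have "transported_ev X \<cdot>\<^sub>N ((far R ?v \<cdot>\<^sub>N \<eta> T) \<boxtimes>\<^sub>N idt N X) = t"
        using w o by (subst transported_ev_sharp) simp_all
      moreover have "far R ?v \<cdot>\<^sub>N \<eta> T \<in> hom N T (fob R ?DX)"
        using w o by simp
      ultimately show "t \<in> (\<lambda>u. transported_ev X \<cdot>\<^sub>N (u \<boxtimes>\<^sub>N idt N X)) ` hom N T (fob R ?DX)"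
        by blast
    qed (use o in auto)
  qed
  then show ?thesis
    by (simp add: pre_rigid_def pre_dual_def)
qed

lemma pre_rigid_category_transported: "pre_rigid_category N (\<lambda>X. fob R (D (fob L X))) transported_ev"
  using N.braided_monoidal_category_axioms pre_rigid_transported by (rule pre_rigid_categoryI)

end

text \<open>\<open>ev'\<close> is an arbitrary evaluation on the objects R(D(L X)), possibly
  different from \<open>transported_ev\<close>, in accordance with the quantifier over evaluations
  in the theorem.\<close>

locale pre_rigid_comparison =
    pre_rigid_transfer M N L R \<eta> \<epsilon> D ev + N: pre_rigid_category N "\<lambda>X. fob R (D (fob L X))" ev'
  for M :: "('o, 'a) braided_category" and N :: "('p, 'b) braided_category"
    and L :: "('p, 'b, 'o, 'a) lax_functor" and R :: "('o, 'a, 'p, 'b) lax_functor"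
    and \<eta> :: "'p \<Rightarrow> 'b" and \<epsilon> :: "'o \<Rightarrow> 'a"
    and D :: "'o \<Rightarrow> 'o" and ev :: "'o \<Rightarrow> 'a" and ev' :: "'p \<Rightarrow> 'b"
begin

abbreviation D' :: "'p \<Rightarrow> 'p" where
  "D' \<equiv> \<lambda>X. fob R (D (fob L X))"

text \<open>An automorphism of \<open>D' X\<close>, and the identity only if the two evaluations at
  X agree. It measures how the dual functor given by \<open>ev'\<close> differs from the transported
  one on arrows and structure maps.\<close>

definition \<kappa> :: "'p \<Rightarrow> 'b" where
  "\<kappa> X = dagger N D' ev' (D' X) X (transported_ev X)"

lemma kappa_simps [simp]:
  assumes "X \<in> ob N"
  shows "\<kappa> X \<in> arr N" "src N (\<kappa> X) = D' X" "tgt N (\<kappa> X) = D' X" "iso_arr N (\<kappa> X)"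
  using assms N.comparison_iso [OF pre_rigid_category_transported assms] by (simp_all add: \<kappa>_def)

lemma ev_kappa:
  assumes "X \<in> ob N" "u \<in> hom N S (D' X)" "x \<in> hom N Z X"
  shows "ev' X \<cdot>\<^sub>N ((\<kappa> X \<cdot>\<^sub>N u) \<boxtimes>\<^sub>N x) = transported_ev X \<cdot>\<^sub>N (u \<boxtimes>\<^sub>N x)"
  unfolding \<kappa>_def by (rule N.ev_dagger) (use assms in simp_all)

lemma ev_kappa':
  assumes "X \<in> ob N" "x \<in> hom N Z X"
  shows "ev' X \<cdot>\<^sub>N (\<kappa> X \<boxtimes>\<^sub>N x) = transported_ev X \<cdot>\<^sub>N (idt N (D' X) \<boxtimes>\<^sub>N x)"
  using ev_kappa [of X "idt N (D' X)" "D' X" x Z] assms by simp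

text \<open>Under \<open>ev'\<close> the left side turns into \<open>transported_ev\<close>; there
  the arrow slides across the evaluation of \<open>M\<close>, and the result is the same sliding
  across \<open>ev'\<close> on the right.\<close>

lemma kappa_natural:
  assumes f: "f \<in> hom N X Y"
  shows "\<kappa> X \<cdot>\<^sub>N far R (dual_arr M D ev (far L f)) = dual_arr N D' ev' f \<cdot>\<^sub>N \<kappa> Y"
proof (rule N.dual_eqI [of _ "D' Y" X])
  have o: "X \<in> ob N" "Y \<in> ob N"
    using f by auto
  let ?LX = "fob L X" and ?LY = "fob L Y"
  have "ev' X \<cdot>\<^sub>N ((\<kappa> X \<cdot>\<^sub>N far R (dual_arr M D ev (far L f))) \<boxtimes>\<^sub>N idt N X)
    = transported_ev X \<cdot>\<^sub>N (far R (dual_arr M D ev (far L f)) \<boxtimes>\<^sub>N idt N X)"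
    by (rule ev_kappa) (use f o in simp_all)
  also have "\<dots> = far R (ev ?LX \<cdot>\<^bsub>M\<^esub> (dual_arr M D ev (far L f) \<boxtimes>\<^bsub>M\<^esub> far L (idt N X))) \<cdot>\<^sub>N (idt N (D' Y) \<boxtimes>\<^sub>N \<eta> X)"
    by (rule transported_ev_far) (use f o in simp_all)
  also have "\<dots> = far R (ev ?LY \<cdot>\<^bsub>M\<^esub> (idt M (D ?LY) \<boxtimes>\<^bsub>M\<^esub> far L f)) \<cdot>\<^sub>N (idt N (D' Y) \<boxtimes>\<^sub>N \<eta> X)"
    using f o by (simp add: M.ev_dual_arr' [of "far L f" ?LX ?LY])
  also have "\<dots> = transported_ev Y \<cdot>\<^sub>N (far R (idt M (D ?LY)) \<boxtimes>\<^sub>N f)"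
    by (rule transported_ev_far [symmetric]) (use f o in simp_all)
  also have "\<dots> = ev' Y \<cdot>\<^sub>N (\<kappa> Y \<boxtimes>\<^sub>N (f \<cdot>\<^sub>N idt N X))"
    using f o by (simp add: ev_kappa')
  also have "\<dots> = ev' X \<cdot>\<^sub>N ((dual_arr N D' ev' f \<cdot>\<^sub>N \<kappa> Y) \<boxtimes>\<^sub>N idt N X)"
    by (rule N.ev_dual_arr [symmetric]) (use f o in simp_all)
  finally show "ev' X \<cdot>\<^sub>N ((\<kappa> X \<cdot>\<^sub>N far R (dual_arr M D ev (far L f))) \<boxtimes>\<^sub>N idt N X)
    = ev' X \<cdot>\<^sub>N ((dual_arr N D' ev' f \<cdot>\<^sub>N \<kappa> Y) \<boxtimes>\<^sub>N idt N X)" .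
qed (use f in auto)

text \<open>Evaluation of the left side leaves the image under R of the tensor pairing of
  \<open>M\<close>, precomposed with the unit at X \<otimes> Y. \<open>R_tensor_pairing\<close>
  makes it a pairing in \<open>N\<close>, the unit splits as a tensor product, and naturality of the
  pairing absorbs its factors into the transported evaluations.\<close>

lemma kappa_lax2:
  assumes o: "X \<in> ob N" "Y \<in> ob N"
  shows "\<kappa> (X \<otimes>\<^bsub>N\<^esub> Y) \<cdot>\<^sub>N far R (lax2 (dual_functor M D ev) (fob L X) (fob L Y))
    = lax2 (dual_functor N D' ev') X Y \<cdot>\<^sub>N (\<kappa> X \<boxtimes>\<^sub>N \<kappa> Y)" (is "?l = ?r")
proof (rule N.dual_eqI [of _ "D' X \<otimes>\<^bsub>N\<^esub> D' Y" "X \<otimes>\<^bsub>N\<^esub> Y"])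
  let ?LX = "fob L X" and ?LY = "fob L Y" and ?T = "X \<otimes>\<^bsub>N\<^esub> Y"
  let ?p = "lax2 (dual_functor M D ev) ?LX ?LY"
  have "ev' ?T \<cdot>\<^sub>N (?l \<boxtimes>\<^sub>N idt N ?T) = transported_ev ?T \<cdot>\<^sub>N (far R ?p \<boxtimes>\<^sub>N idt N ?T)"
    by (rule ev_kappa) (use o in simp_all)
  also have "\<dots> = far R (ev (fob L ?T) \<cdot>\<^bsub>M\<^esub> (?p \<boxtimes>\<^bsub>M\<^esub> far L (idt N ?T))) \<cdot>\<^sub>N (idt N (fob R (D ?LX \<otimes>\<^bsub>M\<^esub> D ?LY)) \<boxtimes>\<^sub>N \<eta> ?T)"
    by (rule transported_ev_far) (use o in simp_all)
  also have "\<dots> = far R (M.tensor_pairing (D ?LX) ?LX (D ?LY) ?LY (ev ?LX) (ev ?LY))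
      \<cdot>\<^sub>N ((idt N (D' X) \<boxtimes>\<^sub>N idt N (D' Y)) \<boxtimes>\<^sub>N (\<eta> X \<boxtimes>\<^sub>N \<eta> Y))"
    using o by (simp add: M.ev_lax2')
  also have "\<dots> = N.tensor_pairing (D' X) (fob R ?LX) (D' Y) (fob R ?LY) (far R (ev ?LX)) (far R (ev ?LY))
      \<cdot>\<^sub>N ((idt N (D' X) \<boxtimes>\<^sub>N idt N (D' Y)) \<boxtimes>\<^sub>N (\<eta> X \<boxtimes>\<^sub>N \<eta> Y))"
    using o by (subst R_tensor_pairing) simp_all
  also have "\<dots> = N.tensor_pairing (D' X) X (D' Y) Y (transported_ev X) (transported_ev Y)"
    unfolding transported_ev_def by (rule N.tensor_pairing_natural [symmetric]) (use o in simp_all)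
  also have "\<dots> = N.tensor_pairing (D' X) X (D' Y) Y (ev' X \<cdot>\<^sub>N (\<kappa> X \<boxtimes>\<^sub>N idt N X)) (ev' Y \<cdot>\<^sub>N (\<kappa> Y \<boxtimes>\<^sub>N idt N Y))
      \<cdot>\<^sub>N (idt N (D' X \<otimes>\<^bsub>N\<^esub> D' Y) \<boxtimes>\<^sub>N idt N ?T)"
    using o by (simp add: ev_kappa')
  also have "\<dots> = ev' ?T \<cdot>\<^sub>N (?r \<boxtimes>\<^sub>N idt N ?T)"
    by (rule N.ev_lax2 [symmetric]) (use o in simp_all)
  finally show "ev' ?T \<cdot>\<^sub>N (?l \<boxtimes>\<^sub>N idt N ?T) = ev' ?T \<cdot>\<^sub>N (?r \<boxtimes>\<^sub>N idt N ?T)" .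
qed (use o in simp_all)

lemma kappa_lax0: "\<kappa> (unt N) \<cdot>\<^sub>N far R (lax0 (dual_functor M D ev)) = lax0 (dual_functor N D' ev')" (is "?l = ?r")
proof (rule N.dual_eqI [of _ "unt N" "unt N"])
  let ?I = "unt N" and ?z = "lax0 (dual_functor M D ev)"
  have "ev' ?I \<cdot>\<^sub>N (?l \<boxtimes>\<^sub>N idt N ?I) = transported_ev ?I \<cdot>\<^sub>N (far R ?z \<boxtimes>\<^sub>N idt N ?I)"
    by (rule ev_kappa) simp_all
  also have "\<dots> = far R (ev (fob L ?I) \<cdot>\<^bsub>M\<^esub> (?z \<boxtimes>\<^bsub>M\<^esub> far L (idt N ?I))) \<cdot>\<^sub>N (idt N (fob R (unt M)) \<boxtimes>\<^sub>N \<eta> ?I)"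
    by (rule transported_ev_far) simp_all
  also have "\<dots> = ev' ?I \<cdot>\<^sub>N (?r \<boxtimes>\<^sub>N idt N ?I)"
    by simp
  finally show "ev' ?I \<cdot>\<^sub>N (?l \<boxtimes>\<^sub>N idt N ?I) = ev' ?I \<cdot>\<^sub>N (?r \<boxtimes>\<^sub>N idt N ?I)" .
qed simp_all

lemma has_left_adjoint_transfer:
  assumes adj: "has_left_adjoint (Alg (op_cat M)) (Alg M) (Alg_functor M (dual_functor M D ev))"
  shows "has_left_adjoint (Alg (op_cat N)) (Alg N) (Alg_functor N (dual_functor N D' ev'))"
proof -
  let ?FM = "dual_functor M D ev" and ?FN = "dual_functor N D' ev'"
  let ?G = "comp_functor (Alg_functor N R) (comp_functor (Alg_functor M ?FM) (Alg_functor (op_cat M) L))"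
  interpret opN: monoidal_category "op_cat N"
    by (rule N.monoidal_category_op)
  interpret op: monoidal_adjunction "op_cat N" "op_cat M" R L \<epsilon> \<eta>
    by (rule monoidal_adjunction_op)
  interpret FM: lax_monoidal_functor "op_cat M" M ?FM
    by (rule M.lax_monoidal_dual_functor)
  interpret FN: lax_monoidal_functor "op_cat N" N ?FN
    by (rule N.lax_monoidal_dual_functor)
  have G: "has_left_adjoint (Alg (op_cat N)) (Alg N) ?G"
    by (rule has_left_adjoint_comp [OF has_left_adjoint_comp [OF op.has_left_adjoint_Alg adj] has_left_adjoint_Alg])
  have G_ob: "fob ?G X = Alg_ob N R (Alg_ob M ?FM (Alg_ob (op_cat M) L X))" for X
    by (simp add: comp_functor_def)
  have G_far: "far ?G (X, f, Y) = (fob ?G X, far R (dual_arr M D ev (far L f)), fob ?G Y)" for X f Y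
    by (simp add: comp_functor_def)
  have G_alg: "fob ?G X \<in> algebras N" if "X \<in> algebras (op_cat N)" for X
    unfolding G_ob using that by (intro F.Alg_ob_algebra FM.Alg_ob_algebra op.F.Alg_ob_algebra)
  \<comment> \<open>On underlying arrows the comparison of \<open>?G\<close> with the dual functor
    of \<open>N\<close> is \<kappa>. Its naturality at comultiplication and counit, with
    \<open>kappa_lax2\<close> and \<open>kappa_lax0\<close>, makes it an algebra morphism; it is
    invertible because \<kappa> is.\<close>
  let ?\<tau> = "\<lambda>X. (fob ?G X, \<kappa> (fst X), Alg_ob N ?FN X)"
  have morphism: "algebra_morphism N (fob ?G X) (\<kappa> (fst X)) (Alg_ob N ?FN X)" if alg: "X \<in> algebras (op_cat N)" for X
  proof -
    obtain A d e where X: "X = (A, d, e)"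
      by (cases X)
    have o [simp]: "A \<in> ob N" "d \<in> arr N" "src N d = A" "tgt N d = A \<otimes>\<^bsub>N\<^esub> A" "e \<in> arr N" "src N e = A" "tgt N e = unt N"
      using alg by (auto simp: X algebras_def)
    have d: "\<kappa> A \<cdot>\<^sub>N far R (dual_arr M D ev (far L d)) = dual_arr N D' ev' d \<cdot>\<^sub>N \<kappa> (A \<otimes>\<^bsub>N\<^esub> A)"
      and e: "\<kappa> A \<cdot>\<^sub>N far R (dual_arr M D ev (far L e)) = dual_arr N D' ev' e \<cdot>\<^sub>N \<kappa> (unt N)"
      by (auto intro!: kappa_natural)
    have "\<kappa> A \<cdot>\<^sub>N far R (dual_arr M D ev (far L d)) \<cdot>\<^sub>N far R (lax2 ?FM (fob L A) (fob L A))
      = dual_arr N D' ev' d \<cdot>\<^sub>N \<kappa> (A \<otimes>\<^bsub>N\<^esub> A) \<cdot>\<^sub>N far R (lax2 ?FM (fob L A) (fob L A))"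
      using N.cmp_extend [OF d, of "far R (lax2 ?FM (fob L A) (fob L A))"] by simp
    moreover have "\<kappa> A \<cdot>\<^sub>N far R (dual_arr M D ev (far L e)) \<cdot>\<^sub>N far R (lax0 ?FM)
      = dual_arr N D' ev' e \<cdot>\<^sub>N \<kappa> (unt N) \<cdot>\<^sub>N far R (lax0 ?FM)"
      using N.cmp_extend [OF e, of "far R (lax0 ?FM)"] by simp
    ultimately show ?thesis
      unfolding G_ob kappa_lax2 [OF o(1) o(1)] kappa_lax0
      by (simp add: X Alg_ob_def algebra_morphism_def F.far_cmp_simp)
  qed
  show ?thesis
  proof (rule has_left_adjoint_iso [OF G FN.cat_functor_Alg, of ?\<tau>])
    fix X
    assume "X \<in> ob (Alg (op_cat N))"
    then have X: "X \<in> algebras (op_cat N)"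
      by simp
    show "?\<tau> X \<in> hom (Alg N) (fob ?G X) (fob (Alg_functor N ?FN) X)"
      unfolding hom_Alg_iff using G_alg [OF X] morphism [OF X] FN.Alg_ob_algebra [OF X] by simp
    show "iso_arr (Alg N) (?\<tau> X)"
      using fst_algebras [OF X]
      by (intro N.iso_Alg G_alg [OF X] morphism [OF X] FN.Alg_ob_algebra [OF X]) simp
  next
    fix f X Y
    assume "f \<in> hom (Alg (op_cat N)) X Y"
    then obtain f' where f: "f = (X, f', Y)" "algebra_morphism (op_cat N) X f' Y"
      unfolding hom_Alg_iff by blast
    have "\<kappa> (fst Y) \<cdot>\<^sub>N far R (dual_arr M D ev (far L f')) = dual_arr N D' ev' f' \<cdot>\<^sub>N \<kappa> (fst X)"
      using algebra_morphism_hom [OF f(2)] by (intro kappa_natural) auto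
    then show "?\<tau> Y \<cdot>\<^bsub>Alg N\<^esub> far ?G f = far (Alg_functor N ?FN) f \<cdot>\<^bsub>Alg N\<^esub> ?\<tau> X"
      unfolding f(1) G_far by simp
  qed
qed

end

theorem proposition4p8:
  fixes M :: "('o, 'a) braided_category" and N :: "('p, 'b) braided_category"
    and R :: "('o, 'a, 'p, 'b) lax_functor" and L :: "('p, 'b, 'o, 'a) lax_functor"
    and \<eta> :: "'p \<Rightarrow> 'b" and \<epsilon> :: "'o \<Rightarrow> 'a"
    and D :: "'o \<Rightarrow> 'o" and ev :: "'o \<Rightarrow> 'a"
  assumes "braided_monoidal_category M"
    and "braided_monoidal_category N"
    and "pre_rigid M D ev"
    and "monoidal_adjunction M N L R \<eta> \<epsilon>"
    and "strict_monoidal_functor N M L"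
    and "strict_monoidal_functor M N R"
    and "braided_lax_monoidal_functor N M L"
  defines "D\<^sub>N \<equiv> (\<lambda>X. fob R (D (fob L X)))"
  shows "(\<exists>ev\<^sub>N. pre_rigid N D\<^sub>N ev\<^sub>N) \<and>
    (has_left_adjoint (Alg (op_cat M)) (Alg M) (Alg_functor M (dual_functor M D ev)) \<longrightarrow>
      (\<forall>ev\<^sub>N. pre_rigid N D\<^sub>N ev\<^sub>N \<longrightarrow>
        liftable_pair (op_cat N) N (dual_functor_op N D\<^sub>N ev\<^sub>N) (dual_functor N D\<^sub>N ev\<^sub>N)
          (dual_unit N D\<^sub>N ev\<^sub>N) (dual_counit N D\<^sub>N ev\<^sub>N)))"
proof -
  have transfer: "pre_rigid_transfer M N L R \<eta> \<epsilon> D ev"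
    by (intro pre_rigid_transfer.intro strict_monoidal_adjunction.intro pre_rigid_categoryI assms)
  show ?thesis
  proof (intro conjI impI allI)
    show "\<exists>ev\<^sub>N. pre_rigid N D\<^sub>N ev\<^sub>N"
      using pre_rigid_transfer.pre_rigid_transported [OF transfer] unfolding D\<^sub>N_def by blast
  next
    fix ev\<^sub>N
    assume adj: "has_left_adjoint (Alg (op_cat M)) (Alg M) (Alg_functor M (dual_functor M D ev))"
      and "pre_rigid N D\<^sub>N ev\<^sub>N"
    \<comment> \<open>Only the objects of the dual are prescribed here, so \<open>ev\<^sub>N\<close>
      enters as the evaluation \<open>ev'\<close> of the comparison locale.\<close>
    then have N: "pre_rigid_category N (\<lambda>X. fob R (D (fob L X))) ev\<^sub>N"
      using assms(2) pre_rigid_categoryI unfolding D\<^sub>N_def by blast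
    interpret pre_rigid_comparison M N L R \<eta> \<epsilon> D ev ev\<^sub>N
      by (rule pre_rigid_comparison.intro [OF transfer N])
    show "liftable_pair (op_cat N) N (dual_functor_op N D\<^sub>N ev\<^sub>N) (dual_functor N D\<^sub>N ev\<^sub>N)
          (dual_unit N D\<^sub>N ev\<^sub>N) (dual_counit N D\<^sub>N ev\<^sub>N)"
      unfolding D\<^sub>N_def by (rule N.liftable_dual [OF has_left_adjoint_transfer [OF adj]])
  qed
qed

end
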